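(* Let $d,n\in\mathbb N$ (positive integers) with $2n-d>0$. Then for all $u\in H^n(\mathbb T^d)$ with zero mean, $$\|u\|^2_{C(\mathbb T^d)}\le c_d(n)\,\|u\|_{L^2}^{2-d/n}\,\|(-\Delta)^{n/2}u\|_{L^2}^{d/n}-K_d(n)\,\|u\|^2_{L^2},$$ where $$c_d(n):=\frac1{(2\pi)^d}\cdot\frac{\pi\,\omega(d)}{\sin\left(\frac{\pi d}{2n}\right)\, d^{\,d/(2n)}\,(2n-d)^{1-d/(2n)}},$$ and the constant $$K_d(n):=\inf_{\delta\ge1}\big\{c_d(n)\,\delta^{d/(2n)}-\Theta_{d,n}(\delta)\big\}$$ is finite and satisfies $K_d(n)\le\frac{2n}{(2\pi)^d(2n-d)}$.
   Context: $\mathbb T^d=(\mathbb R/2\pi\mathbb Z)^d$ with Lebesgue measure; $L^2$ norms are over $\mathbb T^d$. $\omega(d)=\frac{2\pi^{d/2}}{\Gamma(d/2)}$ is the surface area of the unit sphere in $\mathbb R^d$. For $\delta\ge1$, $$\Theta_{d,n}(\delta):=\sup\Big\{\|u\|_{C(\mathbb T^d)}^2:\ u\in H^n(\mathbb T^d),\ \int_{\mathbb T^d}u\,dx=0,\ \|u\|_{L^2}=1,\ \|(-\Delta)^{n/2}u\|_{L^2}^2=\delta\Big\}.$$ *)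

theory Defs
  imports "HOL-Analysis.Analysis"
begin

text \<open>
  The dimension is the cardinality of the finite index type. Functions on the torus
  are functions on Euclidean space that are \<open>2\<pi>\<close>-periodic in each coordinate; integration over the
  torus is integration over one period cell. Complex values are allowed, which includes the
  real-valued case.
\<close>

definition torus :: "(real ^ 'd::finite) measure" where
  "torus = lebesgue_on (cbox 0 (\<chi> i. 2 * pi))"

definition torus_periodic :: "(real ^ 'd::finite \<Rightarrow> complex) \<Rightarrow> bool" where
  "torus_periodic u \<longleftrightarrow> (\<forall>x i. u (x + axis i (2 * pi)) = u x)"

definition torus_L2 :: "(real ^ 'd::finite \<Rightarrow> complex) set" where
  "torus_L2 = {u. torus_periodic u \<and> u \<in> borel_measurable torus \<and>
                  integrable torus (\<lambda>x. (cmod (u x))\<^sup>2)}"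

definition L2_norm :: "(real ^ 'd::finite \<Rightarrow> complex) \<Rightarrow> real" where
  "L2_norm u = sqrt (LINT x|torus. (cmod (u x))\<^sup>2)"

definition freq :: "int ^ 'd::finite \<Rightarrow> real ^ 'd" where
  "freq k = (\<chi> i. real_of_int (k $ i))"

definition fourier_coeff :: "(real ^ 'd::finite \<Rightarrow> complex) \<Rightarrow> int ^ 'd \<Rightarrow> complex" where
  "fourier_coeff u k =
     (LINT x|torus. u x * cis (- (freq k \<bullet> x))) / complex_of_real ((2 * pi) ^ CARD('d))"

definition torus_H :: "nat \<Rightarrow> (real ^ 'd::finite \<Rightarrow> complex) set" where
  "torus_H n = {u \<in> torus_L2.
     (\<lambda>k. (1 + (norm (freq k))\<^sup>2) ^ n * (cmod (fourier_coeff u k))\<^sup>2) summable_on UNIV}"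

text \<open>
  The operator \<open>(-\<Delta>)\<^bsup>n/2\<^esup>\<close> is the Fourier multiplier with symbol \<open>|k|\<^sup>n\<close>.
  On \<open>torus_H n\<close> the chosen function exists and is unique up to null sets, so its \<open>L\<^sup>2\<close>-norm does not
  depend on the choice.
\<close>

definition neg_laplacian_half_power ::
    "nat \<Rightarrow> (real ^ 'd::finite \<Rightarrow> complex) \<Rightarrow> real ^ 'd \<Rightarrow> complex" where
  "neg_laplacian_half_power n u =
     (SOME v. v \<in> torus_L2 \<and>
        (\<forall>k. fourier_coeff v k = complex_of_real (norm (freq k) ^ n) * fourier_coeff u k))"

text \<open>
  Elements of \<open>L\<^sup>2\<close> are only determined almost everywhere, so the norm of \<open>C(T\<^sup>d)\<close> is the
  supremum norm of the continuous periodic representative. That representative is unique if it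
  exists, so the infimum ranges over at most one function; it is \<open>\<infinity>\<close> exactly when no
  continuous representative exists.
\<close>

definition C_norm :: "(real ^ 'd::finite \<Rightarrow> complex) \<Rightarrow> ereal" where
  "C_norm u = (INF v \<in> {v. continuous_on UNIV v \<and> torus_periodic v \<and> (AE x in torus. v x = u x)}.
                 SUP x. ereal (cmod (v x)))"

text \<open>
  Suprema and infima are taken in the extended reals, so that finiteness is an
  actual claim and no default value of a real \<open>Sup\<close> or \<open>Inf\<close> can occur.
\<close>

definition Theta :: "'d::finite itself \<Rightarrow> nat \<Rightarrow> real \<Rightarrow> ereal" where
  "Theta _ n \<delta> = Sup {(C_norm u)\<^sup>2 | u :: real ^ 'd \<Rightarrow> complex.
      u \<in> torus_H n \<and> (LINT x|torus. u x) = 0 \<and> L2_norm u = 1 \<and>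
      (L2_norm (neg_laplacian_half_power n u))\<^sup>2 = \<delta>}"

definition sphere_area :: "nat \<Rightarrow> real" where
  "sphere_area d = 2 * pi powr (real d / 2) / Gamma (real d / 2)"

definition c_const :: "nat \<Rightarrow> nat \<Rightarrow> real" where
  "c_const d n = 1 / (2 * pi) ^ d *
     (pi * sphere_area d /
       (sin (pi * real d / (2 * real n)) * real d powr (real d / (2 * real n)) *
        (2 * real n - real d) powr (1 - real d / (2 * real n))))"

definition K_const :: "'d::finite itself \<Rightarrow> nat \<Rightarrow> ereal" where
  "K_const T n = (INF \<delta> \<in> {1..}.
     ereal (c_const CARD('d) n * \<delta> powr (real CARD('d) / (2 * real n))) - Theta T n \<delta>)"

end

theory Submission
  imports Defs "HOL-Complex_Analysis.Cauchy_Integral_Formula"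
begin

text \<open>
Write \<open>N = (2\<pi>)\<^sup>d\<close>, \<open>a = d/(2n)\<close> and, for a scale \<open>R > 0\<close>, \<open>f(x) = 1/(|x|\<^sup>2\<^sup>n + R\<^sup>2\<^sup>n)\<close>. A function of mean zero with
\<open>\<parallel>u\<parallel> = 1\<close> and \<open>\<parallel>(-\<Delta>)\<^bsup>n/2\<^esup>u\<parallel>\<^sup>2 = \<delta>\<close> has \<open>N \<Sum> |u\<^sub>k|\<^sup>2/f(k) = \<delta> + R\<^sup>2\<^sup>n\<close>, so by Cauchy--Schwarz
\<open>N \<Theta>(\<delta>) \<le> (\<delta> + R\<^sup>2\<^sup>n) \<Sum> f(k)\<close> for every \<open>R\<close> (\<open>Theta_le\<close>); conversely the normalized series
\<open>\<Sum> f(k) e\<^bsup>ikx\<^esup>\<close> over \<open>k \<noteq> 0\<close> gives equality for its own \<open>\<delta>\<close>, once the term \<open>k = 0\<close> is dropped from the sum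
(\<open>Theta_extremal\<close>). If the sum is replaced by \<open>J(R) = \<integral> f = I R\<^sup>d/R\<^sup>2\<^sup>n\<close>, the weighted
arithmetic--geometric mean inequality minimizes \<open>(\<delta> + R\<^sup>2\<^sup>n) J(R)\<close> over \<open>R\<close>, and the minimum is
exactly \<open>N c\<^sub>d(n) \<delta>\<^sup>a\<close> (\<open>c_const_weighted_mean\<close>). This is where the constant comes from.

What remains is to control the difference between the lattice sums of \<open>f\<close> and \<open>f\<^sup>2\<close> and their
integrals. The normalized sum \<open>R\<^sup>2\<^sup>n \<Sum> f(k)\<close> is of size \<open>R\<^sup>d\<close> and is needed with error \<open>o(1)\<close>, which a
comparison of cells does not give for \<open>d > 1\<close>. Instead of Poisson summation the following
device is used. Averaging \<open>\<Sum>\<^sub>k f(k + j s)\<close> over \<open>s\<close> in the unit cube gives \<open>\<integral> f\<close> for every integer \<open>j > 0\<close>, and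
\<open>\<Sum> f(k)\<close> for \<open>j = 0\<close>. Hence the average of the \<open>m\<close>-th difference \<open>\<Sum>\<^sub>j (-1)\<^sup>j (m choose j) f(k + j s)\<close>,
summed over \<open>k\<close>, is precisely \<open>\<Sum> f(k) - \<integral> f\<close> (\<open>lattice_sum_near_integral\<close>). Along every line \<open>x + z s\<close> with \<open>s\<close> in the cube, \<open>f\<close>
is holomorphic for \<open>|z|\<close> up to a multiple of \<open>R\<close>, so Cauchy's inequality bounds that difference by \<open>C R\<^sup>-\<^sup>m f(k)\<close>
(\<open>resolvent_power_difference\<close>), and \<open>m = d + 1\<close> suffices.

With \<open>s\<close> now standing for \<open>I R\<^sup>d\<close>, this yields \<open>y = R\<^sup>2\<^sup>n \<Sum>\<^bsub>k\<noteq>0\<^esub> f(k) = s - 1 + o(1)\<close> and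
\<open>g = R\<^sup>4\<^sup>n \<Sum>\<^bsub>k\<noteq>0\<^esub> f(k)\<^sup>2 = (1 - a) s - 1 + o(1)\<close>. The first expansion bounds \<open>\<Theta>(\<delta>) - c\<^sub>d(n) \<delta>\<^sup>a\<close> from above, so
\<open>K\<^sub>d(n) > -\<infinity>\<close> (\<open>Theta_le_c_const\<close>); at the extremal series the quantity
\<open>N (c\<^sub>d(n) \<delta>\<^sup>a - \<Theta>(\<delta>))\<close> is at most \<open>y (s - y)/g\<close>, which tends to \<open>1/(1 - a) = 2n/(2n - d)\<close> (\<open>K_const_upper\<close>). The inequality
for a general \<open>u\<close> is the definition of \<open>K\<^sub>d(n)\<close> applied to \<open>u/\<parallel>u\<parallel>\<close>; here \<open>\<delta> \<ge> 1\<close> is the Poincare inequality.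

The Fourier analysis behind these steps is developed on the way: the Riesz--Fischer theorem makes
\<open>(-\<Delta>)\<^bsup>n/2\<^esup>u\<close> exist, and uniqueness of Fourier coefficients identifies it and provides the continuous
representative of \<open>u\<close>.
\<close>

section \<open>Finite differences of holomorphic functions\<close>

lemma alternating_binomial_sum_Suc:
  fixes g :: "nat \<Rightarrow> 'a::comm_ring_1"
  shows "(\<Sum>j\<le>Suc m. (-1) ^ j * of_nat (Suc m choose j) * g j) =
         (\<Sum>j\<le>m. (-1) ^ j * of_nat (m choose j) * (g j - g (Suc j)))"
proof -
  have "(\<Sum>j\<le>Suc m. (-1) ^ j * of_nat (Suc m choose j) * g j) =
        g 0 + (\<Sum>j\<le>m. (-1) ^ Suc j * of_nat (Suc m choose Suc j) * g (Suc j))"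
    by (subst sum.atMost_Suc_shift) simp
  also have "\<dots> = g 0 + (\<Sum>j\<le>m. (-1) ^ Suc j * of_nat (m choose Suc j) * g (Suc j))
        - (\<Sum>j\<le>m. (-1) ^ j * of_nat (m choose j) * g (Suc j))"
    by (simp add: ring_distribs sum.distrib sum_negf sum_subtractf)
  also have "g 0 + (\<Sum>j\<le>m. (-1) ^ Suc j * of_nat (m choose Suc j) * g (Suc j)) =
        (\<Sum>j\<le>Suc m. (-1) ^ j * of_nat (m choose j) * g j)"
    by (subst sum.atMost_Suc_shift) simp
  also have "\<dots> = (\<Sum>j\<le>m. (-1) ^ j * of_nat (m choose j) * g j)"
    by (simp add: binomial_eq_0)
  finally show ?thesis by (simp add: algebra_simps sum_subtractf)
qed

text \<open>
The sequence \<open>D\<close> lists a function and its successive derivatives, so that passing to the first difference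
\<open>D\<^sub>i(t) - D\<^sub>i(t + 1)\<close> preserves the hypotheses; the mean value theorem is used once per induction step.
\<close>

lemma difference_le_derivative_bound:
  fixes D :: "nat \<Rightarrow> real \<Rightarrow> complex"
  assumes "\<And>i t. i < m \<Longrightarrow> 0 \<le> t \<Longrightarrow> t \<le> real m \<Longrightarrow> (D i has_vector_derivative D (Suc i) t) (at t)"
    and "\<And>t. 0 \<le> t \<Longrightarrow> t \<le> real m \<Longrightarrow> norm (D m t) \<le> B"
  shows "norm (\<Sum>j\<le>m. (-1) ^ j * of_nat (m choose j) * D 0 (real j)) \<le> B"
  using assms
proof (induction m arbitrary: D)
  case 0
  then show ?case by simp
next
  case (Suc m)
  define E where "E i t = D i t - D i (t + 1)" for i t
  have "norm (\<Sum>j\<le>m. (-1) ^ j * of_nat (m choose j) * E 0 (real j)) \<le> B"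
  proof (rule Suc.IH)
    fix i t assume it: "i < m" "0 \<le> t" "t \<le> real m"
    have D1: "(D i has_vector_derivative D (Suc i) t) (at t)"
      and D2: "(D i has_vector_derivative D (Suc i) (t + 1)) (at (t + 1))"
      using it by (auto intro: Suc.prems(1))
    have "((\<lambda>t. t + 1) has_vector_derivative 1) (at t)"
      by (auto intro!: derivative_eq_intros)
    from vector_diff_chain_at[OF this D2]
    have "((\<lambda>t. D i (t + 1)) has_vector_derivative D (Suc i) (t + 1)) (at t)"
      by (simp add: o_def)
    then show "(E i has_vector_derivative E (Suc i) t) (at t)"
      unfolding E_def using D1 by (intro has_vector_derivative_diff)
  next
    fix t assume t: "0 \<le> t" "t \<le> real m"
    have "norm (D m t - D m (t + 1)) \<le> B * norm (t - (t + 1))"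
    proof (rule differentiable_bound[of "{t..t+1}" _ "\<lambda>s h. h *\<^sub>R D (Suc m) s"])
      fix s assume "s \<in> {t..t+1}"
      then have s: "0 \<le> s" "s \<le> real (Suc m)" using t by auto
      show "(D m has_derivative (\<lambda>h. h *\<^sub>R D (Suc m) s)) (at s within {t..t+1})"
        using Suc.prems(1)[of m s] s unfolding has_vector_derivative_def
        by (auto intro: has_derivative_at_withinI)
      show "onorm (\<lambda>h. h *\<^sub>R D (Suc m) s) \<le> B"
        using Suc.prems(2)[OF s] by (intro onorm_le) (simp add: mult.commute[of B] mult_left_mono)
    qed auto
    then show "norm (E m t) \<le> B" by (simp add: E_def)
  qed
  then show ?case
    by (subst alternating_binomial_sum_Suc) (simp add: E_def add.commute)
qed

text \<open>
Cauchy's inequality on discs of radius \<open>\<rho>/2\<close> around the points of \<open>[0, m]\<close> bounds the \<open>m\<close>-th derivative.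
\<close>

lemma holomorphic_difference_bound:
  fixes h :: "complex \<Rightarrow> complex"
  assumes hol: "h holomorphic_on ball 0 \<rho>" and \<rho>: "2 * real m < \<rho>"
    and bd: "\<And>z. norm z < \<rho> \<Longrightarrow> norm (h z) \<le> B"
  shows "norm (\<Sum>j\<le>m. (-1) ^ j * of_nat (m choose j) * h (of_nat j)) \<le> fact m * B * (2 / \<rho>) ^ m"
proof -
  have \<rho>0: "\<rho> > 0" using \<rho> by linarith
  have "norm (\<Sum>j\<le>m. (-1) ^ j * of_nat (m choose j) *
            (\<lambda>i t. (deriv ^^ i) h (complex_of_real t)) 0 (real j)) \<le> fact m * B * (2 / \<rho>) ^ m"
  proof (rule difference_le_derivative_bound)
    fix i :: nat and t :: real assume t: "0 \<le> t" "t \<le> real m"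
    have "complex_of_real t \<in> ball 0 \<rho>" using t \<rho> by simp
    moreover have "(deriv ^^ i) h holomorphic_on ball 0 \<rho>"
      by (intro holomorphic_higher_deriv hol) simp
    ultimately have "((deriv ^^ i) h has_field_derivative deriv ((deriv ^^ i) h) (of_real t))
        (at (of_real t))"
      by (rule_tac holomorphic_derivI) auto
    then show "((\<lambda>t. (deriv ^^ i) h (complex_of_real t)) has_vector_derivative
       (deriv ^^ Suc i) h (complex_of_real t)) (at t)"
      using has_vector_derivative_real_field[of "(deriv ^^ i) h" _ t UNIV] by simp
  next
    fix t :: real assume t: "0 \<le> t" "t \<le> real m"
    have sub: "cball (complex_of_real t) (\<rho> / 2) \<subseteq> ball 0 \<rho>"
      using t \<rho> by (subst cball_subset_ball_iff) (auto simp: dist_norm)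
    have "norm ((deriv ^^ m) h (complex_of_real t)) \<le> fact m * B / (\<rho> / 2) ^ m"
    proof (rule Cauchy_inequality)
      show "h holomorphic_on ball (complex_of_real t) (\<rho> / 2)"
        using sub ball_subset_cball by (intro holomorphic_on_subset[OF hol]) blast
      show "continuous_on (cball (complex_of_real t) (\<rho> / 2)) h"
        using sub by (intro holomorphic_on_imp_continuous_on holomorphic_on_subset[OF hol])
      fix x assume "norm (complex_of_real t - x) = \<rho> / 2"
      then have "x \<in> cball (complex_of_real t) (\<rho> / 2)" by (simp add: dist_norm)
      with sub have "x \<in> ball 0 \<rho>" by blast
      then show "norm (h x) \<le> B" by (intro bd) simp
    qed (use \<rho>0 in auto)
    then show "norm ((deriv ^^ m) h (complex_of_real t)) \<le> fact m * B * (2 / \<rho>) ^ m"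
      by (simp add: power_divide field_simps)
  qed
  then show ?thesis by simp
qed

section \<open>Differences of the resolvent weights\<close>

text \<open>
At lattice points this is the Fourier multiplier of \<open>((-\<Delta>)\<^sup>n + R\<^sup>2\<^sup>n)\<^sup>-\<^sup>1\<close>. The length \<open>R\<close> is used in place of the spectral parameter
\<open>R\<^sup>2\<^sup>n\<close> because the function varies on the scale \<open>R\<close>.
\<close>

definition resolvent :: "nat \<Rightarrow> real \<Rightarrow> 'a::euclidean_space \<Rightarrow> real" where
  "resolvent n R x = 1 / (norm x ^ (2 * n) + R ^ (2 * n))"

lemma resolvent_pos: "R > 0 \<Longrightarrow> resolvent n R x > 0"
  unfolding resolvent_def by (intro divide_pos_pos add_nonneg_pos) auto

lemma norm_power_difference_le:
  fixes w v :: complex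
  assumes "norm w \<le> M" "norm v \<le> M"
  shows "norm (w ^ n - v ^ n) \<le> real n * M ^ (n - 1) * norm (w - v)"
proof (cases "n = 0")
  case False
  have M: "M \<ge> 0" using assms(1) norm_ge_zero order_trans by blast
  have "w ^ n - v ^ n = (w - v) * (\<Sum>i<n. v ^ (n - Suc i) * w ^ i)"
    using power_diff_sumr2 by blast
  moreover have "norm (\<Sum>i<n. v ^ (n - Suc i) * w ^ i) \<le> of_nat (card {..<n}) * M ^ (n - 1)"
  proof (rule sum_norm_bound)
    fix i assume "i \<in> {..<n}"
    then have "n - 1 = (n - Suc i) + i" by auto
    then have "M ^ (n - 1) = M ^ (n - Suc i) * M ^ i" by (metis power_add)
    then show "norm (v ^ (n - Suc i) * w ^ i) \<le> M ^ (n - 1)"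
      using assms M by (simp add: norm_mult norm_power mult_mono power_mono)
  qed
  ultimately show ?thesis
    by (simp add: norm_mult mult.commute mult_left_mono)
qed simp

text \<open>
With \<open>P(z) = |x + z s|\<^sup>2\<close> extended to complex \<open>z\<close>, a displacement \<open>|z s| \<le> \<epsilon> R\<close> moves \<open>P\<close> by at most
\<open>2\<epsilon>(|x|\<^sup>2 + R\<^sup>2)\<close>. The \<open>n\<close>-th power then moves by a small multiple of \<open>(|x|\<^sup>2 + R\<^sup>2)\<^sup>n\<close>, which is comparable to
the denominator itself; the value of \<open>\<epsilon>\<close> makes that multiple one half.
\<close>

lemma resolvent_denominator_stable:
  fixes x s :: "'a::euclidean_space" and z :: complex
  assumes "R > 0" "n > 0" and \<epsilon>: "\<epsilon> = 1 / (2 * real n * 8 ^ n)" and z: "norm s * norm z \<le> \<epsilon> * R"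
  shows "(norm x ^ (2 * n) + R ^ (2 * n)) / 2 \<le>
    norm ((of_real ((norm x)\<^sup>2) + 2 * z * of_real (x \<bullet> s) + z\<^sup>2 * of_real ((norm s)\<^sup>2)) ^ n + of_real (R ^ (2 * n)))"
proof -
  define A where "A = (norm x)\<^sup>2 + R\<^sup>2"
  define P where "P = of_real ((norm x)\<^sup>2) + 2 * z * of_real (x \<bullet> s) + z\<^sup>2 * of_real ((norm s)\<^sup>2)"
  have A: "A > 0" using assms(1) by (simp add: A_def add_nonneg_pos)
  have \<epsilon>0: "\<epsilon> > 0" using assms by simp
  have "(1 :: real) * 1 \<le> (2 * real n) * 8 ^ n" using assms(2) by (intro mult_mono) auto
  then have \<epsilon>1: "\<epsilon> \<le> 1" unfolding \<epsilon> by (simp add: field_simps)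
  have E: "norm (P - of_real ((norm x)\<^sup>2)) \<le> 2 * \<epsilon> * A"
  proof -
    have "norm (P - of_real ((norm x)\<^sup>2)) \<le> norm (2 * z * of_real (x \<bullet> s)) + norm (z\<^sup>2 * of_real ((norm s)\<^sup>2))"
      unfolding P_def by (simp add: norm_triangle_ineq add.assoc)
    also have "\<dots> = 2 * norm z * \<bar>x \<bullet> s\<bar> + (norm s * norm z)\<^sup>2"
      by (simp add: norm_mult norm_power power_mult_distrib)
    also have "\<dots> \<le> 2 * norm z * (norm x * norm s) + (\<epsilon> * R)\<^sup>2"
      using z by (intro add_mono mult_left_mono Cauchy_Schwarz_ineq2 power_mono) auto
    also have "\<dots> = 2 * norm x * (norm s * norm z) + (\<epsilon> * R)\<^sup>2" by simp
    also have "\<dots> \<le> 2 * norm x * (\<epsilon> * R) + \<epsilon> * R\<^sup>2"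
    proof -
      have "\<epsilon> * (\<epsilon> * R\<^sup>2) \<le> 1 * (\<epsilon> * R\<^sup>2)" using \<epsilon>0 \<epsilon>1 by (intro mult_right_mono) auto
      then show ?thesis using z by (intro add_mono mult_left_mono) (auto simp: power2_eq_square algebra_simps)
    qed
    also have "\<dots> = \<epsilon> * (2 * norm x * R + R\<^sup>2)" by (simp add: algebra_simps)
    also have "\<dots> \<le> \<epsilon> * (2 * A)"
    proof (rule mult_left_mono)
      have "0 \<le> (norm x - R)\<^sup>2 + (norm x)\<^sup>2" by simp
      then show "2 * norm x * R + R\<^sup>2 \<le> 2 * A"
        unfolding A_def power2_diff by argo
    qed (use \<epsilon>0 in simp)
    finally show ?thesis by simp
  qed
  have nP: "norm P \<le> 4 * A"
  proof -
    have "norm P \<le> norm (P - of_real ((norm x)\<^sup>2)) + (norm x)\<^sup>2"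
      using norm_triangle_ineq[of "P - of_real ((norm x)\<^sup>2)" "of_real ((norm x)\<^sup>2)"]
      by (simp add: norm_power)
    also have "\<dots> \<le> 2 * A + A"
    proof (rule add_mono)
      have "\<epsilon> * (2 * A) \<le> 1 * (2 * A)" using \<epsilon>1 A by (intro mult_right_mono) auto
      then show "norm (P - of_real ((norm x)\<^sup>2)) \<le> 2 * A" using E by simp
    qed (simp add: A_def)
    finally show ?thesis using A by simp
  qed
  have Ax: "(norm x)\<^sup>2 \<le> A" by (simp add: A_def)
  have "norm (P ^ n - of_real ((norm x)\<^sup>2) ^ n) \<le> real n * (4 * A) ^ (n - 1) * norm (P - of_real ((norm x)\<^sup>2))"
    using nP A Ax by (intro norm_power_difference_le) (auto simp: norm_power)
  also have "\<dots> \<le> real n * (4 * A) ^ (n - 1) * (\<epsilon> * (4 * A))"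
    using E A \<epsilon>0 by (intro mult_left_mono) (auto intro: order_trans)
  also have "\<dots> = \<epsilon> * real n * (4 * A) ^ n"
    using assms(2) by (cases n) auto
  also have "\<dots> = A ^ n / 2 ^ n / 2"
  proof -
    have "(8::real) ^ n = 2 ^ n * 4 ^ n" by (simp flip: power_mult_distrib)
    then show ?thesis using assms(2) by (simp add: \<epsilon> power_mult_distrib)
  qed
  also have "A ^ n / 2 ^ n \<le> norm x ^ (2 * n) + R ^ (2 * n)"
  proof -
    define M where "M = max ((norm x)\<^sup>2) (R\<^sup>2)"
    have "A \<le> 2 * M" unfolding A_def M_def by simp
    then have "A ^ n \<le> 2 ^ n * M ^ n" using A by (metis less_imp_le power_mono power_mult_distrib)
    moreover have "M ^ n \<le> norm x ^ (2 * n) + R ^ (2 * n)"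
      unfolding M_def by (cases "(norm x)\<^sup>2 \<le> R\<^sup>2") (auto simp: max_def power_mult)
    ultimately have "A ^ n \<le> 2 ^ n * (norm x ^ (2 * n) + R ^ (2 * n))"
      by (rule order_trans[OF _ mult_left_mono]) simp
    then show ?thesis by (subst pos_divide_le_eq) (simp_all add: mult.commute)
  qed
  finally have F: "norm (P ^ n - of_real ((norm x)\<^sup>2) ^ n) \<le> (norm x ^ (2 * n) + R ^ (2 * n)) / 2" by simp
  define D where "D = norm x ^ (2 * n) + R ^ (2 * n)"
  define Q where "Q = P ^ n + of_real (R ^ (2 * n))"
  have "of_real ((norm x)\<^sup>2) ^ n + of_real (R ^ (2 * n)) = complex_of_real D"
    by (simp add: D_def power_mult)
  then have "complex_of_real D = Q - (P ^ n - of_real ((norm x)\<^sup>2) ^ n)"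
    unfolding Q_def by (simp only: algebra_simps)
  then have "norm (complex_of_real D) \<le> norm Q + norm (P ^ n - of_real ((norm x)\<^sup>2) ^ n)"
    using norm_triangle_ineq4 by simp
  moreover have "norm (complex_of_real D) = D"
    using assms(1) unfolding norm_of_real D_def by simp
  moreover note F[folded D_def]
  ultimately have "D / 2 \<le> norm Q" by argo
  then show ?thesis unfolding D_def Q_def P_def .
qed

text \<open>
Along the line \<open>x + z s\<close> the function is holomorphic and at most \<open>2\<^sup>p\<close> times its value at \<open>x\<close> as long as
\<open>|z|\<close> stays below a constant times \<open>R\<close>. Each order of differencing therefore gains a factor \<open>1/R\<close>, uniformly in \<open>x\<close>.
\<close>

lemma resolvent_power_difference:
  assumes n: "n > 0" and b: "b > 0"
  obtains C R0 where "C \<ge> 0" "R0 > 0"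
    "\<And>R x s. R \<ge> R0 \<Longrightarrow> norm (s::'a::euclidean_space) \<le> b \<Longrightarrow>
       \<bar>\<Sum>j\<le>m. (-1) ^ j * real (m choose j) * resolvent n R (x + real j *\<^sub>R s) ^ p\<bar>
         \<le> C / R ^ m * resolvent n R x ^ p"
proof -
  define \<epsilon> where "\<epsilon> = 1 / (2 * real n * 8 ^ n)"
  define C where "C = fact m * 2 ^ p * (2 * b / \<epsilon>) ^ m"
  define R0 where "R0 = (2 * real m + 1) * b / \<epsilon>"
  have \<epsilon>: "\<epsilon> > 0" using n by (simp add: \<epsilon>_def)
  show ?thesis
  proof
    show "C \<ge> 0" using b \<epsilon> by (simp add: C_def)
    show "R0 > 0" using b \<epsilon> by (simp add: R0_def)
    fix R and x s :: 'a assume R: "R \<ge> R0" and s: "norm s \<le> b"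
    have R0: "R > 0" using R \<open>R0 > 0\<close> by simp
    define \<rho> where "\<rho> = \<epsilon> * R / b"
    have "2 * real m + 1 \<le> \<rho>" using R b \<epsilon> by (simp add: \<rho>_def R0_def field_simps)
    then have \<rho>: "2 * real m < \<rho>" by simp
    define P where "P z = of_real ((norm x)\<^sup>2) + 2 * z * of_real (x \<bullet> s) + z\<^sup>2 * of_real ((norm s)\<^sup>2)" for z :: complex
    define h where "h z = 1 / (P z ^ n + of_real (R ^ (2 * n))) ^ p" for z
    define d where "d = norm x ^ (2 * n) + R ^ (2 * n)"
    have d: "d > 0" using R0 by (simp add: d_def add_nonneg_pos)
    have low: "d / 2 \<le> norm (P z ^ n + of_real (R ^ (2 * n)))" if "norm z < \<rho>" for z
    proof -
      have "norm s * norm z \<le> b * \<rho>" using that s b by (intro mult_mono) auto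
      also have "\<dots> = \<epsilon> * R" using b by (simp add: \<rho>_def)
      finally show ?thesis
        unfolding d_def P_def using R0 n by (intro resolvent_denominator_stable[OF _ _ \<epsilon>_def]) auto
    qed
    have nz: "P z ^ n + of_real (R ^ (2 * n)) \<noteq> 0" if "norm z < \<rho>" for z
      using low[OF that] d by auto
    have bound: "norm (\<Sum>j\<le>m. (-1) ^ j * of_nat (m choose j) * h (of_nat j)) \<le> fact m * (2 / d) ^ p * (2 / \<rho>) ^ m"
    proof (rule holomorphic_difference_bound[OF _ \<rho>])
      show "h holomorphic_on ball 0 \<rho>"
        using nz unfolding h_def P_def by (auto intro!: holomorphic_intros)
      fix z :: complex assume z: "norm z < \<rho>"
      have "norm (h z) = (1 / norm (P z ^ n + of_real (R ^ (2 * n)))) ^ p"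
        by (simp add: h_def norm_divide norm_power power_divide)
      also have "\<dots> \<le> (2 / d) ^ p"
      proof (rule power_mono)
        show "1 / norm (P z ^ n + of_real (R ^ (2 * n))) \<le> 2 / d"
          using frac_le[of 1 1 "d / 2" "norm (P z ^ n + of_real (R ^ (2 * n)))"] low[OF z] d by simp
      qed auto
      finally show "norm (h z) \<le> (2 / d) ^ p" .
    qed
    have "h (of_nat j) = of_real (resolvent n R (x + real j *\<^sub>R s) ^ p)" for j
    proof -
      have eq: "(norm (x + real j *\<^sub>R s))\<^sup>2 = (norm x)\<^sup>2 + 2 * real j * (x \<bullet> s) + (real j)\<^sup>2 * (norm s)\<^sup>2"
        unfolding power2_norm_eq_inner by (simp add: algebra_simps inner_commute power2_eq_square)
      have "P (of_nat j) = of_real ((norm (x + real j *\<^sub>R s))\<^sup>2)"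
        unfolding eq P_def by simp
      then have "P (of_nat j) ^ n = of_real (norm (x + real j *\<^sub>R s) ^ (2 * n))"
        unfolding power_mult by simp
      then show ?thesis
        unfolding h_def resolvent_def by (simp add: power_one_over)
    qed
    then have eq: "(\<Sum>j\<le>m. (-1) ^ j * of_nat (m choose j) * h (of_nat j)) =
        of_real (\<Sum>j\<le>m. (-1) ^ j * real (m choose j) * resolvent n R (x + real j *\<^sub>R s) ^ p)"
      by (simp only: of_real_sum of_real_mult of_real_power of_real_minus of_real_1 of_real_of_nat_eq)
    have "\<bar>\<Sum>j\<le>m. (-1) ^ j * real (m choose j) * resolvent n R (x + real j *\<^sub>R s) ^ p\<bar>
        \<le> fact m * (2 / d) ^ p * (2 / \<rho>) ^ m"
      using bound unfolding eq norm_of_real .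
    also have "\<dots> = C / R ^ m * resolvent n R x ^ p"
    proof -
      have "2 / \<rho> = (2 * b / \<epsilon>) / R" by (simp add: \<rho>_def)
      then have "(2 / \<rho>) ^ m = (2 * b / \<epsilon>) ^ m / R ^ m" by (simp only: power_divide)
      moreover have "(2 / d) ^ p = 2 ^ p * resolvent n R x ^ p"
        unfolding resolvent_def d_def[symmetric] by (simp add: power_divide)
      ultimately show ?thesis by (simp add: C_def)
    qed
    finally show "\<bar>\<Sum>j\<le>m. (-1) ^ j * real (m choose j) * resolvent n R (x + real j *\<^sub>R s) ^ p\<bar>
        \<le> C / R ^ m * resolvent n R x ^ p" .
  qed
qed

section \<open>Lattice sums and integrals\<close>

text \<open>
The cube is half open so that its integer translates tile the space without overlap.
\<close>

definition unit_cube :: "(real ^ 'd::finite) set" where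
  "unit_cube = {s. \<forall>i. 0 \<le> s $ i \<and> s $ i < 1}"

lemma unit_cube_borel [measurable]: "unit_cube \<in> sets borel"
proof -
  have "unit_cube = (\<Inter>i. {s :: real ^ 'd. 0 \<le> s $ i} \<inter> {s. s $ i < 1})"
    by (auto simp: unit_cube_def)
  also have "\<dots> \<in> sets borel"
    by (intro sets.countable_INT' sets.Int borel_closed borel_open closed_halfspace_component_ge_cart
        open_halfspace_component_lt_cart) auto
  finally show ?thesis .
qed

lemma emeasure_unit_cube: "emeasure lborel (unit_cube :: (real ^ 'd::finite) set) = 1"
proof (rule antisym)
  have "(unit_cube :: (real ^ 'd) set) \<subseteq> cbox 0 (\<chi> i. 1)"
    by (auto simp: unit_cube_def mem_box_cart less_imp_le)
  then have "emeasure lborel (unit_cube :: (real ^ 'd) set) \<le> emeasure lborel (cbox 0 (\<chi> i. 1) :: (real ^ 'd) set)"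
    by (intro emeasure_mono) auto
  also have "\<dots> = 1"
    by (subst emeasure_lborel_cbox) (auto simp: inner_axis Basis_vec_def intro!: prod.neutral)
  finally show "emeasure lborel (unit_cube :: (real ^ 'd) set) \<le> 1" .
  have "(box 0 (\<chi> i. 1)) \<subseteq> (unit_cube :: (real ^ 'd) set)"
    by (auto simp: unit_cube_def mem_box_cart less_imp_le)
  then have "emeasure lborel (box 0 (\<chi> i. 1) :: (real ^ 'd) set) \<le> emeasure lborel (unit_cube :: (real ^ 'd) set)"
    by (intro emeasure_mono) auto
  moreover have "emeasure lborel (box 0 (\<chi> i. 1) :: (real ^ 'd) set) = 1"
    by (subst emeasure_lborel_box) (auto simp: inner_axis Basis_vec_def intro!: prod.neutral)
  ultimately show "1 \<le> emeasure lborel (unit_cube :: (real ^ 'd) set)" by simp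
qed

text \<open>
Each coordinate of \<open>k\<close> ranges over the \<open>j\<close> integers in the half-open interval \<open>(y\<^sub>i - j, y\<^sub>i]\<close>.
\<close>

lemma card_lattice_points_half_open_cube:
  fixes y :: "real ^ 'd::finite"
  shows "finite {k :: int ^ 'd. \<forall>i. 0 \<le> y $ i - real_of_int (k $ i) \<and> y $ i - real_of_int (k $ i) < real j}"
    and "card {k :: int ^ 'd. \<forall>i. 0 \<le> y $ i - real_of_int (k $ i) \<and> y $ i - real_of_int (k $ i) < real j} = j ^ CARD('d)"
proof -
  let ?K = "{k :: int ^ 'd. \<forall>i. 0 \<le> y $ i - real_of_int (k $ i) \<and> y $ i - real_of_int (k $ i) < real j}"
  let ?P = "PiE (UNIV :: 'd set) (\<lambda>i. {\<lfloor>y $ i\<rfloor> - int j <.. \<lfloor>y $ i\<rfloor>})"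
  have iff: "(0 \<le> y $ i - real_of_int m \<and> y $ i - real_of_int m < real j) \<longleftrightarrow> m \<in> {\<lfloor>y $ i\<rfloor> - int j <.. \<lfloor>y $ i\<rfloor>}" for i m
  proof -
    have "real_of_int m \<le> y $ i \<longleftrightarrow> m \<le> \<lfloor>y $ i\<rfloor>" by (simp add: le_floor_iff)
    moreover have "y $ i < real_of_int (m + int j) \<longleftrightarrow> \<lfloor>y $ i\<rfloor> < m + int j" by (rule floor_less_iff[symmetric])
    ultimately show ?thesis by auto
  qed
  have bij: "bij_betw vec_nth ?K ?P"
    by (rule bij_betwI[where g = vec_lambda]) (simp_all only: iff Pi_iff PiE_iff mem_Collect_eq, auto)
  have fin: "finite ?P" by (intro finite_PiE) auto
  show "finite ?K" using bij fin bij_betw_finite by blast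
  have "card ?K = card ?P" using bij bij_betw_same_card by blast
  also have "\<dots> = (\<Prod>i\<in>(UNIV::'d set). j)"
    by (subst card_PiE) (auto intro!: prod.cong)
  finally show "card ?K = j ^ CARD('d)" by simp
qed

text \<open>
Substituting \<open>y = k + j s\<close> turns the left side into the integral of \<open>g(y)/j\<^sup>d\<close> weighted by the number of
lattice points \<open>k\<close> with \<open>y - k\<close> in \<open>[0, j)\<^sup>d\<close>, and that number is always \<open>j\<^sup>d\<close>.
\<close>

lemma nn_integral_lattice_translates:
  fixes g :: "real ^ 'd::finite \<Rightarrow> ennreal"
  assumes g [measurable]: "g \<in> borel_measurable borel" and j: "j > 0"
  shows "(\<integral>\<^sup>+k. (\<integral>\<^sup>+s. g (freq k + real j *\<^sub>R s) * indicator unit_cube s \<partial>lborel) \<partial>count_space UNIV)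
       = (\<integral>\<^sup>+x. g x \<partial>lborel)"
proof -
  let ?d = "CARD('d)"
  have cnt: "(\<integral>\<^sup>+k. indicator unit_cube ((1 / real j) *\<^sub>R (y - freq k)) \<partial>count_space UNIV) = ennreal (real j ^ ?d)"
    for y :: "real ^ 'd"
  proof -
    have "indicator unit_cube ((1 / real j) *\<^sub>R (y - freq k)) =
       (indicator {k :: int ^ 'd. \<forall>i. 0 \<le> y $ i - real_of_int (k $ i) \<and> y $ i - real_of_int (k $ i) < real j} k :: ennreal)" for k
      using j by (auto simp: indicator_def unit_cube_def freq_def field_simps)
    then show ?thesis
      using card_lattice_points_half_open_cube[of y j]
      by (simp add: nn_integral_indicator emeasure_count_space ennreal_of_nat_eq_real_of_nat)
  qed
  have "(\<integral>\<^sup>+s. g (freq k + real j *\<^sub>R s) * indicator unit_cube s \<partial>lborel) =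
     (\<integral>\<^sup>+y. g y * indicator unit_cube ((1 / real j) *\<^sub>R (y - freq k)) * ennreal (1 / real j ^ ?d) \<partial>lborel)"
    for k :: "int ^ 'd"
  proof -
    have "(\<integral>\<^sup>+y. g y * indicator unit_cube ((1 / real j) *\<^sub>R (y - freq k)) * ennreal (1 / real j ^ ?d) \<partial>lborel)
      = (\<integral>\<^sup>+y. g y * indicator unit_cube ((1 / real j) *\<^sub>R (y - freq k)) * ennreal (1 / real j ^ ?d)
          \<partial>density (distr lborel borel (\<lambda>s. freq k + real j *\<^sub>R s)) (\<lambda>_. ennreal (\<bar>real j\<bar> ^ DIM(real ^ 'd))))"
      using j lborel_affine[of "real j" "freq k"] by simp
    also have "\<dots> = (\<integral>\<^sup>+s. ennreal (real j ^ ?d) *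
          (g (freq k + real j *\<^sub>R s) * indicator unit_cube s * ennreal (1 / real j ^ ?d)) \<partial>lborel)"
      using j by (simp add: nn_integral_density nn_integral_distr)
    also have "\<dots> = (\<integral>\<^sup>+s. g (freq k + real j *\<^sub>R s) * indicator unit_cube s \<partial>lborel)"
    proof (rule nn_integral_cong)
      fix s
      have "ennreal (real j ^ ?d) * ennreal (1 / real j ^ ?d) = 1"
        using j by (simp flip: ennreal_mult')
      moreover have "ennreal (real j ^ ?d) * (g (freq k + real j *\<^sub>R s) * indicator unit_cube s * ennreal (1 / real j ^ ?d))
        = (ennreal (real j ^ ?d) * ennreal (1 / real j ^ ?d)) * (g (freq k + real j *\<^sub>R s) * indicator unit_cube s)"
        by (simp only: ac_simps)
      ultimately show "ennreal (real j ^ ?d) * (g (freq k + real j *\<^sub>R s) * indicator unit_cube s * ennreal (1 / real j ^ ?d))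
         = g (freq k + real j *\<^sub>R s) * indicator unit_cube s"
        by simp
    qed
    finally show ?thesis by simp
  qed
  then have "(\<integral>\<^sup>+k. (\<integral>\<^sup>+s. g (freq k + real j *\<^sub>R s) * indicator unit_cube s \<partial>lborel) \<partial>count_space UNIV) =
    (\<integral>\<^sup>+k. (\<integral>\<^sup>+y. g y * indicator unit_cube ((1 / real j) *\<^sub>R (y - freq k)) * ennreal (1 / real j ^ ?d) \<partial>lborel)
       \<partial>count_space (UNIV :: (int ^ 'd) set))" by simp
  also have "\<dots> = (\<integral>\<^sup>+y. (\<integral>\<^sup>+k. g y * indicator unit_cube ((1 / real j) *\<^sub>R (y - freq k)) * ennreal (1 / real j ^ ?d)
       \<partial>count_space (UNIV :: (int ^ 'd) set)) \<partial>lborel)"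
    by (subst nn_integral_count_space_nn_integral) auto
  also have "\<dots> = (\<integral>\<^sup>+y. g y \<partial>lborel)"
  proof (rule nn_integral_cong)
    fix y :: "real ^ 'd"
    have "(\<integral>\<^sup>+k. g y * indicator unit_cube ((1 / real j) *\<^sub>R (y - freq k)) * ennreal (1 / real j ^ ?d) \<partial>count_space UNIV) =
      g y * ennreal (real j ^ ?d) * ennreal (1 / real j ^ ?d)"
      by (simp add: nn_integral_multc nn_integral_cmult cnt)
    also have "\<dots> = g y"
      using j by (simp add: mult.assoc flip: ennreal_mult')
    finally show "(\<integral>\<^sup>+k. g y * indicator unit_cube ((1 / real j) *\<^sub>R (y - freq k)) * ennreal (1 / real j ^ ?d) \<partial>count_space UNIV) = g y" .
  qed
  finally show ?thesis .
qed

lemma has_sum_if_nn_integral_count_space: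
  fixes f :: "'a \<Rightarrow> real"
  assumes nn: "\<And>x. x \<in> A \<Longrightarrow> 0 \<le> f x" and J: "J \<ge> 0"
    and int: "(\<integral>\<^sup>+x. ennreal (f x) \<partial>count_space A) = ennreal J"
  shows "(f has_sum J) A"
proof -
  have "integrable (count_space A) f"
    using nn int by (intro integrableI_nonneg) (auto simp: AE_count_space)
  then have abs: "Infinite_Set_Sum.abs_summable_on f A" by (simp add: Infinite_Set_Sum.abs_summable_on_def)
  have "ennreal (infsetsum f A) = ennreal J"
    using nn_integral_conv_infsetsum[OF abs nn] int by simp
  then have "infsetsum f A = J" using J nn by (simp add: infsetsum_nonneg ennreal_inj)
  then have "infsum f A = J" using infsetsum_infsum[OF abs] by simp
  moreover have "f summable_on A"
    using abs abs_summable_equivalent abs_summable_summable by blast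
  ultimately show ?thesis using has_sum_infsum by blast
qed

lemma alternating_binomial_sum_eq_diff:
  fixes S J :: real
  assumes "m > 0"
  shows "(\<Sum>j\<le>m. (-1) ^ j * real (m choose j) * (if j = 0 then S else J)) = S - J"
proof -
  have "(\<Sum>j\<le>m. (-1) ^ j * real (m choose j) * (if j = 0 then S else J)) =
    (\<Sum>j\<le>m. (if j = 0 then S - J else 0) + J * ((-1) ^ j * real (m choose j)))"
    by (intro sum.cong) auto
  also have "\<dots> = (S - J) + J * (\<Sum>j\<le>m. (-1) ^ j * real (m choose j))"
    by (simp add: sum.distrib sum_distrib_left)
  also have "(\<Sum>j\<le>m. (-1) ^ j * real (m choose j)) = 0"
    using choose_alternating_sum[OF assms, where 'a = real] by simp
  finally show ?thesis by simp
qed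

lemma has_sum_finite_sum:
  fixes f :: "'i \<Rightarrow> 'a \<Rightarrow> real"
  assumes "finite I" "\<And>i. i \<in> I \<Longrightarrow> (f i has_sum S i) A"
  shows "((\<lambda>x. \<Sum>i\<in>I. f i x) has_sum (\<Sum>i\<in>I. S i)) A"
  using assms by (induction I) (auto intro!: has_sum_add)

lemma lattice_translates_has_sum:
  fixes g :: "real ^ 'd::finite \<Rightarrow> real"
  assumes g [measurable]: "g \<in> borel_measurable borel" and nn: "\<And>x. 0 \<le> g x"
    and J: "(\<integral>\<^sup>+x. ennreal (g x) \<partial>lborel) = ennreal J" "0 \<le> J" and j: "j > 0"
  shows "integrable lborel (\<lambda>s. g (freq k + real j *\<^sub>R s) * indicator unit_cube s)"
    and "((\<lambda>k. LINT s|lborel. g (freq k + real j *\<^sub>R s) * indicator unit_cube s) has_sum J) UNIV"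
proof -
  define B where "B k = (\<integral>\<^sup>+s. ennreal (g (freq k + real j *\<^sub>R s) * indicator unit_cube s) \<partial>lborel)" for k
  have ie: "ennreal (x * indicator unit_cube s) = ennreal x * indicator unit_cube s" for x and s :: "real ^ 'd"
    by (simp add: indicator_def)
  have tot: "(\<integral>\<^sup>+k. B k \<partial>count_space UNIV) = ennreal J"
    using nn_integral_lattice_translates[of "\<lambda>x. ennreal (g x)", OF _ j] J by (simp add: B_def ie)
  have fin: "B k < \<infinity>" for k
  proof -
    have "B k = (\<integral>\<^sup>+i. B i * indicator {k} i \<partial>count_space UNIV)"
      by (simp add: nn_integral_indicator_singleton)
    also have "\<dots> \<le> ennreal J" unfolding tot[symmetric]
      by (intro nn_integral_mono) (auto simp: indicator_def)
    finally show ?thesis using le_less_trans by fastforce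
  qed
  show int: "integrable lborel (\<lambda>s. g (freq k + real j *\<^sub>R s) * indicator unit_cube s)" for k
    using fin[of k] nn by (intro integrableI_nonneg) (auto simp: B_def)
  have eq: "ennreal (LINT s|lborel. g (freq k + real j *\<^sub>R s) * indicator unit_cube s) = B k" for k
    unfolding B_def using nn by (intro nn_integral_eq_integral[symmetric] int) auto
  show "((\<lambda>k. LINT s|lborel. g (freq k + real j *\<^sub>R s) * indicator unit_cube s) has_sum J) UNIV"
    using J nn by (intro has_sum_if_nn_integral_count_space) (auto simp: eq tot)
qed

text \<open>
For fixed \<open>k\<close> the difference hypothesis is averaged over the unit cube and then summed over \<open>k\<close>. The term \<open>j = 0\<close> contributes \<open>S\<close>
and every other term contributes \<open>J\<close> with its binomial weight; as the alternating weights add up to zero,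
the total is \<open>S - J\<close>.
\<close>

lemma lattice_sum_near_integral:
  fixes g :: "real ^ 'd::finite \<Rightarrow> real"
  assumes g [measurable]: "g \<in> borel_measurable borel" and nn: "\<And>x. 0 \<le> g x"
    and J: "(\<integral>\<^sup>+x. ennreal (g x) \<partial>lborel) = ennreal J" "0 \<le> J" and m: "m > 0"
    and S: "((\<lambda>k. g (freq k)) has_sum S) UNIV"
    and diff: "\<And>k s. s \<in> unit_cube \<Longrightarrow>
      \<bar>\<Sum>j\<le>m. (-1) ^ j * real (m choose j) * g (freq k + real j *\<^sub>R s)\<bar> \<le> \<beta> * g (freq k)"
  shows "\<bar>S - J\<bar> \<le> \<beta> * S"
proof -
  define b where "b j k = (LINT s|lborel. g (freq k + real j *\<^sub>R s) * indicator unit_cube s)" for j k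
  have mu: "measure lborel (unit_cube :: (real ^ 'd) set) = 1"
    by (simp add: measure_def emeasure_unit_cube)
  have ci: "integrable lborel (\<lambda>s. c * indicator (unit_cube :: (real ^ 'd) set) s)"
    and cv: "(LINT s|lborel. c * indicator (unit_cube :: (real ^ 'd) set) s) = c" for c :: real
    by (auto simp: mu emeasure_unit_cube)
  have int: "integrable lborel (\<lambda>s. g (freq k + real j *\<^sub>R s) * indicator unit_cube s)" for j k
    using lattice_translates_has_sum(1)[OF g nn J, of j k] ci[of "g (freq k)"] by (cases "j = 0") auto
  have hs: "(b j has_sum (if j = 0 then S else J)) UNIV" for j
    unfolding b_def using lattice_translates_has_sum(2)[OF g nn J, of j] S by (cases "j = 0") (auto simp: mu)
  have "((\<lambda>k. \<Sum>j\<le>m. (-1) ^ j * real (m choose j) * b j k) has_sum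
      (\<Sum>j\<le>m. (-1) ^ j * real (m choose j) * (if j = 0 then S else J))) UNIV"
    by (intro has_sum_finite_sum has_sum_cmult_right hs) auto
  then have T: "((\<lambda>k. \<Sum>j\<le>m. (-1) ^ j * real (m choose j) * b j k) has_sum (S - J)) UNIV"
    by (simp only: alternating_binomial_sum_eq_diff[OF m])
  have bd: "\<bar>\<Sum>j\<le>m. (-1) ^ j * real (m choose j) * b j k\<bar> \<le> \<beta> * g (freq k)" for k
  proof -
    have "(\<Sum>j\<le>m. (-1) ^ j * real (m choose j) * b j k) =
      (LINT s|lborel. (\<Sum>j\<le>m. (-1) ^ j * real (m choose j) * (g (freq k + real j *\<^sub>R s) * indicator unit_cube s)))"
      unfolding b_def by (subst Bochner_Integration.integral_sum) (auto intro!: int)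
    also have "\<bar>\<dots>\<bar> \<le> (LINT s|lborel. \<beta> * g (freq k) * indicator (unit_cube :: (real ^ 'd) set) s)"
      unfolding real_norm_def[symmetric]
    proof (rule Bochner_Integration.integral_norm_bound_integral)
      show "integrable lborel (\<lambda>s. \<Sum>j\<le>m. (-1) ^ j * real (m choose j) * (g (freq k + real j *\<^sub>R s) * indicator unit_cube s))"
        by (intro Bochner_Integration.integrable_sum integrable_mult_right int)
      show "integrable lborel (\<lambda>s. \<beta> * g (freq k) * indicator (unit_cube :: (real ^ 'd) set) s)"
        by (rule ci)
      fix s :: "real ^ 'd"
      have "(\<Sum>j\<le>m. (-1) ^ j * real (m choose j) * (g (freq k + real j *\<^sub>R s) * indicator unit_cube s)) =
        (\<Sum>j\<le>m. (-1) ^ j * real (m choose j) * g (freq k + real j *\<^sub>R s)) * indicator unit_cube s"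
        by (simp add: sum_distrib_right mult.assoc)
      then show "norm (\<Sum>j\<le>m. (-1) ^ j * real (m choose j) * (g (freq k + real j *\<^sub>R s) * indicator unit_cube s))
        \<le> \<beta> * g (freq k) * indicator unit_cube s"
        using diff[of s k] by (simp add: indicator_def)
    qed
    finally show ?thesis by (simp add: mu)
  qed
  have "S - J \<le> \<beta> * S"
    using bd by (intro has_sum_mono[OF T has_sum_cmult_right[OF S]]) (simp add: abs_le_iff)
  moreover have "- (\<beta> * S) \<le> S - J"
  proof (rule has_sum_mono[OF _ T, of "\<lambda>k. - (\<beta> * g (freq k))"])
    show "((\<lambda>k. - (\<beta> * g (freq k))) has_sum - (\<beta> * S)) UNIV"
      using has_sum_cmult_right[OF S, of \<beta>] by (simp add: has_sum_uminus)
  qed (use bd in \<open>auto simp: abs_le_iff minus_le_iff\<close>)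
  ultimately show ?thesis by (simp add: abs_le_iff)
qed

section \<open>Asymptotics of the resolvent sums\<close>

lemma resolvent_borel [measurable]: "resolvent n R \<in> borel_measurable borel"
  unfolding resolvent_def by measurable

text \<open>
A crude comparison of neighbouring values, used only to see that the lattice sums converge.
\<close>

lemma resolvent_translate:
  fixes x s :: "'a::euclidean_space"
  assumes "R > 0" "norm s \<le> b" "b \<ge> 0"
  shows "resolvent n R x \<le> 2 ^ (2 * n) * (1 + (b / R) ^ (2 * n)) * resolvent n R (x + s)"
proof -
  define X where "X = norm x ^ (2 * n)"
  define B where "B = b ^ (2 * n)"
  define Q where "Q = R ^ (2 * n)"
  have pos: "X \<ge> 0" "B \<ge> 0" "Q > 0" using assms by (auto simp: X_def B_def Q_def)
  have "norm (x + s) \<le> 2 * max (norm x) b"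
    using norm_triangle_ineq[of x s] assms by linarith
  then have "norm (x + s) ^ (2 * n) \<le> (2 * max (norm x) b) ^ (2 * n)" by (intro power_mono) auto
  also have "\<dots> \<le> 2 ^ (2 * n) * (X + B)"
    using assms unfolding power_mult_distrib by (intro mult_left_mono) (auto simp: max_def X_def B_def)
  finally have "norm (x + s) ^ (2 * n) + Q \<le> 2 ^ (2 * n) * (X + B) + 2 ^ (2 * n) * Q"
    using pos by (intro add_mono) auto
  also have "\<dots> = 2 ^ (2 * n) * (X + Q + B)" by (simp add: algebra_simps)
  also have "\<dots> \<le> 2 ^ (2 * n) * ((1 + B / Q) * (X + Q))"
    using pos by (intro mult_left_mono) (auto simp: field_simps)
  finally have "norm (x + s) ^ (2 * n) + Q \<le> 2 ^ (2 * n) * (1 + B / Q) * (X + Q)" by (simp add: mult.assoc)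
  moreover have "norm (x + s) ^ (2 * n) + Q > 0" using pos by (simp add: add_nonneg_pos)
  moreover have "X + Q > 0" using pos by simp
  ultimately show ?thesis
    unfolding resolvent_def power_divide X_def[symmetric] B_def[symmetric] Q_def[symmetric]
    by (simp add: divide_le_eq le_divide_eq mult.commute)
qed

lemma norm_unit_cube: "s \<in> unit_cube \<Longrightarrow> norm (s :: real ^ 'd::finite) \<le> real CARD('d)"
proof -
  assume "s \<in> unit_cube"
  then have "norm s \<le> (\<Sum>i\<in>UNIV. \<bar>s $ i\<bar>)" "\<And>i. \<bar>s $ i\<bar> \<le> 1"
    using norm_le_l1_cart[of s] by (auto simp: unit_cube_def abs_of_nonneg less_imp_le)
  then show ?thesis using sum_bounded_above[of UNIV "\<lambda>i. \<bar>s $ i\<bar>" 1] by force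
qed

lemma resolvent_power_summable:
  assumes R: "R > 0" and J: "(\<integral>\<^sup>+x. ennreal (resolvent n R (x :: real ^ 'd::finite) ^ p) \<partial>lborel) = ennreal J" "0 \<le> J"
  shows "(\<lambda>k :: int ^ 'd. resolvent n R (freq k) ^ p) summable_on UNIV"
proof -
  define b where "b = real CARD('d)"
  define C where "C = (2 ^ (2 * n) * (1 + (b / R) ^ (2 * n))) ^ p"
  define A where "A k = (LINT s|lborel. resolvent n R (freq k + real 1 *\<^sub>R (s :: real ^ 'd)) ^ p * indicator unit_cube s)" for k
  note J' = lattice_translates_has_sum[of "\<lambda>x :: real ^ 'd. resolvent n R x ^ p", OF _ _ J zero_less_one]
  have nn: "0 \<le> resolvent n R x ^ p" for x :: "real ^ 'd" using resolvent_pos[OF R, of n x] by simp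
  have int: "integrable lborel (\<lambda>s. resolvent n R (freq k + real 1 *\<^sub>R (s :: real ^ 'd)) ^ p * indicator unit_cube s)" for k
    by (rule J'(1)) (auto simp: nn)
  have A: "(A has_sum J) UNIV"
    unfolding A_def by (rule J'(2)) (auto simp: nn)
  have le: "resolvent n R (freq k) ^ p \<le> C * A k" for k :: "int ^ 'd"
  proof -
    have "resolvent n R (freq k) ^ p = (LINT s|lborel. resolvent n R (freq k) ^ p * indicator (unit_cube :: (real ^ 'd) set) s)"
      by (simp add: measure_def emeasure_unit_cube)
    also have "\<dots> \<le> (LINT s|lborel. C * (resolvent n R (freq k + real 1 *\<^sub>R (s :: real ^ 'd)) ^ p * indicator unit_cube s))"
    proof (rule integral_mono)
      show "integrable lborel (\<lambda>s :: real ^ 'd. C * (resolvent n R (freq k + real 1 *\<^sub>R s) ^ p * indicator unit_cube s))"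
        using int by simp
      fix s :: "real ^ 'd"
      show "resolvent n R (freq k) ^ p * indicator unit_cube s \<le> C * (resolvent n R (freq k + real 1 *\<^sub>R s) ^ p * indicator unit_cube s)"
      proof (cases "s \<in> unit_cube")
        case True
        then have "resolvent n R (freq k) \<le> 2 ^ (2 * n) * (1 + (b / R) ^ (2 * n)) * resolvent n R (freq k + s)"
          using R norm_unit_cube[of s] by (intro resolvent_translate) (auto simp: b_def)
        then have "resolvent n R (freq k) ^ p \<le> (2 ^ (2 * n) * (1 + (b / R) ^ (2 * n)) * resolvent n R (freq k + s)) ^ p"
          using resolvent_pos[OF R] by (intro power_mono) (auto intro: less_imp_le)
        then show ?thesis using True by (simp add: C_def power_mult_distrib)
      qed simp
    qed (auto simp: emeasure_unit_cube)
    finally show ?thesis unfolding A_def by simp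
  qed
  show ?thesis
  proof (rule summable_on_comparison_test[of "\<lambda>k. C * A k"])
    show "(\<lambda>k. C * A k) summable_on UNIV"
      using A by (intro summable_on_cmult_right) (auto simp: summable_on_def)
  qed (use le nn in auto)
qed

text \<open>
Layer-cake integration: the superlevel sets of the normalized function \<open>1/((|x|/R)\<^sup>2\<^sup>n + 1)\<close> are balls, and
the level \<open>t\<close> has volume \<open>V\<^sub>d R\<^sup>d (1/t - 1)\<^sup>a\<close>. Integrating \<open>p t\<^bsup>p-1\<^esup>\<close> against this gives a Beta integral.
\<close>

lemma nn_integral_normalized_resolvent_power:
  fixes n p :: nat and R :: real
  defines "d \<equiv> real DIM('a::euclidean_space)"
  assumes d: "d < 2 * real n" and R: "R > 0" and p: "p > 0"
  shows "(\<integral>\<^sup>+x. ennreal ((R ^ (2 * n) * resolvent n R (x :: 'a)) ^ p) \<partial>lborel) =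
    ennreal (unit_ball_vol d * R ^ DIM('a) * real p * Beta (real p - d / (2 * real n)) (1 + d / (2 * real n)))"
proof -
  define a where "a = d / (2 * real n)"
  have d0: "d > 0" by (simp add: d_def)
  have n: "real n > 0" using d d0 by simp
  have a: "0 < a" "a < 1" using n d d0 by (auto simp: a_def)
  define w where "w x = R ^ (2 * n) * resolvent n R x" for x :: 'a
  have w0: "w x > 0" for x using R resolvent_pos[OF R, of n x] by (simp add: w_def)
  have wb [measurable]: "w \<in> borel_measurable borel" unfolding w_def by measurable
  define h where "h t = real p * t ^ (p - 1)" for t :: real
  have h0: "h t \<ge> 0" if "t \<ge> 0" for t using that by (simp add: h_def)
  have hb [measurable]: "h \<in> borel_measurable borel" unfolding h_def by measurable
  have inner1: "ennreal (w x ^ p) = (\<integral>\<^sup>+t. ennreal (h t) * indicator {0<..} t * indicator {t. t \<le> w x} t \<partial>lborel)" for x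
  proof -
    have "(\<integral>\<^sup>+t. ennreal (h t) * indicator {0..w x} t \<partial>lborel) = ennreal (w x ^ p - 0 ^ p)"
    proof (rule nn_integral_FTC_Icc)
      fix t assume "t \<in> {0..w x}"
      show "((\<lambda>t. t ^ p) has_real_derivative h t) (at t)"
        unfolding h_def using p by (auto intro!: derivative_eq_intros)
    qed (use w0[of x] h0 in \<open>auto intro: less_imp_le\<close>)
    moreover have "(\<integral>\<^sup>+t. ennreal (h t) * indicator {0..w x} t \<partial>lborel) =
      (\<integral>\<^sup>+t. ennreal (h t) * indicator {0<..} t * indicator {t. t \<le> w x} t \<partial>lborel)"
      using AE_lborel_singleton[of "0::real"]
      by (intro nn_integral_cong_AE) (auto elim!: eventually_mono simp: indicator_def)
    ultimately show ?thesis using p by (simp add: zero_power)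
  qed
  have level: "emeasure lborel {x. t \<le> w x} = ennreal (unit_ball_vol d * R ^ DIM('a) * (1 / t - 1) powr a)" if t: "0 < t" "t \<le> 1" for t
  proof -
    define r where "r = R * (1 / t - 1) powr (1 / (2 * real n))"
    have t1: "1 / t - 1 \<ge> 0" using t by (simp add: field_simps)
    have r0: "r \<ge> 0" using R by (simp add: r_def)
    have rp: "r ^ (2 * n) = R ^ (2 * n) * (1 / t - 1)"
    proof (cases "1 / t - 1 = 0")
      case False
      then have "((1 / t - 1) powr (1 / (2 * real n))) ^ (2 * n) = 1 / t - 1"
        using t1 n by (simp add: powr_powr flip: powr_realpow)
      then show ?thesis by (simp add: r_def power_mult_distrib)
    qed (use n in \<open>simp add: r_def zero_power\<close>)
    have "{x. t \<le> w x} = cball 0 r"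
    proof (intro set_eqI)
      fix x :: 'a
      have "t \<le> w x \<longleftrightarrow> t * (norm x ^ (2 * n) + R ^ (2 * n)) \<le> R ^ (2 * n)"
        using R by (simp add: w_def resolvent_def le_divide_eq add_nonneg_pos)
      also have "\<dots> \<longleftrightarrow> norm x ^ (2 * n) \<le> r ^ (2 * n)"
        unfolding rp using t by (simp add: field_simps)
      also have "\<dots> \<longleftrightarrow> norm x \<le> r"
        using r0 n by (intro power_mono_iff) auto
      finally show "x \<in> {x. t \<le> w x} \<longleftrightarrow> x \<in> cball 0 r" by simp
    qed
    then have "emeasure lborel {x. t \<le> w x} = ennreal (unit_ball_vol d * r ^ DIM('a))"
      using emeasure_cball[OF r0, of "0 :: 'a"] by (simp add: d_def)
    also have "r ^ DIM('a) = R ^ DIM('a) * (1 / t - 1) powr a"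
    proof (cases "1 / t - 1 = 0")
      case False
      then show ?thesis
        using t1 n by (simp add: r_def power_mult_distrib a_def d_def powr_powr flip: powr_realpow)
    qed (simp add: r_def zero_power)
    finally show ?thesis by (simp add: mult.assoc)
  qed
  have empty: "{x. t \<le> w x} = {}" if t: "1 < t" for t
  proof -
    have "w x \<le> 1" for x
      using R by (simp add: w_def resolvent_def divide_le_eq add_nonneg_pos)
    then show ?thesis using t by (auto simp: not_le intro: le_less_trans)
  qed
  define V where "V = unit_ball_vol d * R ^ DIM('a)"
  have V0: "V \<ge> 0" using R d0 by (simp add: V_def)
  have "(\<integral>\<^sup>+x. ennreal (w x ^ p) \<partial>lborel) =
    (\<integral>\<^sup>+x. \<integral>\<^sup>+t. ennreal (h t) * indicator {0<..} t * indicator {t. t \<le> w x} t \<partial>lborel \<partial>lborel)"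
    by (simp only: inner1)
  also have "\<dots> = (\<integral>\<^sup>+t. \<integral>\<^sup>+x. ennreal (h t) * indicator {0<..} t * indicator {t. t \<le> w x} t \<partial>lborel \<partial>lborel)"
    by (rule lborel_pair.Fubini'[symmetric]) measurable
  also have "\<dots> = (\<integral>\<^sup>+t. ennreal (h t) * indicator {0<..} t * emeasure lborel {x. t \<le> w x} \<partial>lborel)"
  proof (rule nn_integral_cong)
    fix t :: real
    have "(\<integral>\<^sup>+x. ennreal (h t) * indicator {0<..} t * indicator {t. t \<le> w x} t \<partial>lborel) =
      (\<integral>\<^sup>+x. ennreal (h t) * indicator {0<..} t * indicator {x. t \<le> w x} x \<partial>lborel)"
      by (intro nn_integral_cong) (simp add: indicator_def)
    also have "\<dots> = ennreal (h t) * indicator {0<..} t * emeasure lborel {x. t \<le> w x}"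
      by (rule nn_integral_cmult_indicator) measurable
    finally show "(\<integral>\<^sup>+x. ennreal (h t) * indicator {0<..} t * indicator {t. t \<le> w x} t \<partial>lborel) =
      ennreal (h t) * indicator {0<..} t * emeasure lborel {x. t \<le> w x}" .
  qed
  also have "\<dots> = (\<integral>\<^sup>+t. indicator {0..1} t * ennreal (V * real p * (t powr ((real p - a) - 1) * (1 - t) powr ((1 + a) - 1))) \<partial>lborel)"
  proof (rule nn_integral_cong)
    fix t :: real
    consider "t \<le> 0" | "0 < t" "t \<le> 1" | "1 < t" by linarith
    then show "ennreal (h t) * indicator {0<..} t * emeasure lborel {x. t \<le> w x} =
      indicator {0..1} t * ennreal (V * real p * (t powr ((real p - a) - 1) * (1 - t) powr ((1 + a) - 1)))"
    proof cases
      case 1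
      then show ?thesis by (cases "t = 0") (auto simp: indicator_def)
    next
      case 2
      have "(1 / t - 1) powr a = (1 - t) powr a * t powr (- a)"
      proof -
        have "1 / t - 1 = (1 - t) * t powr (- 1)" using 2 by (simp add: field_simps powr_minus)
        then have "(1 / t - 1) powr a = ((1 - t) * t powr (- 1)) powr a" by (rule arg_cong)
        also have "\<dots> = (1 - t) powr a * (t powr (- 1)) powr a"
          by (rule powr_mult)
        also have "(t powr (- 1)) powr a = t powr (- a)" by (subst powr_powr) simp
        finally show ?thesis .
      qed
      moreover have "t ^ (p - 1) = t powr (real p - 1)"
        using 2 p by (simp add: of_nat_diff flip: powr_realpow)
      ultimately have "h t * (V * (1 / t - 1) powr a) = V * real p * ((t powr (real p - 1) * t powr (- a)) * (1 - t) powr a)"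
        by (simp add: h_def)
      also have "t powr (real p - 1) * t powr (- a) = t powr ((real p - a) - 1)"
        by (simp flip: powr_add add: algebra_simps)
      finally have "h t * (V * (1 / t - 1) powr a) = V * real p * (t powr ((real p - a) - 1) * (1 - t) powr ((1 + a) - 1))"
        by simp
      then show ?thesis
        using 2 level[of t] h0[of t] V0 by (simp add: V_def[symmetric] flip: ennreal_mult)
    qed (auto simp: empty)
  qed
  also have "\<dots> = ennreal (V * real p * Beta (real p - a) (1 + a))"
  proof -
    let ?f = "\<lambda>t. V * real p * (t powr ((real p - a) - 1) * (1 - t) powr ((1 + a) - 1))"
    have "(?f has_integral V * real p * Beta (real p - a) (1 + a)) {0..1}"
      using a p by (intro has_integral_mult_right has_integral_Beta_real) auto
    then have "(\<integral>\<^sup>+t. ennreal (indicator {0..1} t * ?f t) \<partial>lborel) = ennreal (V * real p * Beta (real p - a) (1 + a))"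
      using V0 by (intro nn_integral_has_integral_lebesgue) auto
    moreover have "indicator {0..1} t * ennreal (?f t) = ennreal (indicator {0..1} t * ?f t)" for t
      by (simp add: indicator_def)
    ultimately show ?thesis by simp
  qed
  finally show ?thesis unfolding V_def a_def w_def by (simp add: mult.assoc)
qed

lemma Gamma_reflection_real:
  fixes x :: real
  shows "Gamma x * Gamma (1 - x) = pi / sin (pi * x)"
proof -
  have "complex_of_real (Gamma x * Gamma (1 - x)) = complex_of_real (pi / sin (pi * x))"
    using Gamma_reflection_complex[of "complex_of_real x"]
    by (simp flip: Gamma_complex_of_real add: sin_of_real[symmetric])
  then show ?thesis by (simp only: of_real_eq_iff)
qed

text \<open>
This is the integral of \<open>1/(|x|\<^sup>2\<^sup>n + 1)\<close> over \<open>\<real>\<^sup>d\<close>.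
\<close>

definition resolvent_mass :: "nat \<Rightarrow> nat \<Rightarrow> real" where
  "resolvent_mass d n = pi * sphere_area d / (2 * real n * sin (pi * (real d / (2 * real n))))"

text \<open>
Evaluates the Beta integrals for the first and second power. The reflection formula produces the sine in the
first case, and \<open>\<Gamma>(2 - a) = (1 - a) \<Gamma>(1 - a)\<close> relates the second case to it.
\<close>

lemma resolvent_mass_eq:
  assumes "0 < d" "real d < 2 * real n"
  shows "unit_ball_vol (real d) * Beta (1 - real d / (2 * real n)) (1 + real d / (2 * real n)) = resolvent_mass d n"
    and "unit_ball_vol (real d) * 2 * Beta (2 - real d / (2 * real n)) (1 + real d / (2 * real n))
      = (1 - real d / (2 * real n)) * resolvent_mass d n"
    and "resolvent_mass d n > 0"
proof -
  define a where "a = real d / (2 * real n)"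
  have n: "real n > 0" using assms by simp
  have a: "0 < a" "a < 1" using assms n by (auto simp: a_def)
  have "sin (pi * a) > 0" using a by (intro sin_gt_zero) auto
  have GG: "Gamma (1 - a) * Gamma (1 + a) = a * pi / sin (pi * a)"
  proof -
    have "Gamma (a + 1) = a * Gamma a"
      using a by (intro Gamma_plus1) (auto elim!: nonpos_Ints_cases)
    then have "Gamma (1 - a) * Gamma (1 + a) = a * (Gamma a * Gamma (1 - a))"
      by (simp add: add.commute)
    then show ?thesis by (simp add: Gamma_reflection_real)
  qed
  have Vd: "unit_ball_vol (real d) * a = sphere_area d / (2 * real n)"
  proof -
    have "Gamma (real d / 2 + 1) = real d / 2 * Gamma (real d / 2)"
      using assms by (intro Gamma_plus1) (auto elim!: nonpos_Ints_cases)
    moreover have "Gamma (real d / 2) > 0" using assms by (intro Gamma_real_pos) auto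
    ultimately show ?thesis using assms n by (simp add: unit_ball_vol_def sphere_area_def a_def field_simps)
  qed
  have B1: "Beta (1 - a) (1 + a) = a * pi / sin (pi * a)"
    using GG Gamma_fact[of 1, where 'a = real] by (simp add: Beta_def)
  show 1: "unit_ball_vol (real d) * Beta (1 - real d / (2 * real n)) (1 + real d / (2 * real n)) = resolvent_mass d n"
  proof -
    have "unit_ball_vol (real d) * Beta (1 - a) (1 + a) = (unit_ball_vol (real d) * a) * (pi / sin (pi * a))"
      by (simp add: B1)
    also have "\<dots> = resolvent_mass d n" unfolding Vd unfolding resolvent_mass_def a_def by simp
    finally show ?thesis unfolding a_def .
  qed
  have "Gamma (2 - a) = (1 - a) * Gamma (1 - a)"
  proof -
    have "1 - a \<notin> \<int>\<^sub>\<le>\<^sub>0" using a by (auto elim!: nonpos_Ints_cases)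
    from Gamma_plus1[OF this] show ?thesis by simp
  qed
  moreover have "Gamma (3::real) = 2" using Gamma_fact[of 2, where 'a = real] by simp
  moreover have "Gamma (2::real) = 1" using Gamma_fact[of 1, where 'a = real] by simp
  ultimately have "2 * Beta (2 - a) (1 + a) = (1 - a) * Beta (1 - a) (1 + a)"
    by (simp add: Beta_def)
  then have "unit_ball_vol (real d) * 2 * Beta (2 - a) (1 + a) = (1 - a) * (unit_ball_vol (real d) * Beta (1 - a) (1 + a))"
    by simp
  then show "unit_ball_vol (real d) * 2 * Beta (2 - real d / (2 * real n)) (1 + real d / (2 * real n))
      = (1 - real d / (2 * real n)) * resolvent_mass d n"
    using 1 unfolding a_def by simp
  show "resolvent_mass d n > 0"
    unfolding 1[symmetric] using a assms unfolding a_def[symmetric]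
    by (intro mult_pos_pos) (auto simp: B1 \<open>sin (pi * a) > 0\<close>)
qed

lemma nn_integral_resolvent_power:
  fixes n p :: nat and R :: real
  defines "d \<equiv> real DIM('a::euclidean_space)"
  assumes d: "d < 2 * real n" and R: "R > 0" and p: "p > 0"
  shows "(\<integral>\<^sup>+x. ennreal (resolvent n R (x :: 'a) ^ p) \<partial>lborel) =
    ennreal (unit_ball_vol d * real p * Beta (real p - d / (2 * real n)) (1 + d / (2 * real n)) * R ^ DIM('a) / R ^ (2 * n * p))"
proof -
  let ?c = "unit_ball_vol d * real p * Beta (real p - d / (2 * real n)) (1 + d / (2 * real n))"
  have nn: "resolvent n R x ^ p \<ge> 0" for x :: 'a using resolvent_pos[OF R, of n x] by simp
  have "(\<integral>\<^sup>+x. ennreal (resolvent n R (x :: 'a) ^ p) \<partial>lborel) =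
    (\<integral>\<^sup>+x. ennreal (1 / R ^ (2 * n * p)) * ennreal ((R ^ (2 * n) * resolvent n R (x :: 'a)) ^ p) \<partial>lborel)"
    using R by (intro nn_integral_cong) (simp add: power_mult_distrib power_mult flip: ennreal_mult')
  also have "\<dots> = ennreal (1 / R ^ (2 * n * p)) * ennreal (unit_ball_vol d * R ^ DIM('a) * real p * Beta (real p - d / (2 * real n)) (1 + d / (2 * real n)))"
    using nn_integral_normalized_resolvent_power[of n R p, where 'a = 'a] assms
    by (subst nn_integral_cmult) auto
  also have "\<dots> = ennreal (?c * R ^ DIM('a) / R ^ (2 * n * p))"
    using R by (subst ennreal_mult'[symmetric]) (auto simp: mult_ac)
  finally show ?thesis .
qed

text \<open>
The estimate \<open>|S - J| \<le> \<beta> S\<close> with \<open>\<beta> = C/R\<^bsup>d+1\<^esup> \<le> 1/2\<close> first gives \<open>S \<le> 2J\<close> and then \<open>|S - J| \<le> 2\<beta>J\<close>. Since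
\<open>R\<^bsup>2np\<^esup>J\<close> is a multiple of \<open>R\<^sup>d\<close>, the normalized error is \<open>O(1/R)\<close>.
\<close>

lemma lattice_resolvent_sum_asymptotics:
  fixes n p :: nat
  defines "d \<equiv> real CARD('d::finite)"
  defines "c \<equiv> unit_ball_vol d * real p * Beta (real p - d / (2 * real n)) (1 + d / (2 * real n))"
  assumes d: "d < 2 * real n" and p: "p > 0"
  shows "\<And>R. R > 0 \<Longrightarrow> (\<lambda>k :: int ^ 'd. resolvent n R (freq k) ^ p) summable_on UNIV"
    and "((\<lambda>R. R ^ (2 * n * p) * (\<Sum>\<^sub>\<infinity>k :: int ^ 'd. resolvent n R (freq k) ^ p) - c * R ^ CARD('d)) \<longlongrightarrow> 0) at_top"
proof -
  have d0: "d > 0" by (simp add: d_def)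
  then have n: "n > 0" using d by (cases n) auto
  have "d / (2 * real n) < 1" using d n by simp
  also have "1 \<le> real p" using p by simp
  finally have "d / (2 * real n) < real p" .
  then have B: "Beta (real p - d / (2 * real n)) (1 + d / (2 * real n)) > 0"
    using d0 n p unfolding Beta_def by (intro divide_pos_pos mult_pos_pos Gamma_real_pos) (auto simp: add_pos_pos add_pos_nonneg)
  have c: "c \<ge> 0" using B d0 by (simp add: c_def)
  define J where "J R = c * R ^ CARD('d) / R ^ (2 * n * p)" for R :: real
  have J0: "J R \<ge> 0" if "R > 0" for R using that c by (simp add: J_def)
  have J: "(\<integral>\<^sup>+x. ennreal (resolvent n R (x :: real ^ 'd) ^ p) \<partial>lborel) = ennreal (J R)" if "R > 0" for R
    using nn_integral_resolvent_power[of n R p, where 'a = "real ^ 'd"] d p that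
    by (simp add: J_def c_def d_def)
  show summ: "(\<lambda>k :: int ^ 'd. resolvent n R (freq k) ^ p) summable_on UNIV" if "R > 0" for R
    by (rule resolvent_power_summable[OF that J[OF that] J0[OF that]])
  define S where "S R = (\<Sum>\<^sub>\<infinity>k :: int ^ 'd. resolvent n R (freq k) ^ p)" for R
  \<comment> \<open>differences of order \<open>d + 1\<close> beat the growth \<open>R\<^sup>d\<close> of the sum by one factor \<open>R\<close>\<close>
  let ?m = "Suc CARD('d)"
  obtain C R0 where C: "C \<ge> 0" "R0 > 0"
    and diff: "\<And>R x s. R \<ge> R0 \<Longrightarrow> norm (s :: real ^ 'd) \<le> d \<Longrightarrow>
       \<bar>\<Sum>j\<le>?m. (-1) ^ j * real (?m choose j) * resolvent n R (x + real j *\<^sub>R s) ^ p\<bar> \<le> C / R ^ ?m * resolvent n R x ^ p"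
    using resolvent_power_difference[OF n d0, where p = p and m = ?m and 'a = "real ^ 'd"] by blast
  \<comment> \<open>\<open>R \<ge> 2C\<close> and \<open>R \<ge> 1\<close> ensure \<open>C/R\<^bsup>d+1\<^esup> \<le> 1/2\<close>\<close>
  define R1 where "R1 = max R0 (max 1 (2 * C))"
  have main: "\<bar>R ^ (2 * n * p) * S R - c * R ^ CARD('d)\<bar> \<le> 2 * C * c / R" if R: "R \<ge> R1" for R
  proof -
    have R': "R \<ge> R0" "R \<ge> 1" "R \<ge> 2 * C" "R > 0" using R C by (auto simp: R1_def)
    define \<beta> where "\<beta> = C / R ^ ?m"
    have "R \<le> R ^ ?m" using R' by (intro self_le_power) auto
    then have "2 * C \<le> R ^ ?m" using R' by linarith
    then have \<beta>: "0 \<le> \<beta>" "\<beta> \<le> 1 / 2" using C R' by (auto simp: \<beta>_def field_simps)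
    have near: "\<bar>S R - J R\<bar> \<le> \<beta> * S R"
    proof (rule lattice_sum_near_integral[OF _ _ J[OF R'(4)] J0[OF R'(4)], where m = ?m])
      show "0 \<le> resolvent n R x ^ p" for x :: "real ^ 'd"
        using resolvent_pos[OF R'(4), of n x] by simp
      show "((\<lambda>k. resolvent n R (freq k) ^ p) has_sum S R) (UNIV :: (int ^ 'd) set)"
        unfolding S_def using summ[OF R'(4)] by (rule has_sum_infsum)
      show "\<bar>\<Sum>j\<le>?m. (-1) ^ j * real (?m choose j) * resolvent n R (freq k + real j *\<^sub>R s) ^ p\<bar>
         \<le> \<beta> * resolvent n R (freq k) ^ p" if "s \<in> unit_cube" for k and s :: "real ^ 'd"
        unfolding \<beta>_def using diff[OF R'(1)] norm_unit_cube[OF that] by (simp add: d_def)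
    qed simp_all
    have S0: "S R \<ge> 0" unfolding S_def
      by (intro infsum_nonneg zero_le_power less_imp_le resolvent_pos R'(4))
    have "\<beta> * S R \<le> 1 / 2 * S R" using \<beta> S0 by (intro mult_right_mono) auto
    with near have "S R \<le> 2 * J R" by linarith
    then have "\<beta> * S R \<le> \<beta> * (2 * J R)" using \<beta> by (intro mult_left_mono) auto
    with near have "\<bar>S R - J R\<bar> \<le> 2 * \<beta> * J R" by linarith
    then have "R ^ (2 * n * p) * \<bar>S R - J R\<bar> \<le> R ^ (2 * n * p) * (2 * \<beta> * J R)"
      using R' by (intro mult_left_mono) auto
    also have "\<dots> = 2 * C * c / R"
      using R' by (simp add: \<beta>_def J_def)
    also have "R ^ (2 * n * p) * \<bar>S R - J R\<bar> = \<bar>R ^ (2 * n * p) * S R - c * R ^ CARD('d)\<bar>"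
    proof -
      have "R ^ (2 * n * p) * S R - c * R ^ CARD('d) = R ^ (2 * n * p) * (S R - J R)"
        using R' by (simp add: J_def algebra_simps)
      then show ?thesis using R' by (simp add: abs_mult)
    qed
    finally show ?thesis .
  qed
  have "((\<lambda>R. R ^ (2 * n * p) * S R - c * R ^ CARD('d)) \<longlongrightarrow> 0) at_top"
  proof (rule Lim_null_comparison[of _ "\<lambda>R. 2 * C * c / R"])
    show "eventually (\<lambda>R. norm (R ^ (2 * n * p) * S R - c * R ^ CARD('d)) \<le> 2 * C * c / R) at_top"
      using main by (auto simp: eventually_at_top_linorder)
    show "((\<lambda>R. 2 * C * c / R) \<longlongrightarrow> 0) at_top"
      by (intro tendsto_divide_0[OF tendsto_const] filterlim_at_top_imp_at_infinity filterlim_ident)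
  qed
  then show "((\<lambda>R. R ^ (2 * n * p) * (\<Sum>\<^sub>\<infinity>k :: int ^ 'd. resolvent n R (freq k) ^ p) - c * R ^ CARD('d)) \<longlongrightarrow> 0) at_top"
    by (simp only: S_def)
qed

section \<open>Fourier series on the torus\<close>

lemma space_torus: "space (torus :: (real ^ 'd::finite) measure) = cbox 0 (\<chi> i. 2 * pi)"
  by (simp add: torus_def)

lemma emeasure_torus: "emeasure torus (space (torus :: (real ^ 'd::finite) measure)) = ennreal ((2 * pi) ^ CARD('d))"
proof -
  have "emeasure torus (space (torus :: (real ^ 'd) measure)) = emeasure lborel (cbox 0 (\<chi> i. 2 * pi) :: (real ^ 'd) set)"
    unfolding space_torus by (simp add: torus_def emeasure_restrict_space)
  also have "\<dots> = ennreal (\<Prod>b\<in>(Basis :: (real ^ 'd) set). ((\<chi> i. 2 * pi) - 0) \<bullet> b)"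
    by (rule emeasure_lborel_cbox) (auto simp: Basis_vec_def inner_axis)
  also have "(\<Prod>b\<in>(Basis :: (real ^ 'd) set). ((\<chi> i. 2 * pi) - 0) \<bullet> b) = (\<Prod>b\<in>(Basis :: (real ^ 'd) set). 2 * pi)"
    by (intro prod.cong) (auto simp: Basis_vec_def inner_axis)
  finally show ?thesis by simp
qed

lemma finite_measure_torus: "finite_measure (torus :: (real ^ 'd::finite) measure)"
  by (rule finite_measureI) (simp add: emeasure_torus)

lemma measure_torus: "measure torus (space (torus :: (real ^ 'd::finite) measure)) = (2 * pi) ^ CARD('d)"
  by (simp add: measure_def emeasure_torus)

lemma continuous_on_torus_borel:
  assumes "continuous_on UNIV f"
  shows "f \<in> borel_measurable (torus :: (real ^ 'd::finite) measure)"
proof -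
  have "f \<in> borel_measurable lborel"
    using borel_measurable_continuous_onI[OF assms] by simp
  then have "f \<in> borel_measurable lebesgue" by (rule measurable_completion)
  then show ?thesis unfolding torus_def by (rule measurable_restrict_space1)
qed

lemma bounded_torus_integrable:
  fixes f :: "real ^ 'd::finite \<Rightarrow> 'b::{banach, second_countable_topology}"
  assumes "f \<in> borel_measurable torus" "\<And>x. norm (f x) \<le> B"
  shows "integrable torus f"
  using assms by (intro finite_measure.integrable_const_bound[OF finite_measure_torus, of _ B]) auto

definition torus_char :: "int ^ 'd::finite \<Rightarrow> real ^ 'd \<Rightarrow> complex" where
  "torus_char k x = cis (freq k \<bullet> x)"

lemma torus_char_0 [simp]: "torus_char 0 x = 1"
  by (simp add: torus_char_def freq_def inner_vec_def)

lemma freq_add: "freq (k + l) = freq k + freq l"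
  by (simp add: freq_def vec_eq_iff)

lemma freq_minus: "freq (- k) = - freq k"
  by (simp add: freq_def vec_eq_iff)

lemma torus_char_add: "torus_char (k + l) x = torus_char k x * torus_char l x"
  by (simp add: torus_char_def freq_add inner_add_left cis_mult)

lemma torus_char_minus: "torus_char (- k) x = cnj (torus_char k x)"
  by (simp add: torus_char_def freq_minus cis_cnj)

lemma norm_torus_char [simp]: "norm (torus_char k x) = 1"
  by (simp add: torus_char_def)

lemma continuous_torus_char: "continuous_on UNIV (torus_char k)"
  unfolding torus_char_def cis_conv_exp by (intro continuous_intros)

lemma torus_char_measurable [measurable]: "torus_char k \<in> borel_measurable torus"
  by (rule continuous_on_torus_borel[OF continuous_torus_char])

lemma torus_periodic_char: "torus_periodic (torus_char k)"
  unfolding torus_periodic_def torus_char_def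
proof (intro allI)
  fix x :: "real ^ 'a" and i
  have "freq k \<bullet> (x + axis i (2 * pi)) = freq k \<bullet> x + 2 * pi * real_of_int (k $ i)"
    by (simp add: inner_add_right inner_axis freq_def)
  then show "cis (freq k \<bullet> (x + axis i (2 * pi))) = cis (freq k \<bullet> x)"
    by (simp flip: cis_mult add: cis_multiple_2pi)
qed

lemma integral_torus_eq_lborel:
  fixes f :: "real ^ 'd::finite \<Rightarrow> complex"
  assumes "continuous_on UNIV f"
  shows "(LINT x|torus. f x) = (LINT x|lborel. indicator (cbox 0 (\<chi> i. 2 * pi)) x *\<^sub>R f x)"
proof -
  have "(LINT x|torus. f x) = (LINT x|lebesgue. indicator (cbox 0 (\<chi> i. 2 * pi)) x *\<^sub>R f x)"
    unfolding torus_def by (subst integral_restrict_space) auto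
  also have "\<dots> = (LINT x|lborel. indicator (cbox 0 (\<chi> i. 2 * pi)) x *\<^sub>R f x)"
    using borel_measurable_continuous_onI[OF assms] by (intro integral_completion) auto
  finally show ?thesis .
qed

lemma integral_cis_period:
  fixes m :: int
  shows "(LINT t|lborel. indicator {0..2 * pi} t *\<^sub>R cis (real_of_int m * t)) = (if m = 0 then of_real (2 * pi) else 0)"
proof (cases "m = 0")
  case False
  have "(LINT t|lborel. indicator {0..2 * pi} t *\<^sub>R cis (real_of_int m * t)) =
    cis (real_of_int m * (2 * pi)) / (\<i> * of_int m) - cis (real_of_int m * 0) / (\<i> * of_int m)"
  proof (rule integral_FTC_atLeastAtMost)
    fix t :: real
    show "((\<lambda>t. cis (real_of_int m * t) / (\<i> * of_int m)) has_vector_derivative cis (real_of_int m * t)) (at t within {0..2 * pi})"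
    proof -
      have "((\<lambda>z. exp (\<i> * of_int m * z) / (\<i> * of_int m)) has_field_derivative exp (\<i> * of_int m * of_real t)) (at (of_real t))"
        using False by (auto intro!: derivative_eq_intros)
      from has_vector_derivative_real_field[OF this]
      show ?thesis by (simp add: cis_conv_exp mult.assoc)
    qed
  qed (auto intro!: continuous_intros simp: cis_conv_exp)
  also have "cis (real_of_int m * (2 * pi)) = 1"
    using cis_multiple_2pi[of "real_of_int m"] by (simp add: mult_ac)
  finally show ?thesis using False by simp
qed (simp add: scaleR_conv_of_real)

text \<open>
The integral factors into one integral over \<open>[0, 2\<pi>]\<close> per coordinate.
\<close>

lemma integral_torus_char:
  "(LINT x|torus. torus_char k x) = (if k = 0 then of_real ((2 * pi) ^ CARD('d)) else 0)" for k :: "int ^ 'd::finite"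
proof -
  let ?B = "Basis :: (real ^ 'd) set"
  interpret product_sigma_finite "\<lambda>_ :: real ^ 'd. lborel :: real measure" ..
  define g where "g b t = indicator {0..2 * pi} t *\<^sub>R cis ((freq k \<bullet> b) * t)" for b :: "real ^ 'd" and t :: real
  have gi: "integrable lborel (g b)" for b
    unfolding g_def by (rule borel_integrable_atLeastAtMost'[unfolded set_integrable_def]) (auto intro!: continuous_intros simp: cis_conv_exp)
  have gb [measurable]: "g b \<in> borel_measurable borel" for b
    using borel_measurable_integrable[OF gi[of b]] by simp
  have split: "indicator (cbox 0 (\<chi> i. 2 * pi)) x *\<^sub>R torus_char k x = (\<Prod>b\<in>?B. g b (x \<bullet> b))" for x :: "real ^ 'd"
  proof -
    have "torus_char k x = (\<Prod>b\<in>?B. cis ((freq k \<bullet> b) * (x \<bullet> b)))"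
    proof -
      have "freq k \<bullet> x = (\<Sum>b\<in>?B. (freq k \<bullet> b) * (x \<bullet> b))" by (rule euclidean_inner)
      then show ?thesis by (simp add: torus_char_def cis_conv_exp exp_sum sum_distrib_left)
    qed
    moreover have "(indicator (cbox 0 (\<chi> i. 2 * pi)) x :: real) = (\<Prod>b\<in>?B. indicator {0..2 * pi} (x \<bullet> b))"
    proof -
      have "x \<in> cbox 0 (\<chi> i. 2 * pi) \<longleftrightarrow> (\<forall>b\<in>?B. x \<bullet> b \<in> {0..2 * pi})"
        by (auto simp: mem_box Basis_vec_def inner_axis)
      then show ?thesis by (auto simp: indicator_def)
    qed
    ultimately show ?thesis
      by (simp add: g_def scaleR_conv_of_real prod.distrib)
  qed
  have "(LINT x|torus. torus_char k x) = (LINT x|lborel. (\<Prod>b\<in>?B. g b (x \<bullet> b)))"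
    by (simp add: integral_torus_eq_lborel[OF continuous_torus_char] split)
  also have "\<dots> = (LINT f|(\<Pi>\<^sub>M b\<in>?B. lborel). (\<Prod>b\<in>?B. g b ((\<Sum>b\<in>?B. f b *\<^sub>R b) \<bullet> b)))"
    by (subst lborel_eq, subst integral_distr) auto
  also have "\<dots> = (LINT f|(\<Pi>\<^sub>M b\<in>?B. lborel). (\<Prod>b\<in>?B. g b (f b)))"
    by (intro Bochner_Integration.integral_cong refl prod.cong) (simp add: inner_sum_left inner_Basis if_distrib sum.delta cong: if_cong)
  also have "\<dots> = (\<Prod>b\<in>?B. integral\<^sup>L lborel (g b))"
    by (rule product_integral_prod) (auto simp: gi)
  also have "\<dots> = (\<Prod>i\<in>(UNIV :: 'd set). if k $ i = 0 then of_real (2 * pi) else 0)"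
  proof -
    have B: "?B = range (\<lambda>i. axis i 1)" by (auto simp: Basis_vec_def)
    have inj: "inj (\<lambda>i. axis i (1::real) :: real ^ 'd)" by (auto simp: inj_on_def axis_eq_axis)
    have "integral\<^sup>L lborel (g (axis i 1)) = (if k $ i = 0 then of_real (2 * pi) else 0)" for i
      using integral_cis_period[of "k $ i"] by (simp add: g_def[abs_def] freq_def inner_axis)
    then show ?thesis unfolding B by (subst prod.reindex[OF inj]) simp
  qed
  also have "\<dots> = (if k = 0 then of_real ((2 * pi) ^ CARD('d)) else 0)"
    by (auto simp: vec_eq_iff)
  finally show ?thesis .
qed

lemma torus_L2_integrable:
  assumes "u \<in> torus_L2"
  shows "integrable torus u" "integrable torus (\<lambda>x. u x * torus_char k x)" "integrable torus (\<lambda>x. (cmod (u x))\<^sup>2)"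
    "u \<in> borel_measurable torus"
proof -
  from assms have u [measurable]: "u \<in> borel_measurable torus" and u2: "integrable torus (\<lambda>x. (cmod (u x))\<^sup>2)"
    by (auto simp: torus_L2_def)
  have "integrable torus (\<lambda>x. 1 + (cmod (u x))\<^sup>2)"
    using finite_measure_torus u2 by (auto intro!: finite_measure.integrable_const)
  then show "integrable torus u"
  proof (rule Bochner_Integration.integrable_bound)
    show "AE x in torus. norm (u x) \<le> norm (1 + (cmod (u x))\<^sup>2)"
    proof (intro always_eventually allI)
      fix x
      have "2 * cmod (u x) \<le> 1 + (cmod (u x))\<^sup>2" using sum_squares_bound[of 1 "cmod (u x)"] by simp
      then have "cmod (u x) \<le> 1 + (cmod (u x))\<^sup>2" using norm_ge_zero[of "u x"] by linarith
      then show "norm (u x) \<le> norm (1 + (cmod (u x))\<^sup>2)" by simp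
    qed
  qed measurable
  then show "integrable torus (\<lambda>x. u x * torus_char k x)"
    by (rule Bochner_Integration.integrable_bound) (auto simp: norm_mult)
qed (use assms in \<open>auto simp: torus_L2_def\<close>)

lemma fourier_coeff_char: "fourier_coeff u k = (LINT x|torus. u x * cnj (torus_char k x)) / complex_of_real ((2 * pi) ^ CARD('d))"
  for u :: "real ^ 'd::finite \<Rightarrow> complex"
  by (simp add: fourier_coeff_def torus_char_def cis_cnj)

definition trig_sum :: "(int ^ 'd::finite) set \<Rightarrow> (int ^ 'd \<Rightarrow> complex) \<Rightarrow> real ^ 'd \<Rightarrow> complex" where
  "trig_sum F a x = (\<Sum>k\<in>F. a k * torus_char k x)"

lemma continuous_trig_sum: "continuous_on UNIV (trig_sum F a)"
  unfolding trig_sum_def by (intro continuous_intros continuous_torus_char)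

lemma trig_sum_measurable [measurable]: "trig_sum F a \<in> borel_measurable torus"
  by (rule continuous_on_torus_borel[OF continuous_trig_sum])

lemma torus_periodic_trig_sum: "torus_periodic (trig_sum F a)"
  by (simp add: torus_periodic_def trig_sum_def torus_periodic_char[unfolded torus_periodic_def, rule_format])

lemma norm_trig_sum_le: "norm (trig_sum F a x) \<le> (\<Sum>k\<in>F. norm (a k))"
  unfolding trig_sum_def by (rule sum_norm_le) (simp add: norm_mult)

lemma trig_sum_L2: "trig_sum F a \<in> torus_L2"
  unfolding torus_L2_def
proof (intro CollectI conjI)
  have "norm ((cmod (trig_sum F a x))\<^sup>2) \<le> (\<Sum>k\<in>F. norm (a k))\<^sup>2" for x
    by (simp add: power_mono norm_trig_sum_le)
  then show "integrable torus (\<lambda>x. (cmod (trig_sum F a x))\<^sup>2)"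
    by (intro bounded_torus_integrable[where B = "(\<Sum>k\<in>F. norm (a k))\<^sup>2"]) auto
qed (auto simp: torus_periodic_trig_sum)

lemma fourier_coeff_trig_sum:
  fixes k :: "int ^ 'd::finite"
  assumes "finite F"
  shows "fourier_coeff (trig_sum F a) k = (if k \<in> F then a k else 0)"
proof -
  have "(LINT x|torus. trig_sum F a x * cnj (torus_char k x)) = (LINT x|torus. (\<Sum>l\<in>F. a l * torus_char (l - k) x))"
    by (intro Bochner_Integration.integral_cong refl)
      (simp add: trig_sum_def sum_distrib_right torus_char_add[of _ "- k", simplified] torus_char_minus mult.assoc)
  also have "\<dots> = (\<Sum>l\<in>F. a l * (LINT x|torus. torus_char (l - k) x))"
    by (subst Bochner_Integration.integral_sum)
      (auto intro!: bounded_torus_integrable[where B = 1] integrable_mult_right)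
  also have "\<dots> = (\<Sum>l\<in>F. if l = k then a k * of_real ((2 * pi) ^ CARD('d)) else 0)"
    by (intro sum.cong) (auto simp: integral_torus_char)
  also have "\<dots> = (if k \<in> F then a k * of_real ((2 * pi) ^ CARD('d)) else 0)"
    using assms by simp
  finally show ?thesis unfolding fourier_coeff_char by simp
qed

lemma integral_mult_cnj_trig_sum:
  fixes u :: "real ^ 'd::finite \<Rightarrow> complex"
  assumes "u \<in> torus_L2"
  shows "(LINT x|torus. u x * cnj (trig_sum F a x)) = of_real ((2 * pi) ^ CARD('d)) * (\<Sum>k\<in>F. fourier_coeff u k * cnj (a k))"
proof -
  have "(LINT x|torus. u x * cnj (trig_sum F a x)) = (LINT x|torus. (\<Sum>k\<in>F. cnj (a k) * (u x * torus_char (- k) x)))"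
    by (simp add: trig_sum_def sum_distrib_left torus_char_minus mult_ac)
  also have "\<dots> = (\<Sum>k\<in>F. cnj (a k) * (LINT x|torus. u x * torus_char (- k) x))"
    by (subst Bochner_Integration.integral_sum) (auto intro!: integrable_mult_right torus_L2_integrable(2) assms)
  also have "\<dots> = (\<Sum>k\<in>F. cnj (a k) * (of_real ((2 * pi) ^ CARD('d)) * fourier_coeff u k))"
    by (simp add: fourier_coeff_char torus_char_minus)
  finally show ?thesis by (simp add: sum_distrib_left mult_ac)
qed

lemma trig_sum_parseval:
  fixes a :: "int ^ 'd::finite \<Rightarrow> complex"
  assumes "finite F"
  shows "(LINT x|torus. (cmod (trig_sum F a x))\<^sup>2) = (2 * pi) ^ CARD('d) * (\<Sum>k\<in>F. (cmod (a k))\<^sup>2)"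
proof -
  have "complex_of_real (LINT x|torus. (cmod (trig_sum F a x))\<^sup>2) = (LINT x|torus. trig_sum F a x * cnj (trig_sum F a x))"
    by (simp only: integral_complex_of_real[symmetric] complex_norm_square)
  also have "\<dots> = of_real ((2 * pi) ^ CARD('d)) * (\<Sum>k\<in>F. a k * cnj (a k))"
    by (subst integral_mult_cnj_trig_sum[OF trig_sum_L2]) (simp add: fourier_coeff_trig_sum assms)
  also have "\<dots> = complex_of_real ((2 * pi) ^ CARD('d) * (\<Sum>k\<in>F. (cmod (a k))\<^sup>2))"
    by (simp only: complex_norm_square of_real_mult of_real_sum)
  finally show ?thesis by (simp only: of_real_eq_iff)
qed

lemma cnj_borel [measurable]: "cnj \<in> borel_measurable borel"
  by (intro borel_measurable_continuous_onI continuous_intros)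

text \<open>
Expand \<open>0 \<le> \<parallel>u - S\<parallel>\<^sup>2\<close> for the partial sum \<open>S\<close> of the Fourier series.
\<close>

lemma bessel_inequality:
  fixes u :: "real ^ 'd::finite \<Rightarrow> complex"
  assumes u: "u \<in> torus_L2" and F: "finite F"
  shows "(2 * pi) ^ CARD('d) * (\<Sum>k\<in>F. (cmod (fourier_coeff u k))\<^sup>2) \<le> (LINT x|torus. (cmod (u x))\<^sup>2)"
proof -
  let ?a = "fourier_coeff u"
  let ?S = "trig_sum F ?a"
  let ?T = "(2 * pi) ^ CARD('d) * (\<Sum>k\<in>F. (cmod (?a k))\<^sup>2)"
  note [measurable] = torus_L2_integrable(4)[OF u]
  have "norm (cnj (?S x)) \<le> (\<Sum>k\<in>F. norm (?a k))" for x
    by (simp add: norm_trig_sum_le)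
  then have "norm (u x * cnj (?S x)) \<le> norm ((\<Sum>k\<in>F. norm (?a k)) * norm (u x))" for x
    by (simp add: norm_mult mult.commute[of "norm (u x)"] mult_right_mono sum_nonneg)
  then have bd: "AE x in torus. norm (u x * cnj (?S x)) \<le> norm ((\<Sum>k\<in>F. norm (?a k)) * norm (u x))"
    by (rule AE_I2)
  have i: "integrable torus (\<lambda>x. u x * cnj (?S x))"
  proof (rule Bochner_Integration.integrable_bound[OF _ _ bd])
    show "integrable torus (\<lambda>x. (\<Sum>k\<in>F. norm (?a k)) * norm (u x))"
      using torus_L2_integrable(1)[OF u] by (intro integrable_mult_right integrable_norm)
  qed measurable
  have j: "integrable torus (\<lambda>x. (cmod (?S x))\<^sup>2)" using trig_sum_L2 torus_L2_integrable(3) by blast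
  have "0 \<le> (LINT x|torus. (cmod (u x - ?S x))\<^sup>2)" by simp
  also have "\<dots> = (LINT x|torus. (cmod (u x))\<^sup>2 - 2 * Re (u x * cnj (?S x)) + (cmod (?S x))\<^sup>2)"
    by (intro Bochner_Integration.integral_cong refl)
      (simp add: cmod_power2 power2_diff algebra_simps)
  also have "\<dots> = (LINT x|torus. (cmod (u x))\<^sup>2) - 2 * Re (LINT x|torus. u x * cnj (?S x)) + (LINT x|torus. (cmod (?S x))\<^sup>2)"
  proof -
    note k = torus_L2_integrable(3)[OF u]
    have r: "integrable torus (\<lambda>x. 2 * Re (u x * cnj (?S x)))"
      using i by (intro integrable_mult_right integrable_Re)
    have "(LINT x|torus. 2 * Re (u x * cnj (?S x))) = 2 * Re (LINT x|torus. u x * cnj (?S x))"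
      by (simp only: integral_mult_right_zero integral_Re[OF i])
    then show ?thesis
      by (simp only: Bochner_Integration.integral_add[OF Bochner_Integration.integrable_diff[OF k r] j]
          Bochner_Integration.integral_diff[OF k r])
  qed
  also have "(LINT x|torus. u x * cnj (?S x)) = of_real ?T"
    by (simp only: integral_mult_cnj_trig_sum[OF u] complex_norm_square of_real_mult of_real_sum)
  also have "(LINT x|torus. (cmod (?S x))\<^sup>2) = ?T" by (rule trig_sum_parseval[OF F])
  finally show ?thesis unfolding Re_complex_of_real by linarith
qed

lemma torus_integrable_cnj_char:
  assumes "integrable torus u"
  shows "integrable torus (\<lambda>x. u x * cnj (torus_char k x))"
proof (rule Bochner_Integration.integrable_bound[OF assms])
  note [measurable] = borel_measurable_integrable[OF assms]
  show "(\<lambda>x. u x * cnj (torus_char k x)) \<in> borel_measurable torus" by measurable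
qed (simp add: norm_mult)

text \<open>
An increasing sequence of finite sets whose complements carry prescribed small mass; it lets a family of
partial sums indexed by finite sets be treated as a rapidly convergent sequence.
\<close>

lemma small_tail_exhaustion:
  fixes f :: "'k \<Rightarrow> real"
  assumes f: "f summable_on UNIV" and nn: "\<And>k. f k \<ge> 0" and e: "\<And>N::nat. e N > 0"
  obtains F :: "nat \<Rightarrow> 'k set" where "\<And>N. finite (F N)" "\<And>N. F N \<subseteq> F (Suc N)"
    "\<And>N G. finite G \<Longrightarrow> G \<inter> F N = {} \<Longrightarrow> sum f G \<le> e N"
proof -
  have "\<exists>H. finite H \<and> infsum f UNIV - e N \<le> sum f H" for N
  proof -
    obtain H where "finite H" "dist (sum f H) (infsum f UNIV) \<le> e N"
      using has_sum_finite_approximation[OF has_sum_infsum[OF f] e] by blast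
    then show ?thesis by (intro exI[of _ H]) (auto simp: dist_real_def)
  qed
  then obtain H where H: "\<And>N. finite (H N)" "\<And>N. infsum f UNIV - e N \<le> sum f (H N)" by metis
  define F where "F N = (\<Union>i\<le>N. H i)" for N
  show ?thesis
  proof
    show fin: "finite (F N)" for N using H by (simp add: F_def)
    show "F N \<subseteq> F (Suc N)" for N unfolding F_def by (intro UN_mono) auto
    fix N and G assume G: "finite G" "G \<inter> F N = {}"
    have "sum f (H N) + sum f G \<le> sum f (F N) + sum f G"
      using fin nn by (intro add_right_mono sum_mono2) (auto simp: F_def)
    also have "\<dots> = sum f (F N \<union> G)" using fin G by (subst sum.union_disjoint) auto
    also have "\<dots> \<le> infsum f UNIV" using fin G nn by (intro finite_sum_le_infsum[OF f]) auto
    finally show "sum f G \<le> e N" using H(2)[of N] by linarith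
  qed
qed

text \<open>
Partial sums over finite sets with tails below \<open>4\<^sup>-\<^sup>N\<close> have increments of \<open>L\<^sup>1\<close> norm \<open>O(2\<^sup>-\<^sup>N)\<close>. The increments are
therefore absolutely summable almost everywhere with integrable sum. The limit inherits the \<open>L\<^sup>2\<close> bound by Fatou's lemma
and the coefficients by dominated convergence.
\<close>

theorem riesz_fischer:
  fixes a :: "int ^ 'd::finite \<Rightarrow> complex"
  assumes a: "(\<lambda>k. (cmod (a k))\<^sup>2) summable_on UNIV"
  obtains v where "v \<in> torus_L2" "\<And>k. fourier_coeff v k = a k"
    "(LINT x|torus. (cmod (v x))\<^sup>2) \<le> (2 * pi) ^ CARD('d) * (\<Sum>\<^sub>\<infinity>k. (cmod (a k))\<^sup>2)"
proof -
  let ?N = "(2 * pi) ^ CARD('d)"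
  obtain F where F: "\<And>N. finite (F N)" "\<And>N. F N \<subseteq> F (Suc N)"
    "\<And>N G. finite G \<Longrightarrow> G \<inter> F N = {} \<Longrightarrow> (\<Sum>k\<in>G. (cmod (a k))\<^sup>2) \<le> (1 / 4) ^ N"
    using small_tail_exhaustion[OF a, of "\<lambda>N. (1 / 4) ^ N"] by auto
  define S where "S N = trig_sum (F N) a" for N
  define g where "g N = trig_sum (F (Suc N) - F N) a" for N
  have S_Suc: "S (Suc N) x = S N x + g N x" for N x
    unfolding S_def g_def trig_sum_def
    using F(1)[of "Suc N"] F(2)[of N] by (subst sum.subset_diff[of "F N" "F (Suc N)"]) (auto simp: add.commute)
  have Sm [measurable]: "S N \<in> borel_measurable torus" and gm [measurable]: "g N \<in> borel_measurable torus" for N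
    unfolding S_def g_def by measurable
  have gi: "integrable torus (g N)" for N
    unfolding g_def by (rule torus_L2_integrable(1)[OF trig_sum_L2])
  have Si: "integrable torus (S N)" for N
    unfolding S_def by (rule torus_L2_integrable(1)[OF trig_sum_L2])
  \<comment> \<open>\<open>2 |z| \<le> e + |z|\<^sup>2/e\<close> with \<open>e = 2\<^sup>-\<^sup>N\<close> turns the bound \<open>4\<^sup>-\<^sup>N\<close> on squares into the bound \<open>2\<^sup>-\<^sup>N\<close> in \<open>L\<^sup>1\<close>\<close>
  have g1: "(LINT x|torus. norm (g N x)) \<le> ?N * (1 / 2) ^ N" for N
  proof -
    have g2: "integrable torus (\<lambda>x. (cmod (g N x))\<^sup>2)"
      unfolding g_def by (rule torus_L2_integrable(3)[OF trig_sum_L2])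
    have c: "integrable (torus :: (real ^ 'd) measure) (\<lambda>x. c :: real)" for c
      using finite_measure_torus by (rule finite_measure.integrable_const)
    have "(LINT x|torus. norm (g N x)) \<le> (LINT x|torus. (1 / 2) * (1 / 2) ^ N + (1 / 2) * (2 ^ N * (cmod (g N x))\<^sup>2))"
    proof (rule integral_mono)
      show "norm (g N x) \<le> (1 / 2) * (1 / 2) ^ N + (1 / 2) * (2 ^ N * (cmod (g N x))\<^sup>2)" for x
      proof -
        have "0 \<le> 2 ^ N * (cmod (g N x) - (1 / 2) ^ N)\<^sup>2" by simp
        also have "\<dots> = 2 ^ N * (cmod (g N x))\<^sup>2 - 2 * (2 ^ N * (1 / 2) ^ N) * cmod (g N x) + (2 ^ N * (1 / 2) ^ N) * (1 / 2) ^ N"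
          by (simp only: power2_diff power2_eq_square algebra_simps)
        also have "(2::real) ^ N * (1 / 2) ^ N = 1" by (simp flip: power_mult_distrib)
        finally show ?thesis by simp
      qed
    qed (use gi g2 c in auto)
    also have "\<dots> = (1 / 2) * (1 / 2) ^ N * ?N + (1 / 2) * (2 ^ N * (LINT x|torus. (cmod (g N x))\<^sup>2))"
      using g2 c by (subst Bochner_Integration.integral_add) (auto simp: measure_torus)
    also have "(LINT x|torus. (cmod (g N x))\<^sup>2) = ?N * (\<Sum>k\<in>F (Suc N) - F N. (cmod (a k))\<^sup>2)"
      unfolding g_def using F by (intro trig_sum_parseval) auto
    also have "(1 / 2) * (1 / 2) ^ N * ?N + (1 / 2) * (2 ^ N * (?N * (\<Sum>k\<in>F (Suc N) - F N. (cmod (a k))\<^sup>2)))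
       \<le> (1 / 2) * (1 / 2) ^ N * ?N + (1 / 2) * (2 ^ N * (?N * (1 / 4) ^ N))"
      using F by (intro add_left_mono mult_left_mono F(3)) auto
    also have "\<dots> = ?N * (1 / 2) ^ N"
    proof -
      have "(2::real) ^ N * (1 / 4) ^ N = (1 / 2) ^ N" by (simp flip: power_mult_distrib)
      then have "2 ^ N * (?N * (1 / 4) ^ N) = ?N * (1 / 2) ^ N"
        by (simp only: mult.left_commute[of _ ?N])
      moreover have "(1 / 2) * q * M + (1 / 2) * (M * q) = M * q" for q M :: real by simp
      ultimately show ?thesis by (simp only:)
    qed
    finally show ?thesis .
  qed
  have "(\<integral>\<^sup>+x. (\<Sum>N. ennreal (norm (g N x))) \<partial>torus) = (\<Sum>N. \<integral>\<^sup>+x. ennreal (norm (g N x)) \<partial>torus)"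
    by (rule nn_integral_suminf) measurable
  also have "\<dots> \<le> (\<Sum>N. ennreal (?N * (1 / 2) ^ N))"
    using g1 gi by (intro suminf_le) (auto simp: nn_integral_eq_integral)
  also have "\<dots> = ennreal (\<Sum>N. ?N * (1 / 2) ^ N)"
    by (rule suminf_ennreal_eq[OF _ summable_sums]) (auto intro!: summable_mult summable_geometric)
  finally have fin: "(\<integral>\<^sup>+x. (\<Sum>N. ennreal (norm (g N x))) \<partial>torus) < \<infinity>"
    by (rule le_less_trans) simp
  then have "AE x in torus. (\<Sum>N. ennreal (norm (g N x))) \<noteq> \<infinity>"
    by (intro nn_integral_PInf_AE) auto
  then have ae: "AE x in torus. summable (\<lambda>N. norm (g N x))"
    by (auto elim!: eventually_mono intro: summable_suminf_not_top)
  have S_eq: "S N x = S 0 x + (\<Sum>i<N. g i x)" for N x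
    by (induction N) (auto simp: S_Suc)
  have conv: "convergent (\<lambda>N. S N x)" if "summable (\<lambda>N. norm (g N x))" for x
  proof -
    have "(\<lambda>N. S 0 x + (\<Sum>i<N. g i x)) \<longlonglongrightarrow> S 0 x + (\<Sum>i. g i x)"
      using summable_norm_cancel[OF that] by (intro tendsto_intros summable_LIMSEQ)
    then show ?thesis by (auto simp: S_eq[symmetric] convergent_def)
  qed
  define v where "v x = lim (\<lambda>N. S N x)" for x
  have vm [measurable]: "v \<in> borel_measurable torus" unfolding v_def[abs_def] by measurable
  have lim: "AE x in torus. (\<lambda>N. S N x) \<longlonglongrightarrow> v x"
    using ae by (auto elim!: eventually_mono simp: v_def convergent_LIMSEQ_iff[symmetric] conv)
  have per: "torus_periodic v"
    unfolding torus_periodic_def v_def S_def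
    by (simp add: torus_periodic_trig_sum[unfolded torus_periodic_def, rule_format])
  have fatou: "(\<integral>\<^sup>+x. ennreal ((cmod (v x))\<^sup>2) \<partial>torus) \<le> ennreal (?N * (\<Sum>\<^sub>\<infinity>k. (cmod (a k))\<^sup>2))"
  proof -
    have "(\<integral>\<^sup>+x. ennreal ((cmod (v x))\<^sup>2) \<partial>torus) = (\<integral>\<^sup>+x. liminf (\<lambda>N. ennreal ((cmod (S N x))\<^sup>2)) \<partial>torus)"
    proof (rule nn_integral_cong_AE)
      show "AE x in torus. ennreal ((cmod (v x))\<^sup>2) = liminf (\<lambda>N. ennreal ((cmod (S N x))\<^sup>2))"
        using lim
      proof (rule eventually_mono)
        fix x assume "(\<lambda>N. S N x) \<longlonglongrightarrow> v x"
        then have "(\<lambda>N. ennreal ((cmod (S N x))\<^sup>2)) \<longlonglongrightarrow> ennreal ((cmod (v x))\<^sup>2)"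
          by (intro tendsto_ennrealI tendsto_intros)
        then show "ennreal ((cmod (v x))\<^sup>2) = liminf (\<lambda>N. ennreal ((cmod (S N x))\<^sup>2))"
          by (intro lim_imp_Liminf[symmetric]) auto
      qed
    qed
    also have "\<dots> \<le> liminf (\<lambda>N. \<integral>\<^sup>+x. ennreal ((cmod (S N x))\<^sup>2) \<partial>torus)"
      by (rule nn_integral_liminf) measurable
    also have "\<dots> \<le> ennreal (?N * (\<Sum>\<^sub>\<infinity>k. (cmod (a k))\<^sup>2))"
    proof (rule Liminf_le)
      show "\<forall>\<^sub>F N in sequentially. (\<integral>\<^sup>+x. ennreal ((cmod (S N x))\<^sup>2) \<partial>torus) \<le> ennreal (?N * (\<Sum>\<^sub>\<infinity>k. (cmod (a k))\<^sup>2))"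
      proof (intro always_eventually allI)
        fix N
        have "(\<integral>\<^sup>+x. ennreal ((cmod (S N x))\<^sup>2) \<partial>torus) = ennreal (LINT x|torus. (cmod (S N x))\<^sup>2)"
          unfolding S_def by (intro nn_integral_eq_integral torus_L2_integrable(3)[OF trig_sum_L2]) auto
        also have "(LINT x|torus. (cmod (S N x))\<^sup>2) = ?N * (\<Sum>k\<in>F N. (cmod (a k))\<^sup>2)"
          unfolding S_def using F(1) by (rule trig_sum_parseval)
        also have "ennreal \<dots> \<le> ennreal (?N * (\<Sum>\<^sub>\<infinity>k. (cmod (a k))\<^sup>2))"
          using F(1) by (intro ennreal_leI mult_left_mono finite_sum_le_infsum[OF a]) auto
        finally show "(\<integral>\<^sup>+x. ennreal ((cmod (S N x))\<^sup>2) \<partial>torus) \<le> ennreal (?N * (\<Sum>\<^sub>\<infinity>k. (cmod (a k))\<^sup>2))" .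
      qed
    qed simp
    finally show ?thesis .
  qed
  have vint: "integrable torus (\<lambda>x. (cmod (v x))\<^sup>2)"
    using fatou by (intro integrableI_nonneg) (auto intro: le_less_trans)
  have vL2: "v \<in> torus_L2" using per vm vint by (auto simp: torus_L2_def)
  have bound: "(LINT x|torus. (cmod (v x))\<^sup>2) \<le> ?N * (\<Sum>\<^sub>\<infinity>k. (cmod (a k))\<^sup>2)"
    using fatou by (subst (asm) nn_integral_eq_integral[OF vint])
      (auto simp: ennreal_le_iff infsum_nonneg mult_nonneg_nonneg)
  have coeff: "fourier_coeff v k = a k" for k
  proof -
    define w where "w x = norm (S 0 x) + (\<Sum>N. norm (g N x))" for x
    have wi: "integrable torus w"
      unfolding w_def
    proof (intro Bochner_Integration.integrable_add integrable_norm Si)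
      show "integrable torus (\<lambda>x. \<Sum>N. norm (g N x))"
      proof (rule integrableI_nonneg)
        have "(\<integral>\<^sup>+x. ennreal (\<Sum>N. norm (g N x)) \<partial>torus) = (\<integral>\<^sup>+x. (\<Sum>N. ennreal (norm (g N x))) \<partial>torus)"
          using ae by (intro nn_integral_cong_AE) (auto elim!: eventually_mono simp: suminf_ennreal2)
        then show "(\<integral>\<^sup>+x. ennreal (\<Sum>N. norm (g N x)) \<partial>torus) < \<infinity>" using fin by simp
        show "AE x in torus. 0 \<le> (\<Sum>N. norm (g N x))"
          using ae by (auto elim!: eventually_mono intro!: suminf_nonneg)
      qed measurable
    qed
    have "(\<lambda>N. LINT x|torus. S N x * cnj (torus_char k x)) \<longlonglongrightarrow> (LINT x|torus. v x * cnj (torus_char k x))"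
    proof (rule integral_dominated_convergence[where w = w])
      show "AE x in torus. (\<lambda>N. S N x * cnj (torus_char k x)) \<longlonglongrightarrow> v x * cnj (torus_char k x)"
        using lim by (auto elim!: eventually_mono intro!: tendsto_intros)
      show "AE x in torus. norm (S N x * cnj (torus_char k x)) \<le> w x" for N
        using ae
      proof (rule eventually_mono)
        fix x assume s: "summable (\<lambda>N. norm (g N x))"
        have "norm (S N x) \<le> norm (S 0 x) + norm (\<Sum>i<N. g i x)"
          unfolding S_eq[of N] by (rule norm_triangle_ineq)
        also have "norm (\<Sum>i<N. g i x) \<le> (\<Sum>i<N. norm (g i x))" by (rule norm_sum)
        also have "\<dots> \<le> (\<Sum>i. norm (g i x))" by (intro sum_le_suminf s) auto
        finally show "norm (S N x * cnj (torus_char k x)) \<le> w x" by (simp add: w_def norm_mult)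
      qed
    qed (use wi in measurable)
    then have l1: "(\<lambda>N. fourier_coeff (S N) k) \<longlonglongrightarrow> fourier_coeff v k"
      unfolding fourier_coeff_char by (intro tendsto_divide) auto
    have l2: "(\<lambda>N. fourier_coeff (S N) k) \<longlonglongrightarrow> a k"
    proof (rule LIM_zero_cancel, rule Lim_null_comparison)
      show "\<forall>\<^sub>F N in sequentially. norm (fourier_coeff (S N) k - a k) \<le> (1 / 2) ^ N"
      proof (intro always_eventually allI)
        fix N
        show "norm (fourier_coeff (S N) k - a k) \<le> (1 / 2) ^ N"
        proof (cases "k \<in> F N")
          case False
          then have "(cmod (a k))\<^sup>2 \<le> (1 / 4) ^ N" using F(3)[of "{k}" N] by simp
          also have "\<dots> = ((1 / 2) ^ N)\<^sup>2" by (simp add: power2_eq_square flip: power_mult_distrib)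
          finally have "cmod (a k) \<le> (1 / 2) ^ N" by (rule power2_le_imp_le) simp
          then show ?thesis using False F(1) by (simp add: S_def fourier_coeff_trig_sum)
        qed (use F(1) in \<open>simp add: S_def fourier_coeff_trig_sum\<close>)
      qed
      show "(\<lambda>N. (1 / 2 :: real) ^ N) \<longlonglongrightarrow> 0" by (rule LIMSEQ_realpow_zero) auto
    qed
    show ?thesis using LIMSEQ_unique[OF l1 l2] .
  qed
  show ?thesis using that vL2 coeff bound by blast
qed

section \<open>Completeness of the characters\<close>

text \<open>
Generating by monomials and sums keeps the products of two trigonometric polynomials accessible to induction.
\<close>

inductive trig_polynomial :: "(real ^ 'd::finite \<Rightarrow> complex) \<Rightarrow> bool" where
  monomial: "trig_polynomial (\<lambda>x. c * torus_char k x)"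
| add: "trig_polynomial p \<Longrightarrow> trig_polynomial q \<Longrightarrow> trig_polynomial (\<lambda>x. p x + q x)"

lemma trig_polynomial_const: "trig_polynomial (\<lambda>x. c)"
  using monomial[of c 0] by simp

lemma trig_polynomial_mult:
  assumes "trig_polynomial p" "trig_polynomial q"
  shows "trig_polynomial (\<lambda>x. p x * q x)"
  using assms(1)
proof induction
  case (monomial c k)
  show ?case using assms(2)
  proof induction
    case (monomial c' k')
    have "(\<lambda>x. c * torus_char k x * (c' * torus_char k' x)) = (\<lambda>x. (c * c') * torus_char (k + k') x)"
      by (simp add: torus_char_add mult_ac)
    then show ?case using trig_polynomial.monomial[of "c * c'" "k + k'"] by simp
  next
    case (add p q)
    then show ?case using trig_polynomial.add by (fastforce simp: distrib_left)
  qed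
next
  case (add p1 p2)
  then show ?case using trig_polynomial.add by (fastforce simp: distrib_right)
qed

lemma trig_polynomial_sum:
  assumes "finite I" "\<And>i. i \<in> I \<Longrightarrow> trig_polynomial (p i)"
  shows "trig_polynomial (\<lambda>x. \<Sum>i\<in>I. p i x)"
  using assms by (induction I) (auto intro: trig_polynomial_const trig_polynomial.add)

lemma integral_mult_trig_polynomial_eq_0:
  fixes w :: "real ^ 'd::finite \<Rightarrow> complex"
  assumes w: "integrable torus w" and 0: "\<And>k. fourier_coeff w k = 0" and "trig_polynomial p"
  shows "integrable torus (\<lambda>x. w x * p x) \<and> (LINT x|torus. w x * p x) = 0"
  using assms(3)
proof induction
  case (monomial c k)
  have eq: "w x * (c * torus_char k x) = c * (w x * cnj (torus_char (- k) x))" for x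
    by (simp add: torus_char_minus mult_ac)
  have "(LINT x|torus. w x * cnj (torus_char (- k) x)) = 0"
    using 0[of "- k"] unfolding fourier_coeff_char by simp
  then show ?case
    unfolding eq using torus_integrable_cnj_char[OF w, of "- k"] by simp
next
  case (add p q)
  then show ?case by (simp add: distrib_left)
qed

text \<open>
This realizes the torus as a compact subset of \<open>\<complex>\<^sup>d\<close>, where the Stone--Weierstrass theorem for polynomials applies; coordinates
of the image are trigonometric monomials.
\<close>

definition torus_embedding :: "real ^ 'd::finite \<Rightarrow> complex ^ 'd" where
  "torus_embedding x = (\<chi> i. cis (x $ i))"

lemma continuous_torus_embedding: "continuous_on S torus_embedding"
  unfolding torus_embedding_def cis_conv_exp by (intro continuous_intros)

lemma trig_polynomial_of_real_polynomial:
  assumes "real_polynomial_function (q :: complex ^ 'd::finite \<Rightarrow> real)"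
  shows "trig_polynomial (\<lambda>x. of_real (q (torus_embedding x)))"
  using assms
proof induction
  case (linear f)
  let ?k = "\<lambda>i. axis i (1::int)"
  have ch: "torus_char (?k i) x = cis (x $ i)" for i :: 'd and x
  proof -
    have "freq (?k i) = axis i 1" by (simp add: freq_def vec_eq_iff axis_def)
    then show ?thesis by (simp add: torus_char_def inner_commute[of "axis i 1"] inner_axis)
  qed
  have "f (torus_embedding x) = (\<Sum>i\<in>UNIV. cos (x $ i) * f (axis i 1) + sin (x $ i) * f (axis i \<i>))" for x
  proof -
    have "torus_embedding x = (\<Sum>i\<in>UNIV. cos (x $ i) *\<^sub>R axis i 1 + sin (x $ i) *\<^sub>R axis i \<i>)"
      by (simp add: vec_eq_iff torus_embedding_def axis_def if_distrib sum.distrib sum.delta complex_eq_iff cong: if_cong)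
    then show ?thesis
      using linear by (simp add: linear_sum[OF bounded_linear.linear] linear_add[OF bounded_linear.linear] linear_scale[OF bounded_linear.linear])
  qed
  moreover have "complex_of_real (cos t) = (1 / 2) * cis t + (1 / 2) * cnj (cis t)"
    "complex_of_real (sin t) = (- \<i> / 2) * cis t + (\<i> / 2) * cnj (cis t)" for t
    by (auto simp: complex_eq_iff)
  ultimately have "of_real (f (torus_embedding x)) =
    (\<Sum>i\<in>UNIV. ((1 / 2) * torus_char (?k i) x + (1 / 2) * torus_char (- ?k i) x) * of_real (f (axis i 1)) +
      ((- \<i> / 2) * torus_char (?k i) x + (\<i> / 2) * torus_char (- ?k i) x) * of_real (f (axis i \<i>)))" for x
    by (simp only: of_real_sum of_real_add of_real_mult ch torus_char_minus)
  then show ?case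
    by (simp only:) (intro trig_polynomial_sum finite trig_polynomial.add trig_polynomial_mult trig_polynomial_const trig_polynomial.monomial)
next
  case (add f g)
  then show ?case using trig_polynomial.add by fastforce
next
  case (mult f g)
  then show ?case using trig_polynomial_mult by fastforce
qed (rule trig_polynomial_const)

text \<open>
A function with vanishing Fourier coefficients is orthogonal to all trigonometric polynomials, hence to all
polynomials in the coordinates of the embedded torus, hence by uniform approximation to all continuous functions there.
\<close>

lemma integral_mult_continuous_eq_0:
  fixes w :: "real ^ 'd::finite \<Rightarrow> complex" and G :: "complex ^ 'd \<Rightarrow> real"
  assumes w: "integrable torus w" and 0: "\<And>k. fourier_coeff w k = 0" and G: "continuous_on UNIV G"
  shows "(LINT x|torus. w x * of_real (G (torus_embedding x))) = 0"
proof -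
  let ?X = "space (torus :: (real ^ 'd) measure)"
  let ?E = "torus_embedding :: real ^ 'd \<Rightarrow> complex ^ 'd"
  have cpt: "compact (?E ` ?X)"
    unfolding space_torus by (intro compact_continuous_image continuous_torus_embedding compact_cbox)
  note [measurable] = borel_measurable_integrable[OF w]
  have GE: "continuous_on UNIV (\<lambda>x. complex_of_real (G (?E x)))"
    by (intro continuous_intros continuous_on_compose2[OF G] continuous_torus_embedding) auto
  note [measurable] = continuous_on_torus_borel[OF GE]
  have "bounded (G ` ?E ` ?X)"
    by (intro compact_imp_bounded compact_continuous_image[OF continuous_on_subset[OF G] cpt]) simp
  then obtain B where B: "\<And>x. x \<in> ?X \<Longrightarrow> \<bar>G (?E x)\<bar> \<le> B" by (auto simp: bounded_iff)
  have wG: "integrable torus (\<lambda>x. w x * of_real (G (?E x)))"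
  proof (rule Bochner_Integration.integrable_bound)
    show "integrable torus (\<lambda>x. B * norm (w x))" using w by simp
    show "AE x in torus. norm (w x * of_real (G (?E x))) \<le> norm (B * norm (w x))"
    proof (rule AE_I2)
      fix x :: "real ^ 'd" assume "x \<in> ?X"
      then have "\<bar>G (?E x)\<bar> \<le> \<bar>B\<bar>" using B[of x] by simp
      then show "norm (w x * of_real (G (?E x))) \<le> norm (B * norm (w x))"
        by (simp add: norm_mult abs_mult mult.commute[of "\<bar>B\<bar>"] mult_left_mono)
    qed
  qed measurable
  have bound: "norm (LINT x|torus. w x * of_real (G (?E x))) \<le> e * (LINT x|torus. norm (w x))" if e: "e > 0" for e
  proof -
    obtain q where q: "real_polynomial_function q" "\<And>z. z \<in> ?E ` ?X \<Longrightarrow> \<bar>G z - q z\<bar> < e"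
      using Stone_Weierstrass_real_polynomial_function[OF cpt _ e, of G] G continuous_on_subset by blast
    have wq: "integrable torus (\<lambda>x. w x * of_real (q (?E x)))" "(LINT x|torus. w x * of_real (q (?E x))) = 0"
      using integral_mult_trig_polynomial_eq_0[OF w 0 trig_polynomial_of_real_polynomial[OF q(1)]] by auto
    have "(LINT x|torus. w x * of_real (G (?E x))) = (LINT x|torus. w x * of_real (G (?E x)) - w x * of_real (q (?E x)))"
      using wG wq by simp
    also have "norm \<dots> \<le> (LINT x|torus. e * norm (w x))"
    proof (rule Bochner_Integration.integral_norm_bound_integral)
      fix x :: "real ^ 'd" assume "x \<in> ?X"
      then have "\<bar>G (?E x) - q (?E x)\<bar> \<le> e" using q(2)[of "?E x"] by auto
      moreover have "w x * of_real (G (?E x)) - w x * of_real (q (?E x)) = w x * of_real (G (?E x) - q (?E x))"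
        by (simp add: algebra_simps)
      ultimately show "norm (w x * of_real (G (?E x)) - w x * of_real (q (?E x))) \<le> e * norm (w x)"
        by (simp only: norm_mult norm_of_real mult.commute[of e] mult_left_mono norm_ge_zero)
    qed (use wG wq w in auto)
    finally show ?thesis by simp
  qed
  have "norm (LINT x|torus. w x * of_real (G (?E x))) \<le> 0"
  proof (rule field_le_epsilon)
    fix e :: real assume e: "e > 0"
    define I where "I = (LINT x|torus. norm (w x))"
    have I: "I \<ge> 0" by (simp add: I_def)
    have "norm (LINT x|torus. w x * of_real (G (?E x))) \<le> e / (I + 1) * I"
      unfolding I_def using e I by (intro bound) (simp add: I_def[symmetric] add_nonneg_pos)
    also have "\<dots> \<le> e" using e I by (simp add: field_simps)
    finally show "norm (LINT x|torus. w x * of_real (G (?E x))) \<le> 0 + e" by simp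
  qed
  then show ?thesis by simp
qed

lemma torus_embedding_inj_on_box:
  assumes "torus_embedding x = torus_embedding y" "x \<in> box 0 (\<chi> i. 2 * pi)" "y \<in> box 0 (\<chi> i. 2 * pi)"
  shows "x = y"
proof (subst vec_eq_iff, intro allI)
  fix i
  have "cis (x $ i) = cis (y $ i)" using assms(1) by (simp add: torus_embedding_def vec_eq_iff)
  then have sc: "sin (x $ i) = sin (y $ i) \<and> cos (x $ i) = cos (y $ i)" by (simp add: complex_eq_iff)
  then obtain m :: int where m: "x $ i = y $ i + 2 * pi * real_of_int m" using sin_cos_eq_iff by blast
  have "0 < x $ i" "x $ i < 2 * pi" "0 < y $ i" "y $ i < 2 * pi"
    using assms(2,3) by (auto simp: mem_box_cart)
  then have "\<bar>x $ i - y $ i\<bar> < 2 * pi" by linarith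
  then have "2 * pi * \<bar>real_of_int m\<bar> < 2 * pi * 1" using m by (simp add: abs_mult)
  then have "m = 0" by (simp add: mult_less_cancel_left)
  then show "x $ i = y $ i" using m by simp
qed

lemma AE_torus_interior: "AE x in (torus :: (real ^ 'd::finite) measure). x \<in> box 0 (\<chi> i. 2 * pi)"
proof -
  have "negligible (cbox 0 (\<chi> i. 2 * pi) - box 0 (\<chi> i. 2 * pi) :: (real ^ 'd) set)"
    by (metis negligible_frontier_interval)
  then have "AE x in lebesgue. x \<notin> (cbox 0 (\<chi> i. 2 * pi) - box 0 (\<chi> i. 2 * pi) :: (real ^ 'd) set)"
    using AE_not_in negligible_iff_null_sets by blast
  then show ?thesis
    unfolding torus_def by (subst AE_restrict_space_iff) (auto elim!: eventually_mono)
qed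

text \<open>
The functions \<open>max 0 (1 - N dist(z, E(K)))\<close> are continuous on \<open>\<complex>\<^sup>d\<close> and decrease to the indicator of the image of \<open>K\<close>. The
embedding \<open>E\<close> is injective on the open period cell, so they pull back to the indicator of \<open>K\<close> there.
\<close>

lemma integral_compact_eq_0:
  fixes w :: "real ^ 'd::finite \<Rightarrow> complex"
  assumes w: "integrable torus w" and 0: "\<And>k. fourier_coeff w k = 0"
    and K: "compact K" "K \<subseteq> box 0 (\<chi> i. 2 * pi)"
  shows "(LINT x|torus. w x * indicator K x) = 0"
proof (cases "K = {}")
  case False
  let ?E = "torus_embedding :: real ^ 'd \<Rightarrow> complex ^ 'd"
  define G where "G N z = max 0 (1 - real N * infdist z (?E ` K))" for N z
  note [measurable] = borel_measurable_integrable[OF w]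
  have EK: "closed (?E ` K)" "?E ` K \<noteq> {}"
    using K False by (auto intro!: compact_imp_closed compact_continuous_image continuous_torus_embedding)
  have Kb: "K \<in> sets borel" using K by (simp add: compact_imp_closed)
  have Km [measurable]: "(indicator K :: real ^ 'd \<Rightarrow> complex) \<in> borel_measurable torus"
    using Kb unfolding torus_def by (intro measurable_restrict_space1 measurable_completion borel_measurable_indicator) simp
  have Gc: "continuous_on UNIV (G N)" for N
    unfolding G_def by (intro continuous_intros)
  have Gm [measurable]: "(\<lambda>x. complex_of_real (G N (?E x))) \<in> borel_measurable torus" for N
    by (intro continuous_on_torus_borel continuous_intros continuous_on_compose2[OF Gc] continuous_torus_embedding) auto
  have "(\<lambda>N. LINT x|torus. w x * of_real (G N (?E x))) \<longlonglongrightarrow> (LINT x|torus. w x * indicator K x)"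
  proof (rule integral_dominated_convergence[where w = "\<lambda>x. norm (w x)"])
    show "AE x in torus. (\<lambda>N. w x * of_real (G N (?E x))) \<longlonglongrightarrow> w x * indicator K x"
      using AE_torus_interior
    proof (rule eventually_mono)
      fix x :: "real ^ 'd" assume x: "x \<in> box 0 (\<chi> i. 2 * pi)"
      have "(\<lambda>N. G N (?E x)) \<longlonglongrightarrow> indicator K x"
      proof (cases "x \<in> K")
        case True
        then have "infdist (?E x) (?E ` K) = 0" by (intro infdist_zero) auto
        then show ?thesis using True by (simp add: G_def)
      next
        case False
        have "?E x \<notin> ?E ` K"
        proof
          assume "?E x \<in> ?E ` K"
          then obtain y where "y \<in> K" "?E x = ?E y" by auto
          then have "x = y" using torus_embedding_inj_on_box x K by blast
          then show False using False \<open>y \<in> K\<close> by simp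
        qed
        then have pos: "infdist (?E x) (?E ` K) > 0"
          using EK in_closed_iff_infdist_zero[of "?E ` K" "?E x"] infdist_nonneg[of "?E x" "?E ` K"] by simp
        have "\<forall>\<^sub>F N in sequentially. 1 / infdist (?E x) (?E ` K) \<le> real N"
          using filterlim_real_sequentially by (simp add: filterlim_at_top)
        then have "\<forall>\<^sub>F N in sequentially. G N (?E x) = 0"
          by (rule eventually_mono) (use pos in \<open>simp add: G_def field_simps\<close>)
        then show ?thesis using False by (simp add: tendsto_eventually)
      qed
      then have "(\<lambda>N. w x * of_real (G N (?E x))) \<longlonglongrightarrow> w x * of_real (indicator K x)"
        by (intro tendsto_intros)
      then show "(\<lambda>N. w x * of_real (G N (?E x))) \<longlonglongrightarrow> w x * indicator K x"
        by (cases "x \<in> K") simp_all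
    qed
    show "AE x in torus. norm (w x * of_real (G N (?E x))) \<le> norm (w x)" for N
    proof (rule AE_I2)
      fix x
      have "\<bar>G N (?E x)\<bar> \<le> 1" by (auto simp: G_def infdist_nonneg)
      then show "norm (w x * of_real (G N (?E x))) \<le> norm (w x)"
        by (simp add: norm_mult mult_left_le)
    qed
  qed (auto intro!: borel_measurable_times Km Gm borel_measurable_integrable[OF w] integrable_norm w)
  moreover have "(LINT x|torus. w x * of_real (G N (?E x))) = 0" for N
    by (rule integral_mult_continuous_eq_0[OF w 0 Gc])
  ultimately show ?thesis by (simp add: LIMSEQ_const_iff)
qed simp

text \<open>
If the set where \<open>Re w > 0\<close> had positive measure, inner regularity would give a compact subset of positive measure, over which the integral of \<open>w\<close>
vanishes although its real part is positive.
\<close>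

lemma AE_Re_nonpos_if_coeffs_0:
  fixes w :: "real ^ 'd::finite \<Rightarrow> complex"
  assumes w: "integrable torus w" and 0: "\<And>k. fourier_coeff w k = 0"
  shows "AE x in torus. Re (w x) \<le> 0"
proof -
  let ?Q = "cbox 0 (\<chi> i. 2 * pi) :: (real ^ 'd) set"
  let ?B = "box 0 (\<chi> i. 2 * pi) :: (real ^ 'd) set"
  note wm [measurable] = borel_measurable_integrable[OF w]
  define A where "A = {x \<in> ?Q. Re (w x) > 0} \<inter> ?B"
  have "{x \<in> space torus. Re (w x) > 0} \<in> sets torus" by measurable
  then have "{x \<in> ?Q. Re (w x) > 0} \<in> sets lebesgue"
    unfolding space_torus by (simp add: torus_def sets_restrict_space_iff)
  then have A: "A \<in> sets lebesgue" unfolding A_def by (intro sets.Int) auto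
  have "bounded A" unfolding A_def using bounded_box bounded_subset by blast
  then have Alm: "A \<in> lmeasurable" using A by (rule bounded_set_imp_lmeasurable)
  have null: "T \<in> null_sets lebesgue" if T: "closed T" "T \<subseteq> A" for T
  proof -
    have "compact T" using T \<open>bounded A\<close> bounded_subset compact_eq_bounded_closed by blast
    moreover have "T \<subseteq> ?B" using T by (auto simp: A_def)
    ultimately have z: "(LINT x|torus. w x * indicator T x) = 0"
      by (intro integral_compact_eq_0 w 0)
    have Tb: "T \<in> sets lebesgue" using T by auto
    have Tm: "(indicator T :: real ^ 'd \<Rightarrow> complex) \<in> borel_measurable torus"
      using Tb unfolding torus_def by (intro measurable_restrict_space1 borel_measurable_indicator)
    have i: "integrable torus (\<lambda>x. w x * indicator T x)"
    proof (rule Bochner_Integration.integrable_bound[OF w])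
      show "(\<lambda>x. w x * indicator T x) \<in> borel_measurable torus" using Tm by measurable
      show "AE x in torus. norm (w x * indicator T x) \<le> norm (w x)"
        by (intro AE_I2) (simp add: norm_mult indicator_def)
    qed
    have "(LINT x|torus. Re (w x * indicator T x)) = 0"
      using integral_Re[OF i] z by simp
    moreover have nn: "0 \<le> Re (w x * indicator T x)" for x
      using T by (auto simp: indicator_def A_def)
    ultimately have "AE x in torus. Re (w x * indicator T x) = 0"
      using integral_nonneg_eq_0_iff_AE[OF integrable_Re[OF i]] by simp
    then have "AE x in torus. x \<notin> T"
      by (rule eventually_mono) (use T in \<open>auto simp: A_def indicator_def\<close>)
    then have "AE x in lebesgue. x \<in> ?Q \<longrightarrow> x \<notin> T"
      unfolding torus_def by (subst (asm) AE_restrict_space_iff) auto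
    then have "AE x in lebesgue. x \<notin> T"
      by (rule eventually_mono) (use T in \<open>auto simp: A_def\<close>)
    then show ?thesis using Tb by (simp add: AE_iff_null_sets)
  qed
  have small: "emeasure lebesgue A \<le> ennreal e" if e: "e > 0" for e
  proof -
    obtain T where T: "closed T" "T \<subseteq> A" "A - T \<in> lmeasurable" "emeasure lebesgue (A - T) < ennreal e"
      by (rule sets_lebesgue_inner_closed[OF A e])
    have "emeasure lebesgue A = emeasure lebesgue (A - T)"
      using null[OF T(1,2)] A by (simp add: emeasure_Diff_null_set)
    then show ?thesis using T(4) by simp
  qed
  have "emeasure lebesgue A \<le> 0"
    by (rule ennreal_le_epsilon) (simp add: small)
  then have "A \<in> null_sets lebesgue" using A by (intro null_setsI) auto
  then have "AE x in lebesgue. x \<notin> A" by (rule AE_not_in)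
  then have "AE x in torus. x \<notin> A"
    unfolding torus_def by (subst AE_restrict_space_iff) (auto elim!: eventually_mono)
  then show ?thesis
    using AE_torus_interior AE_space
  proof eventually_elim
    case (elim x)
    then show ?case by (auto simp: A_def space_torus)
  qed
qed

theorem fourier_coeff_unique:
  fixes u v :: "real ^ 'd::finite \<Rightarrow> complex"
  assumes u: "integrable torus u" and v: "integrable torus v"
    and eq: "\<And>k. fourier_coeff u k = fourier_coeff v k"
  shows "AE x in torus. u x = v x"
proof -
  define w where "w x = u x - v x" for x
  have w: "integrable torus w" unfolding w_def using u v by simp
  have 0: "fourier_coeff w k = 0" for k
  proof -
    have "(LINT x|torus. w x * cnj (torus_char k x)) =
      (LINT x|torus. u x * cnj (torus_char k x)) - (LINT x|torus. v x * cnj (torus_char k x))"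
      unfolding w_def left_diff_distrib
      by (intro Bochner_Integration.integral_diff torus_integrable_cnj_char u v)
    then show ?thesis using eq[of k] unfolding fourier_coeff_char by (simp add: diff_divide_distrib)
  qed
  have c: "AE x in torus. Re (c * w x) \<le> 0" for c
  proof (rule AE_Re_nonpos_if_coeffs_0)
    show "integrable torus (\<lambda>x. c * w x)" using w by simp
    show "fourier_coeff (\<lambda>x. c * w x) k = 0" for k
      using 0[of k] unfolding fourier_coeff_char by (simp add: mult.assoc)
  qed
  \<comment> \<open>the four units bound the real and imaginary parts of \<open>w\<close> from both sides\<close>
  show ?thesis
    using c[of 1] c[of "-1"] c[of "\<i>"] c[of "- \<i>"]
  proof eventually_elim
    case (elim x)
    then have "w x = 0" by (simp add: complex_eq_iff)
    then show ?case by (simp add: w_def)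
  qed
qed

text \<open>
Bessel's inequality is one half. For the other half, the function with the same coefficients provided by Riesz--Fischer has norm at
most the sum, and it agrees with \<open>u\<close> almost everywhere by uniqueness.
\<close>

theorem parseval:
  fixes u :: "real ^ 'd::finite \<Rightarrow> complex"
  assumes u: "u \<in> torus_L2"
  shows "((\<lambda>k. (2 * pi) ^ CARD('d) * (cmod (fourier_coeff u k))\<^sup>2) has_sum (L2_norm u)\<^sup>2) UNIV"
proof -
  let ?N = "(2 * pi) ^ CARD('d)"
  let ?I = "LINT x|torus. (cmod (u x))\<^sup>2"
  have nrm: "(L2_norm u)\<^sup>2 = ?I" by (simp add: L2_norm_def)
  have summ: "(\<lambda>k. ?N * (cmod (fourier_coeff u k))\<^sup>2) summable_on UNIV"
    using bessel_inequality[OF u]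
    by (intro nonneg_bounded_partial_sums_imp_summable_on[where C = ?I])
      (auto simp: sum_distrib_left intro!: eventually_finite_subsets_at_top_weakI)
  have summ': "(\<lambda>k. (cmod (fourier_coeff u k))\<^sup>2) summable_on UNIV"
    using summable_on_cmult_right[OF summ, of "1 / ?N"] by simp
  have le: "(\<Sum>\<^sub>\<infinity>k. ?N * (cmod (fourier_coeff u k))\<^sup>2) \<le> ?I"
    using bessel_inequality[OF u] by (intro infsum_le_finite_sums[OF summ]) (auto simp: sum_distrib_left)
  obtain v where v: "v \<in> torus_L2" "\<And>k. fourier_coeff v k = fourier_coeff u k"
    "(LINT x|torus. (cmod (v x))\<^sup>2) \<le> ?N * (\<Sum>\<^sub>\<infinity>k. (cmod (fourier_coeff u k))\<^sup>2)"
    using riesz_fischer[OF summ'] by blast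
  have "AE x in torus. u x = v x"
    by (intro fourier_coeff_unique torus_L2_integrable(1) u v(1)) (simp add: v(2))
  then have "?I = (LINT x|torus. (cmod (v x))\<^sup>2)"
    using torus_L2_integrable(4)[OF u] torus_L2_integrable(4)[OF v(1)]
    by (intro integral_cong_AE) (auto elim!: eventually_mono)
  with v(3) have "?I \<le> (\<Sum>\<^sub>\<infinity>k. ?N * (cmod (fourier_coeff u k))\<^sup>2)"
    by (simp add: infsum_cmult_right')
  with le have "(\<Sum>\<^sub>\<infinity>k. ?N * (cmod (fourier_coeff u k))\<^sup>2) = (L2_norm u)\<^sup>2" using nrm by simp
  then show ?thesis using has_sum_infsum[OF summ] by simp
qed

section \<open>Absolutely convergent series and the uniform norm\<close>

definition trig_series :: "(int ^ 'd::finite \<Rightarrow> complex) \<Rightarrow> real ^ 'd \<Rightarrow> complex" where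
  "trig_series a x = (\<Sum>\<^sub>\<infinity>k. a k * torus_char k x)"

context
  fixes a :: "int ^ 'd::finite \<Rightarrow> complex"
  assumes abs_a: "(\<lambda>k. norm (a k)) summable_on UNIV"
begin

lemma trig_series_uniform_limit:
  "uniform_limit UNIV (\<lambda>F. trig_sum F a) (trig_series a) (finite_subsets_at_top UNIV)"
  using Weierstrass_m_test_general[of UNIV UNIV "\<lambda>k x. a k * torus_char k x" "\<lambda>k. norm (a k)", OF _ abs_a]
  by (simp add: norm_mult trig_sum_def[abs_def] trig_series_def[abs_def])

lemma continuous_trig_series: "continuous_on UNIV (trig_series a)"
  by (rule uniform_limit_theorem[OF _ trig_series_uniform_limit])
    (auto intro: always_eventually continuous_trig_sum)

lemma torus_periodic_trig_series: "torus_periodic (trig_series a)"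
  by (simp add: torus_periodic_def trig_series_def torus_periodic_char[unfolded torus_periodic_def, rule_format])

lemma norm_trig_series_le: "norm (trig_series a x) \<le> (\<Sum>\<^sub>\<infinity>k. norm (a k))"
  unfolding trig_series_def
  by (rule order_trans[OF norm_infsum_bound]) (use abs_a in \<open>simp_all add: norm_mult\<close>)

lemma trig_series_L2: "trig_series a \<in> torus_L2"
proof -
  have m [measurable]: "trig_series a \<in> borel_measurable torus"
    by (rule continuous_on_torus_borel[OF continuous_trig_series])
  have "norm ((cmod (trig_series a x))\<^sup>2) \<le> (\<Sum>\<^sub>\<infinity>k. norm (a k))\<^sup>2" for x
    by (simp add: power_mono norm_trig_series_le)
  then have "integrable torus (\<lambda>x. (cmod (trig_series a x))\<^sup>2)"
    by (intro bounded_torus_integrable[where B = "(\<Sum>\<^sub>\<infinity>k. norm (a k))\<^sup>2"]) auto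
  then show ?thesis by (simp add: torus_L2_def torus_periodic_trig_series m)
qed

lemma fourier_coeff_trig_series: "fourier_coeff (trig_series a) k = a k"
proof -
  let ?N = "(2 * pi) ^ CARD('d)"
  have near: "dist (fourier_coeff (trig_series a) k) (a k) \<le> e" if e: "e > 0" for e
  proof -
    have "\<forall>\<^sub>F F in finite_subsets_at_top UNIV. \<forall>x\<in>UNIV. dist (trig_sum F a x) (trig_series a x) < e"
      using trig_series_uniform_limit e by (rule uniform_limitD)
    moreover have "\<forall>\<^sub>F F in finite_subsets_at_top UNIV. finite F \<and> {k} \<subseteq> F"
      unfolding eventually_finite_subsets_at_top by (intro exI[of _ "{k}"]) auto
    ultimately have "\<forall>\<^sub>F F in finite_subsets_at_top (UNIV :: (int ^ 'd) set). (\<forall>x. dist (trig_sum F a x) (trig_series a x) < e) \<and> finite F \<and> k \<in> F"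
      by eventually_elim auto
    then obtain F where F: "\<And>x. norm (trig_series a x - trig_sum F a x) < e" "finite F" "k \<in> F"
      using eventually_happens'[OF finite_subsets_at_top_neq_bot] by (fastforce simp: dist_norm norm_minus_commute)
    have i: "integrable torus (\<lambda>x. trig_series a x * cnj (torus_char k x))"
      "integrable torus (\<lambda>x. trig_sum F a x * cnj (torus_char k x))"
      by (intro torus_integrable_cnj_char torus_L2_integrable(1) trig_series_L2 trig_sum_L2)+
    have "norm ((LINT x|torus. trig_series a x * cnj (torus_char k x)) - (LINT x|torus. trig_sum F a x * cnj (torus_char k x)))
      = norm (LINT x|torus. trig_series a x * cnj (torus_char k x) - trig_sum F a x * cnj (torus_char k x))"
      by (simp only: Bochner_Integration.integral_diff[OF i])
    also have "\<dots> \<le> (LINT x|(torus :: (real ^ 'd) measure). e)"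
    proof (rule Bochner_Integration.integral_norm_bound_integral)
      fix x
      have "trig_series a x * cnj (torus_char k x) - trig_sum F a x * cnj (torus_char k x) =
        (trig_series a x - trig_sum F a x) * cnj (torus_char k x)" by (simp add: algebra_simps)
      then show "norm (trig_series a x * cnj (torus_char k x) - trig_sum F a x * cnj (torus_char k x)) \<le> e"
        using F(1)[of x] by (simp add: norm_mult)
    qed (use i finite_measure_torus finite_measure.integrable_const in auto)
    also have "\<dots> = ?N * e" by (simp add: measure_torus)
    finally have "norm (fourier_coeff (trig_series a) k - fourier_coeff (trig_sum F a) k) \<le> e"
      unfolding fourier_coeff_char diff_divide_distrib[symmetric] norm_divide
      by (subst pos_divide_le_eq) (simp_all add: norm_mult norm_power mult.commute[of e])
    then show ?thesis using F by (simp add: fourier_coeff_trig_sum dist_norm)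
  qed
  have "dist (fourier_coeff (trig_series a) k) (a k) \<le> 0"
  proof (rule field_le_epsilon)
    fix e :: real assume "e > 0"
    from near[OF this] show "dist (fourier_coeff (trig_series a) k) (a k) \<le> 0 + e" by simp
  qed
  then show ?thesis by simp
qed

end

text \<open>
The set of disagreement in the open cell is open and null, hence empty; the closed cell is the closure of
the open one.
\<close>

lemma continuous_AE_eq_on_torus:
  fixes v :: "real ^ 'd::finite \<Rightarrow> complex"
  assumes v: "continuous_on UNIV v" and w: "continuous_on UNIV w" and ae: "AE x in torus. v x = w x"
    and x: "x \<in> cbox 0 (\<chi> i. 2 * pi)"
  shows "v x = w x"
proof -
  let ?B = "box 0 (\<chi> i. 2 * pi) :: (real ^ 'd) set"
  let ?D = "{x \<in> ?B. v x \<noteq> w x}"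
  have "?D = ?B \<inter> (\<lambda>x. v x - w x) -` (- {0})" by auto
  also have "open \<dots>"
    using v w by (intro open_Int open_vimage continuous_intros) auto
  finally have op: "open ?D" .
  have "AE x in lebesgue. x \<in> cbox 0 (\<chi> i. 2 * pi) \<longrightarrow> v x = w x"
    using ae unfolding torus_def by (subst (asm) AE_restrict_space_iff) auto
  then have "AE x in lebesgue. x \<notin> ?D"
    by (rule eventually_mono) (use box_subset_cbox in blast)
  then have "?D \<in> null_sets lebesgue" using op by (subst AE_iff_null_sets) auto
  then have "?D = {}" using op open_not_negligible negligible_iff_null_sets by blast
  then have eq: "v y = w y" if "y \<in> ?B" for y using that by blast
  have "(\<chi> i. pi) \<in> ?B" by (simp add: mem_box_cart)
  then have "?B \<noteq> {}" by blast
  then have "closure ?B = cbox 0 (\<chi> i. 2 * pi)" by (rule closure_box)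
  then have "x \<in> closure ?B" using x by simp
  moreover have "closure ?B \<subseteq> {y. v y = w y}"
    using eq v w by (intro closure_minimal closed_Collect_eq) auto
  ultimately show ?thesis by blast
qed

lemma C_norm_le:
  assumes "continuous_on UNIV v" "torus_periodic v" "AE x in torus. v x = u x" "\<And>x. cmod (v x) \<le> M"
  shows "C_norm u \<le> ereal M"
proof -
  have "C_norm u \<le> (SUP x. ereal (cmod (v x)))"
    unfolding C_norm_def using assms by (intro INF_lower) auto
  also have "\<dots> \<le> ereal M" using assms(4) by (intro SUP_least) simp
  finally show ?thesis .
qed

lemma C_norm_nonneg: "0 \<le> C_norm u"
  unfolding C_norm_def
proof (rule INF_greatest)
  fix v :: "real ^ 'a \<Rightarrow> complex"
  have "ereal (cmod (v 0)) \<le> (SUP x. ereal (cmod (v x)))" by (rule SUP_upper) simp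
  then show "0 \<le> (SUP x. ereal (cmod (v x)))" by (rule order_trans[rotated]) simp
qed

text \<open>
All continuous representatives agree on the closed period cell, in particular at the origin.
\<close>

lemma C_norm_ge:
  fixes u :: "real ^ 'd::finite \<Rightarrow> complex"
  assumes u: "continuous_on UNIV u"
  shows "ereal (cmod (u 0)) \<le> C_norm u"
  unfolding C_norm_def
proof (rule INF_greatest)
  fix v assume "v \<in> {v. continuous_on UNIV v \<and> torus_periodic v \<and> (AE x in torus. v x = u x)}"
  then have "v 0 = u 0" using u by (intro continuous_AE_eq_on_torus) (auto simp: mem_box_cart)
  then show "ereal (cmod (u 0)) \<le> (SUP x. ereal (cmod (v x)))" by (intro SUP_upper2[of 0]) auto
qed

text \<open>
Multiplication by \<open>c\<close> maps continuous representatives of \<open>u/c\<close> to those of \<open>u\<close>.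
\<close>

lemma C_norm_scale:
  fixes u :: "real ^ 'd::finite \<Rightarrow> complex"
  assumes c: "c > 0"
  shows "C_norm u \<le> ereal c * C_norm (\<lambda>x. u x / of_real c)"
proof -
  let ?P = "\<lambda>v. continuous_on UNIV v \<and> torus_periodic v \<and> (AE x in torus. v x = u x / of_real c)"
  have "C_norm u / ereal c \<le> C_norm (\<lambda>x. u x / of_real c)"
    unfolding C_norm_def[of "\<lambda>x. u x / of_real c"]
  proof (rule INF_greatest)
    fix v assume "v \<in> {v. ?P v}"
    then have v: "continuous_on UNIV v" "torus_periodic v" "AE x in torus. v x = u x / of_real c" by auto
    have "C_norm u \<le> (SUP x. ereal (cmod (of_real c * v x)))"
      unfolding C_norm_def
    proof (rule INF_lower, intro CollectI conjI)
      show "continuous_on UNIV (\<lambda>x. of_real c * v x)" using v by (intro continuous_intros)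
      show "torus_periodic (\<lambda>x. of_real c * v x)" using v by (simp add: torus_periodic_def)
      show "AE x in torus. of_real c * v x = u x"
        using v(3) by (rule eventually_mono) (use c in simp)
    qed
    also have "\<dots> = (SUP x. ereal c * ereal (cmod (v x)))" using c by (simp add: norm_mult)
    also have "\<dots> = ereal c * (SUP x. ereal (cmod (v x)))"
      using c by (intro SUP_ereal_mult_left) auto
    finally show "C_norm u / ereal c \<le> (SUP x. ereal (cmod (v x)))"
      using c by (simp add: ereal_divide_le_pos mult.commute)
  qed
  then show ?thesis using c by (simp add: ereal_divide_le_pos mult.commute)
qed

lemma norm_freq_ge_1: "k \<noteq> 0 \<Longrightarrow> 1 \<le> norm (freq k)" for k :: "int ^ 'd::finite"
proof -
  assume "k \<noteq> 0"
  then obtain i where "k $ i \<noteq> 0" by (auto simp: vec_eq_iff)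
  then have "1 \<le> \<bar>freq k $ i\<bar>" by (simp add: freq_def)
  then show ?thesis using component_le_norm_cart[of "freq k" i] by linarith
qed

lemma freq_0 [simp]: "freq 0 = 0"
  by (simp add: freq_def vec_eq_iff)

lemma torus_H_L2: "u \<in> torus_H n \<Longrightarrow> u \<in> torus_L2"
  by (simp add: torus_H_def)

lemma fourier_coeff_0: "fourier_coeff u 0 = 0 \<longleftrightarrow> (LINT x|torus. u x) = 0"
  by (simp add: fourier_coeff_char)

text \<open>
The choice in the definition is justified by Riesz--Fischer: membership in \<open>H\<^sup>n\<close> makes \<open>|k|\<^sup>n u\<^sub>k\<close> square summable.
\<close>

lemma neg_laplacian_half_power:
  fixes u :: "real ^ 'd::finite \<Rightarrow> complex"
  assumes "u \<in> torus_H n"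
  shows "neg_laplacian_half_power n u \<in> torus_L2"
    and "fourier_coeff (neg_laplacian_half_power n u) k = of_real (norm (freq k) ^ n) * fourier_coeff u k"
proof -
  have "(\<lambda>k. (cmod (of_real (norm (freq k) ^ n) * fourier_coeff u k))\<^sup>2) summable_on UNIV"
  proof (rule summable_on_comparison_test)
    show "(\<lambda>k. (1 + (norm (freq k))\<^sup>2) ^ n * (cmod (fourier_coeff u k))\<^sup>2) summable_on UNIV"
      using assms by (simp add: torus_H_def)
    fix k :: "int ^ 'd"
    have "((norm (freq k))\<^sup>2) ^ n \<le> (1 + (norm (freq k))\<^sup>2) ^ n" by (intro power_mono) auto
    then show "(cmod (of_real (norm (freq k) ^ n) * fourier_coeff u k))\<^sup>2 \<le> (1 + (norm (freq k))\<^sup>2) ^ n * (cmod (fourier_coeff u k))\<^sup>2"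
    proof -
      have "(cmod (of_real (norm (freq k) ^ n) * fourier_coeff u k))\<^sup>2 = ((norm (freq k))\<^sup>2) ^ n * (cmod (fourier_coeff u k))\<^sup>2"
        by (simp add: norm_mult norm_power power_mult_distrib flip: power_mult) (simp add: mult.commute)
      then show ?thesis using \<open>((norm (freq k))\<^sup>2) ^ n \<le> (1 + (norm (freq k))\<^sup>2) ^ n\<close> by (simp only: mult_right_mono zero_le_power2)
    qed
  qed simp
  then obtain v where "v \<in> torus_L2" "\<And>k. fourier_coeff v k = of_real (norm (freq k) ^ n) * fourier_coeff u k"
    using riesz_fischer[of "\<lambda>k. of_real (norm (freq k) ^ n) * fourier_coeff u k"] by blast
  then have "\<exists>v. v \<in> torus_L2 \<and> (\<forall>k. fourier_coeff v k = complex_of_real (norm (freq k) ^ n) * fourier_coeff u k)" by blast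
  then have "neg_laplacian_half_power n u \<in> torus_L2 \<and>
    (\<forall>k. fourier_coeff (neg_laplacian_half_power n u) k = complex_of_real (norm (freq k) ^ n) * fourier_coeff u k)"
    unfolding neg_laplacian_half_power_def by (rule someI_ex)
  then show "neg_laplacian_half_power n u \<in> torus_L2"
    and "fourier_coeff (neg_laplacian_half_power n u) k = of_real (norm (freq k) ^ n) * fourier_coeff u k" by auto
qed

lemma neg_laplacian_parseval:
  fixes u :: "real ^ 'd::finite \<Rightarrow> complex"
  assumes "u \<in> torus_H n"
  shows "((\<lambda>k. (2 * pi) ^ CARD('d) * (norm (freq k) ^ (2 * n) * (cmod (fourier_coeff u k))\<^sup>2)) has_sum
    (L2_norm (neg_laplacian_half_power n u))\<^sup>2) UNIV"
proof -
  have "(cmod (of_real (norm (freq k) ^ n) * fourier_coeff u k))\<^sup>2 = norm (freq k) ^ (2 * n) * (cmod (fourier_coeff u k))\<^sup>2" for k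
    by (simp add: norm_mult norm_power power_mult_distrib flip: power_mult) (simp add: mult.commute)
  then show ?thesis
    using parseval[OF neg_laplacian_half_power(1)[OF assms]]
    by (simp only: neg_laplacian_half_power(2)[OF assms])
qed

text \<open>
Nonzero integer vectors have length at least one, and the coefficient at \<open>k = 0\<close> vanishes.
\<close>

lemma poincare:
  fixes u :: "real ^ 'd::finite \<Rightarrow> complex"
  assumes u: "u \<in> torus_H n" and mean: "(LINT x|torus. u x) = 0"
  shows "(L2_norm u)\<^sup>2 \<le> (L2_norm (neg_laplacian_half_power n u))\<^sup>2"
proof (rule has_sum_mono[OF parseval[OF torus_H_L2[OF u]] neg_laplacian_parseval[OF u]])
  fix k :: "int ^ 'd"
  have "(cmod (fourier_coeff u k))\<^sup>2 \<le> norm (freq k) ^ (2 * n) * (cmod (fourier_coeff u k))\<^sup>2"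
  proof (cases "k = 0")
    case True
    then show ?thesis using mean fourier_coeff_0[of u] by simp
  next
    case False
    then have "1 \<le> norm (freq k) ^ (2 * n)" by (intro one_le_power norm_freq_ge_1)
    then show ?thesis using mult_right_mono[of 1 "norm (freq k) ^ (2 * n)" "(cmod (fourier_coeff u k))\<^sup>2"] by simp
  qed
  then show "(2 * pi) ^ CARD('d) * (cmod (fourier_coeff u k))\<^sup>2 \<le>
     (2 * pi) ^ CARD('d) * (norm (freq k) ^ (2 * n) * (cmod (fourier_coeff u k))\<^sup>2)"
    by (intro mult_left_mono) auto
qed

section \<open>The extremal problem\<close>

lemma resolvent_at_0: "n > 0 \<Longrightarrow> resolvent n R 0 = 1 / R ^ (2 * n)"
  by (simp add: resolvent_def zero_power)

text \<open>
Cauchy--Schwarz with weights \<open>f(k) = 1/(|k|\<^sup>2\<^sup>n + R\<^sup>2\<^sup>n)\<close>: up to the factor \<open>(2\<pi>)\<^sup>d\<close>, the sum \<open>\<Sum> |u\<^sub>k|\<^sup>2/f(k)\<close> is the combination of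
the two norms on the right. The Fourier series of \<open>u\<close> thus converges absolutely, and its sum is the continuous representative.
\<close>

lemma C_norm_square_le:
  fixes u :: "real ^ 'd::finite \<Rightarrow> complex"
  assumes u: "u \<in> torus_H n" and mean: "(LINT x|torus. u x) = 0" and R: "R > 0"
    and summ: "(\<lambda>k :: int ^ 'd. resolvent n R (freq k)) summable_on UNIV"
  shows "(C_norm u)\<^sup>2 \<le> ereal (((L2_norm (neg_laplacian_half_power n u))\<^sup>2 + R ^ (2 * n) * (L2_norm u)\<^sup>2)
      * (\<Sum>\<^sub>\<infinity>k :: int ^ 'd. resolvent n R (freq k)) / (2 * pi) ^ CARD('d))"
proof -
  let ?N = "(2 * pi) ^ CARD('d)"
  define S where "S = (\<Sum>\<^sub>\<infinity>k :: int ^ 'd. resolvent n R (freq k))"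
  define W where "W = (L2_norm (neg_laplacian_half_power n u))\<^sup>2 + R ^ (2 * n) * (L2_norm u)\<^sup>2"
  define c where "c k = fourier_coeff u k" for k
  define f where "f k = resolvent n R (freq k)" for k :: "int ^ 'd"
  have f0: "f k > 0" for k using R unfolding f_def by (rule resolvent_pos)
  have W0: "W \<ge> 0" using R by (simp add: W_def)
  have S0: "S \<ge> 0" unfolding S_def using f0[unfolded f_def] by (intro infsum_nonneg less_imp_le)
  have "((\<lambda>k. ?N * (norm (freq k) ^ (2 * n) * (cmod (c k))\<^sup>2) + R ^ (2 * n) * (?N * (cmod (c k))\<^sup>2)) has_sum W) UNIV"
    unfolding W_def c_def
    by (intro has_sum_add has_sum_cmult_right neg_laplacian_parseval[OF u] parseval[OF torus_H_L2[OF u]])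
  moreover have "?N * (norm (freq k) ^ (2 * n) * (cmod (c k))\<^sup>2) + R ^ (2 * n) * (?N * (cmod (c k))\<^sup>2)
      = ?N * ((cmod (c k))\<^sup>2 / f k)" for k
    using f0[of k] by (simp add: f_def resolvent_def algebra_simps)
  ultimately have W: "((\<lambda>k. ?N * ((cmod (c k))\<^sup>2 / f k)) has_sum W) UNIV" by simp
  have fin: "(\<Sum>k\<in>F. cmod (c k)) \<le> sqrt (W * S / ?N)" if F: "finite F" for F
  proof -
    have "(\<Sum>k\<in>F. cmod (c k))\<^sup>2 = (\<Sum>k\<in>F. cmod (c k) / sqrt (f k) * sqrt (f k))\<^sup>2"
      using f0 by (intro arg_cong[where f = "\<lambda>x. x\<^sup>2"] sum.cong) (auto simp: less_imp_neq[symmetric])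
    also have "\<dots> \<le> (\<Sum>k\<in>F. (cmod (c k) / sqrt (f k))\<^sup>2) * (\<Sum>k\<in>F. (sqrt (f k))\<^sup>2)"
      by (rule Cauchy_Schwarz_ineq_sum)
    also have "\<dots> = (\<Sum>k\<in>F. ?N * ((cmod (c k))\<^sup>2 / f k)) / ?N * (\<Sum>k\<in>F. f k)"
    proof -
      have "(\<Sum>k\<in>F. ?N * ((cmod (c k))\<^sup>2 / f k)) / ?N = (\<Sum>k\<in>F. (cmod (c k))\<^sup>2 / f k)"
        by (simp only: sum_distrib_left[symmetric]) simp
      then show ?thesis using f0 by (simp add: power_divide less_imp_le)
    qed
    also have "\<dots> \<le> W / ?N * S"
    proof (rule mult_mono)
      show "(\<Sum>k\<in>F. ?N * ((cmod (c k))\<^sup>2 / f k)) / ?N \<le> W / ?N"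
        using f0 F by (intro divide_right_mono finite_sum_le_has_sum[OF W]) (auto simp: less_imp_le)
      show "(\<Sum>k\<in>F. f k) \<le> S"
        unfolding S_def f_def[symmetric] using F f0 summ[folded f_def]
        by (intro finite_sum_le_infsum) (auto simp: less_imp_le)
    qed (use W0 f0 in \<open>auto intro!: sum_nonneg simp: less_imp_le\<close>)
    finally show ?thesis by (intro real_le_rsqrt) simp
  qed
  have abs: "(\<lambda>k. cmod (c k)) summable_on UNIV"
    using fin by (intro nonneg_bounded_partial_sums_imp_summable_on[where C = "sqrt (W * S / ?N)"])
      (auto intro!: eventually_finite_subsets_at_top_weakI)
  have tot: "(\<Sum>\<^sub>\<infinity>k. cmod (c k)) \<le> sqrt (W * S / ?N)"
    using fin by (intro infsum_le_finite_sums[OF abs]) auto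
  have "AE x in torus. trig_series c x = u x"
    by (intro fourier_coeff_unique torus_L2_integrable(1) trig_series_L2 abs torus_H_L2[OF u])
      (simp add: fourier_coeff_trig_series[OF abs] c_def)
  then have "C_norm u \<le> ereal (sqrt (W * S / ?N))"
    by (rule C_norm_le[OF continuous_trig_series[OF abs] torus_periodic_trig_series[OF abs] _
          order_trans[OF norm_trig_series_le[OF abs] tot]])
  then have "(C_norm u)\<^sup>2 \<le> (ereal (sqrt (W * S / ?N)))\<^sup>2"
    unfolding power2_eq_square using C_norm_nonneg[of u] W0 S0 by (intro ereal_mult_mono) auto
  also have "\<dots> = ereal (W * S / ?N)"
    using W0 S0 by (simp add: power2_eq_square)
  finally show ?thesis unfolding W_def S_def .
qed

lemma Theta_le:
  fixes T :: "'d::finite itself"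
  assumes R: "R > 0" and summ: "(\<lambda>k :: int ^ 'd. resolvent n R (freq k)) summable_on UNIV"
  shows "Theta T n \<delta> \<le> ereal ((\<delta> + R ^ (2 * n)) * (\<Sum>\<^sub>\<infinity>k :: int ^ 'd. resolvent n R (freq k)) / (2 * pi) ^ CARD('d))"
  unfolding Theta_def
proof (rule Sup_least, clarify)
  fix u :: "real ^ 'd \<Rightarrow> complex"
  assume u: "u \<in> torus_H n" "(LINT x|torus. u x) = 0" "L2_norm u = 1"
  show "(C_norm u)\<^sup>2 \<le> ereal (((L2_norm (neg_laplacian_half_power n u))\<^sup>2 + R ^ (2 * n)) *
      (\<Sum>\<^sub>\<infinity>k :: int ^ 'd. resolvent n R (freq k)) / (2 * pi) ^ CARD('d))"
    using C_norm_square_le[OF u(1,2) R summ] u(3) by simp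
qed

lemma has_sum_diff_real:
  fixes f g :: "'a \<Rightarrow> real"
  assumes "(f has_sum a) A" "(g has_sum b) A"
  shows "((\<lambda>x. f x - g x) has_sum (a - b)) A"
  using has_sum_add[OF assms(1) has_sum_cmult_right[OF assms(2), of "-1"]] by simp

lemma infsum_remove_0:
  fixes f :: "int ^ 'd::finite \<Rightarrow> real"
  assumes "f summable_on UNIV"
  shows "((\<lambda>k. if k = 0 then 0 else f k) has_sum (infsum f UNIV - f 0)) UNIV"
proof -
  have "((\<lambda>k. if k = 0 then f 0 else 0) has_sum f 0) UNIV"
    by (rule has_sum_finite_neutralI[of "{0}"]) auto
  from has_sum_diff_real[OF has_sum_infsum[OF assms] this]
  have "((\<lambda>k. f k - (if k = 0 then f 0 else 0)) has_sum (infsum f UNIV - f 0)) UNIV" .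
  moreover have "(\<lambda>k. f k - (if k = 0 then f 0 else 0)) = (\<lambda>k. if k = 0 then 0 else f k)" by auto
  ultimately show ?thesis by simp
qed

text \<open>
The equality case of the Cauchy--Schwarz estimate behind \<open>Theta_le\<close>: coefficients proportional to \<open>f(k)\<close> for \<open>k \<noteq> 0\<close>. As all of them are nonnegative, the value at
the origin is the full sum \<open>F\<close>. The two norms follow from \<open>|k|\<^sup>2\<^sup>n f(k)\<^sup>2 = f(k) - R\<^sup>2\<^sup>n f(k)\<^sup>2\<close>, and the lower bound for the parameter is
the Poincare inequality.
\<close>

lemma Theta_extremal:
  fixes T :: "'d::finite itself" and n :: nat and R :: real
  defines "F \<equiv> (\<Sum>\<^sub>\<infinity>k :: int ^ 'd. resolvent n R (freq k)) - 1 / R ^ (2 * n)"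
    and "G \<equiv> (\<Sum>\<^sub>\<infinity>k :: int ^ 'd. resolvent n R (freq k) ^ 2) - 1 / R ^ (4 * n)"
  assumes n: "n > 0" and R: "R > 0"
    and summ1: "(\<lambda>k :: int ^ 'd. resolvent n R (freq k)) summable_on UNIV"
    and summ2: "(\<lambda>k :: int ^ 'd. resolvent n R (freq k) ^ 2) summable_on UNIV"
    and G: "G > 0" and F: "F \<ge> 0"
  shows "1 \<le> F / G - R ^ (2 * n)"
    and "ereal (F\<^sup>2 / ((2 * pi) ^ CARD('d) * G)) \<le> Theta T n (F / G - R ^ (2 * n))"
proof -
  let ?N = "(2 * pi) ^ CARD('d)"
  define f where "f k = (if k = 0 then 0 else resolvent n R (freq k))" for k :: "int ^ 'd"
  have f0: "f k \<ge> 0" for k using resolvent_pos[OF R, of n "freq k"] by (simp add: f_def)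
  have F_sum: "(f has_sum F) UNIV"
    using infsum_remove_0[OF summ1] by (simp add: f_def[abs_def] F_def resolvent_at_0[OF n])
  have "(\<lambda>k. (f k)\<^sup>2) = (\<lambda>k. if k = 0 then 0 else resolvent n R (freq k) ^ 2)" by (auto simp: f_def)
  then have G_sum: "((\<lambda>k. (f k)\<^sup>2) has_sum G) UNIV"
    using infsum_remove_0[OF summ2] by (simp add: G_def resolvent_at_0[OF n] power_one_over flip: power_mult)
  define g where "g = sqrt (?N * G)"
  have g: "g > 0" "g\<^sup>2 = ?N * G" using G by (auto simp: g_def)
  define a where "a k = complex_of_real (f k / g)" for k
  have na: "cmod (a k) = f k / g" for k using f0[of k] g by (simp add: a_def norm_divide)
  have abs: "(\<lambda>k. cmod (a k)) summable_on UNIV"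
    unfolding na using has_sum_cmult_left[OF F_sum, of "1 / g"] by (auto simp: summable_on_def)
  define u where "u = trig_series a"
  have coeff: "fourier_coeff u k = a k" for k unfolding u_def by (rule fourier_coeff_trig_series[OF abs])
  have L2: "u \<in> torus_L2" unfolding u_def by (rule trig_series_L2[OF abs])
  \<comment> \<open>\<open>|k|\<^sup>2\<^sup>n f\<^sub>k\<^sup>2 = f\<^sub>k - R\<^sup>2\<^sup>n f\<^sub>k\<^sup>2\<close> away from the origin\<close>
  have key: "norm (freq k) ^ (2 * n) * (f k)\<^sup>2 = f k - R ^ (2 * n) * (f k)\<^sup>2" for k
  proof (cases "k = 0")
    case False
    have "norm (freq k) ^ (2 * n) + R ^ (2 * n) > 0" using R by (simp add: add_nonneg_pos)
    then have "(norm (freq k) ^ (2 * n) + R ^ (2 * n)) * f k = 1" using False by (simp add: f_def resolvent_def)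
    then have "((norm (freq k) ^ (2 * n) + R ^ (2 * n)) * f k) * f k = f k" by simp
    then show ?thesis by (simp add: power2_eq_square algebra_simps)
  qed (simp add: f_def)
  have H: "u \<in> torus_H n"
  proof -
    have "(\<lambda>k. (1 + (norm (freq k))\<^sup>2) ^ n * (cmod (fourier_coeff u k))\<^sup>2) summable_on UNIV"
    proof (rule summable_on_comparison_test)
      show "(\<lambda>k. 2 ^ n / g\<^sup>2 * f k) summable_on UNIV"
        using F_sum by (intro summable_on_cmult_right) (auto simp: summable_on_def)
      fix k :: "int ^ 'd"
      have "(1 + (norm (freq k))\<^sup>2) ^ n * (f k)\<^sup>2 \<le> 2 ^ n * f k"
      proof (cases "k = 0")
        case False
        have "1 \<le> (norm (freq k))\<^sup>2" using norm_freq_ge_1[OF False] by (rule one_le_power)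
        then have "(1 + (norm (freq k))\<^sup>2) ^ n \<le> (2 * (norm (freq k))\<^sup>2) ^ n" by (intro power_mono) auto
        then have "(1 + (norm (freq k))\<^sup>2) ^ n * (f k)\<^sup>2 \<le> 2 ^ n * (norm (freq k) ^ (2 * n) * (f k)\<^sup>2)"
          by (simp add: power_mult_distrib power_mult mult_right_mono flip: mult.assoc)
        also have "\<dots> \<le> 2 ^ n * f k"
          unfolding key using R by (intro mult_left_mono) auto
        finally show ?thesis .
      qed (simp add: f_def)
      then have "(1 + (norm (freq k))\<^sup>2) ^ n * (f k)\<^sup>2 / g\<^sup>2 \<le> 2 ^ n * f k / g\<^sup>2" by (rule divide_right_mono) simp
      then show "(1 + (norm (freq k))\<^sup>2) ^ n * (cmod (fourier_coeff u k))\<^sup>2 \<le> 2 ^ n / g\<^sup>2 * f k"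
        by (simp add: coeff na power_divide)
    qed auto
    then show ?thesis using L2 by (simp add: torus_H_def)
  qed
  have mean: "(LINT x|torus. u x) = 0"
    using fourier_coeff_0[of u] by (simp add: coeff a_def f_def)
  have "(L2_norm u)\<^sup>2 = 1"
  proof (rule has_sum_unique[OF parseval[OF L2]])
    have "((\<lambda>k. ?N / g\<^sup>2 * (f k)\<^sup>2) has_sum ?N / g\<^sup>2 * G) UNIV" by (rule has_sum_cmult_right[OF G_sum])
    then show "((\<lambda>k. ?N * (cmod (fourier_coeff u k))\<^sup>2) has_sum 1) UNIV"
      using G g by (simp add: coeff na power_divide)
  qed
  moreover have "L2_norm u \<ge> 0" by (simp add: L2_norm_def)
  ultimately have norm1: "L2_norm u = 1" by (simp add: power2_eq_1_iff)
  have lap: "(L2_norm (neg_laplacian_half_power n u))\<^sup>2 = F / G - R ^ (2 * n)"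
  proof (rule has_sum_unique[OF neg_laplacian_parseval[OF H]])
    have "((\<lambda>k. ?N / g\<^sup>2 * (f k - R ^ (2 * n) * (f k)\<^sup>2)) has_sum ?N / g\<^sup>2 * (F - R ^ (2 * n) * G)) UNIV"
      by (intro has_sum_cmult_right has_sum_diff_real F_sum G_sum)
    moreover have "?N / g\<^sup>2 * (F - R ^ (2 * n) * G) = F / G - R ^ (2 * n)"
      using G g by (simp add: field_simps)
    moreover have "?N / g\<^sup>2 * (f k - R ^ (2 * n) * (f k)\<^sup>2) = ?N * (norm (freq k) ^ (2 * n) * (cmod (fourier_coeff u k))\<^sup>2)" for k
      by (simp add: coeff na power_divide flip: key)
    ultimately show "((\<lambda>k. ?N * (norm (freq k) ^ (2 * n) * (cmod (fourier_coeff u k))\<^sup>2)) has_sum F / G - R ^ (2 * n)) UNIV"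
      by simp
  qed
  show "1 \<le> F / G - R ^ (2 * n)" using poincare[OF H mean] norm1 lap by simp
  have "u 0 = of_real (F / g)"
  proof -
    have "((\<lambda>k. complex_of_real (f k / g)) has_sum of_real (F / g)) UNIV"
      using has_sum_cmult_left[OF F_sum, of "1 / g"] by (simp only: has_sum_of_real_iff) simp
    moreover have "torus_char k 0 = 1" for k :: "int ^ 'd" by (simp add: torus_char_def)
    ultimately show ?thesis unfolding u_def trig_series_def by (simp add: a_def infsumI)
  qed
  then have "ereal (F / g) \<le> C_norm u"
    using C_norm_ge[of u] continuous_trig_series[OF abs] F g by (simp add: u_def norm_divide)
  then have "(ereal (F / g))\<^sup>2 \<le> (C_norm u)\<^sup>2"
    unfolding power2_eq_square using F g C_norm_nonneg[of u] by (intro ereal_mult_mono) auto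
  also have "\<dots> \<le> Theta T n (F / G - R ^ (2 * n))"
    unfolding Theta_def using H mean norm1 lap by (intro Sup_upper) auto
  finally show "ereal (F\<^sup>2 / (?N * G)) \<le> Theta T n (F / G - R ^ (2 * n))"
    by (simp add: power_divide g(2))
qed

section \<open>The constants of the inequality\<close>

lemma c_const_eq:
  assumes "0 < d" "real d < 2 * real n"
  defines "a \<equiv> real d / (2 * real n)"
  shows "(2 * pi) ^ d * c_const d n = resolvent_mass d n / (a powr a * (1 - a) powr (1 - a))"
proof -
  have n: "real n > 0" using assms by simp
  have d: "real d = 2 * real n * a" using n by (simp add: a_def)
  have a: "0 < a" "a < 1" using assms n by (auto simp: a_def)
  have "real d powr a = (2 * real n) powr a * a powr a"
    unfolding d by (rule powr_mult)
  moreover have "(2 * real n - real d) powr (1 - a) = (2 * real n) powr (1 - a) * (1 - a) powr (1 - a)"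
  proof -
    have "2 * real n - real d = 2 * real n * (1 - a)" unfolding d by (simp add: algebra_simps)
    then show ?thesis by (simp only: powr_mult)
  qed
  moreover have "(2 * real n) powr a * (2 * real n) powr (1 - a) = 2 * real n"
    using n by (simp flip: powr_add)
  ultimately have D: "real d powr a * (2 * real n - real d) powr (1 - a) = 2 * real n * (a powr a * (1 - a) powr (1 - a))"
    by (simp add: mult_ac)
  have "(2 * pi) ^ d * c_const d n = pi * sphere_area d / (sin (pi * a) * (real d powr a * (2 * real n - real d) powr (1 - a)))"
    by (simp add: c_const_def a_def mult.assoc)
  also have "\<dots> = resolvent_mass d n / (a powr a * (1 - a) powr (1 - a))"
    unfolding D resolvent_mass_def by (simp add: a_def mult_ac)
  finally show ?thesis .
qed

text \<open>
Young's inequality \<open>(\<delta>/a)\<^sup>a (\<mu>/(1-a))\<^bsup>1-a\<^esup> \<le> \<delta> + \<mu>\<close> with \<open>\<mu> = R\<^sup>2\<^sup>n\<close>, multiplied by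
\<open>\<integral> f = I \<mu>\<^bsup>a-1\<^esup>\<close>. Equality holds when \<open>\<delta>/a = \<mu>/(1 - a)\<close>.
\<close>

lemma c_const_weighted_mean:
  assumes d: "0 < d" "real d < 2 * real n" and \<delta>: "\<delta> > 0" and R: "R > 0"
  defines "a \<equiv> real d / (2 * real n)"
  shows "(2 * pi) ^ d * c_const d n * \<delta> powr a \<le> (\<delta> + R ^ (2 * n)) * (resolvent_mass d n * R ^ d / R ^ (2 * n))"
    and "R ^ (2 * n) = \<delta> * (1 - a) / a \<Longrightarrow>
      (2 * pi) ^ d * c_const d n * \<delta> powr a = (\<delta> + R ^ (2 * n)) * (resolvent_mass d n * R ^ d / R ^ (2 * n))"
proof -
  have n: "real n > 0" using d by simp
  have a: "0 < a" "a < 1" using d n by (auto simp: a_def)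
  define \<mu> where "\<mu> = R ^ (2 * n)"
  define I where "I = resolvent_mass d n"
  have I: "I > 0" unfolding I_def using d by (rule resolvent_mass_eq(3))
  have \<mu>: "\<mu> > 0" using R by (simp add: \<mu>_def)
  have \<mu>a: "\<mu> powr (1 - a) = R ^ (2 * n) / R ^ d"
  proof -
    have "\<mu> powr a = R powr (real (2 * n) * a)"
      unfolding \<mu>_def using R by (simp add: powr_powr flip: powr_realpow)
    also have "real (2 * n) * a = real d" using n by (simp add: a_def)
    finally have "\<mu> powr a = R ^ d" using R by (simp add: powr_realpow)
    then show ?thesis using \<mu> by (simp add: powr_diff \<mu>_def)
  qed
  let ?M = "(\<delta> / a) powr a * (\<mu> / (1 - a)) powr (1 - a)"
  have eq: "(2 * pi) ^ d * c_const d n * \<delta> powr a = ?M * (I * R ^ d / R ^ (2 * n))"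
  proof -
    have "?M = \<delta> powr a * \<mu> powr (1 - a) / (a powr a * (1 - a) powr (1 - a))"
      using a \<delta> \<mu> by (simp add: powr_divide)
    then have "?M * (I * R ^ d / R ^ (2 * n)) = \<delta> powr a * I / (a powr a * (1 - a) powr (1 - a)) * (\<mu> powr (1 - a) * (R ^ d / R ^ (2 * n)))"
      by simp
    also have "\<mu> powr (1 - a) * (R ^ d / R ^ (2 * n)) = 1" unfolding \<mu>a using R by simp
    finally show ?thesis unfolding I_def a_def c_const_eq[OF d] by simp
  qed
  have "?M \<le> a * (\<delta> / a) + (1 - a) * (\<mu> / (1 - a))"
    using a \<delta> \<mu> by (intro Youngs_inequality_0) auto
  also have "\<dots> = \<delta> + \<mu>" using a by simp
  finally have le: "?M \<le> \<delta> + \<mu>" .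
  show "(2 * pi) ^ d * c_const d n * \<delta> powr a \<le> (\<delta> + R ^ (2 * n)) * (resolvent_mass d n * R ^ d / R ^ (2 * n))"
    unfolding eq using le I R \<mu> unfolding I_def[symmetric] \<mu>_def[symmetric] by (intro mult_right_mono) auto
  assume "R ^ (2 * n) = \<delta> * (1 - a) / a"
  then have \<mu>\<delta>: "\<mu> / (1 - a) = \<delta> / a" using a by (simp add: \<mu>_def)
  have "?M = \<delta> / a" unfolding \<mu>\<delta> using a \<delta> by (simp flip: powr_add)
  also have "\<dots> = \<delta> + \<mu>"
  proof -
    have "\<mu> = (1 - a) * (\<delta> / a)" using \<mu>\<delta> a by (simp add: field_simps)
    then show ?thesis using a by (simp add: field_simps)
  qed
  finally show "(2 * pi) ^ d * c_const d n * \<delta> powr a = (\<delta> + R ^ (2 * n)) * (resolvent_mass d n * R ^ d / R ^ (2 * n))"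
    unfolding eq I_def \<mu>_def by simp
qed

lemma lattice_sum_first_power:
  assumes d: "real CARD('d::finite) < 2 * real n"
  shows "\<And>R. R > 0 \<Longrightarrow> (\<lambda>k :: int ^ 'd. resolvent n R (freq k)) summable_on UNIV"
    and "((\<lambda>R. R ^ (2 * n) * (\<Sum>\<^sub>\<infinity>k :: int ^ 'd. resolvent n R (freq k)) - resolvent_mass CARD('d) n * R ^ CARD('d)) \<longlongrightarrow> 0) at_top"
  using lattice_resolvent_sum_asymptotics[where 'd = 'd, of n 1] resolvent_mass_eq(1)[OF _ d] d by simp_all

lemma lattice_sum_second_power:
  assumes d: "real CARD('d::finite) < 2 * real n"
  shows "\<And>R. R > 0 \<Longrightarrow> (\<lambda>k :: int ^ 'd. resolvent n R (freq k) ^ 2) summable_on UNIV"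
    and "((\<lambda>R. R ^ (4 * n) * (\<Sum>\<^sub>\<infinity>k :: int ^ 'd. resolvent n R (freq k) ^ 2)
      - (1 - real CARD('d) / (2 * real n)) * (resolvent_mass CARD('d) n * R ^ CARD('d))) \<longlongrightarrow> 0) at_top"
  using lattice_resolvent_sum_asymptotics[where 'd = 'd, of n 2] d
  unfolding mult.assoc[symmetric, of "1 - real CARD('d) / (2 * real n)"] resolvent_mass_eq(2)[OF zero_less_card_finite d, symmetric]
  by simp_all

text \<open>
For large \<open>\<delta>\<close> the optimal scale \<open>R\<^sup>2\<^sup>n = \<delta>(1 - a)/a\<close> lies in the asymptotic range, where the sum exceeds the integral by at
most \<open>1/R\<^sup>2\<^sup>n\<close>; this costs the constant \<open>(\<delta> + R\<^sup>2\<^sup>n)/R\<^sup>2\<^sup>n = 1/(1 - a)\<close>. For the remaining bounded range of \<open>\<delta>\<close> one fixed scale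
bounds \<open>\<Theta>(\<delta>)\<close> by a constant.
\<close>

lemma Theta_le_c_const:
  fixes T :: "'d::finite itself"
  assumes d: "real CARD('d) < 2 * real n"
  obtains C where "\<And>\<delta>. \<delta> \<ge> 1 \<Longrightarrow> Theta T n \<delta> \<le> ereal (c_const CARD('d) n * \<delta> powr (real CARD('d) / (2 * real n)) + C)"
proof -
  let ?d = "CARD('d)" and ?N = "(2 * pi) ^ CARD('d)"
  define a where "a = real ?d / (2 * real n)"
  define I where "I = resolvent_mass ?d n"
  define S where "S R = (\<Sum>\<^sub>\<infinity>k :: int ^ 'd. resolvent n R (freq k))" for R
  have d0: "0 < ?d" by simp
  have n: "real n > 0" using d by (cases n) auto
  have a: "0 < a" "a < 1" using d n by (auto simp: a_def)
  have c0: "c_const ?d n \<ge> 0"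
  proof -
    have "(2 * pi) ^ ?d * c_const ?d n \<ge> 0"
      unfolding c_const_eq[OF d0 d] using resolvent_mass_eq(3)[OF d0 d] by simp
    moreover have "(2 * pi) ^ ?d > 0" by simp
    ultimately show ?thesis by (metis zero_le_mult_iff not_le)
  qed
  have Spos: "S R \<ge> 0" if "R > 0" for R
    unfolding S_def using that by (intro infsum_nonneg less_imp_le resolvent_pos)
  have "\<forall>\<^sub>F R in at_top. R ^ (2 * n) * S R - I * R ^ ?d < 1 \<and> R > 0"
    unfolding S_def I_def
    by (intro eventually_conj order_tendstoD(2)[OF lattice_sum_first_power(2)[OF d]] eventually_gt_at_top) simp
  then obtain R1 where R1: "\<And>R. R \<ge> R1 \<Longrightarrow> R ^ (2 * n) * S R - I * R ^ ?d < 1 \<and> R > 0"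
    by (auto simp: eventually_at_top_linorder)
  have R1pos: "R1 > 0" using R1[of R1] by simp
  define C1 where "C1 = 1 / ((1 - a) * ?N)"
  define C2 where "C2 = (R1 ^ (2 * n) * a / (1 - a) + R1 ^ (2 * n)) * S R1 / ?N"
  have C1: "C1 \<ge> 0" using a by (simp add: C1_def)
  have C2: "C2 \<ge> 0" using a R1pos Spos[OF R1pos] by (simp add: C2_def)
  show ?thesis
  proof
    fix \<delta> :: real assume \<delta>: "\<delta> \<ge> 1"
    \<comment> \<open>the scale at which the weighted mean inequality is an equality\<close>
    define R where "R = (\<delta> * (1 - a) / a) powr (1 / (2 * real n))"
    have base: "\<delta> * (1 - a) / a > 0" using a \<delta> by simp
    then have R: "R > 0" unfolding R_def by (subst powr_gt_zero) linarith
    have RR: "R ^ (2 * n) = \<delta> * (1 - a) / a"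
    proof -
      have "R ^ (2 * n) = R powr real (2 * n)" using R by (simp only: powr_realpow)
      also have "\<dots> = (\<delta> * (1 - a) / a) powr (1 / (2 * real n) * real (2 * n))"
        unfolding R_def by (rule powr_powr)
      also have "1 / (2 * real n) * real (2 * n) = 1" using n by simp
      also have "(\<delta> * (1 - a) / a) powr 1 = \<delta> * (1 - a) / a" using base by (subst powr_one) linarith+
      finally show ?thesis .
    qed
    have "Theta T n \<delta> \<le> ereal (c_const ?d n * \<delta> powr a + C1 + C2)"
    proof (cases "R \<ge> R1")
      case True
      have "Theta T n \<delta> \<le> ereal ((\<delta> + R ^ (2 * n)) * S R / ?N)"
        unfolding S_def by (rule Theta_le[OF R lattice_sum_first_power(1)[OF d R]])
      also have "\<dots> \<le> ereal ((\<delta> + R ^ (2 * n)) * ((I * R ^ ?d + 1) / R ^ (2 * n)) / ?N)"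
      proof -
        have "S R \<le> (I * R ^ ?d + 1) / R ^ (2 * n)"
          using R1[OF True] R by (simp add: pos_le_divide_eq mult.commute)
        then show ?thesis using \<delta> R
          by (intro ereal_less_eq(3)[THEN iffD2] divide_right_mono mult_left_mono) auto
      qed
      also have "(\<delta> + R ^ (2 * n)) * ((I * R ^ ?d + 1) / R ^ (2 * n)) / ?N = c_const ?d n * \<delta> powr a + C1"
      proof -
        have "(\<delta> + R ^ (2 * n)) * (I * R ^ ?d / R ^ (2 * n)) = ?N * c_const ?d n * \<delta> powr a"
          using c_const_weighted_mean(2)[OF d0 d _ R RR[unfolded a_def]] \<delta> by (simp add: I_def a_def)
        moreover have "(\<delta> + R ^ (2 * n)) / R ^ (2 * n) = 1 / (1 - a)"
          unfolding RR using a \<delta> by (simp add: field_simps)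
        moreover have "(\<delta> + R ^ (2 * n)) * ((I * R ^ ?d + 1) / R ^ (2 * n)) =
            (\<delta> + R ^ (2 * n)) * (I * R ^ ?d / R ^ (2 * n)) + (\<delta> + R ^ (2 * n)) / R ^ (2 * n)"
          by (simp add: add_divide_distrib distrib_left)
        ultimately show ?thesis by (simp add: C1_def add_divide_distrib)
      qed
      also have "ereal (c_const ?d n * \<delta> powr a + C1) \<le> ereal (c_const ?d n * \<delta> powr a + C1 + C2)"
        using C2 by simp
      finally show ?thesis .
    next
      case False
      have "\<delta> * (1 - a) / a \<le> R1 ^ (2 * n)"
        unfolding RR[symmetric] using False R by (intro power_mono) auto
      then have "\<delta> \<le> R1 ^ (2 * n) * a / (1 - a)" using a by (simp add: field_simps)
      then have le: "(\<delta> + R1 ^ (2 * n)) * S R1 / ?N \<le> C2"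
        unfolding C2_def using Spos[OF R1pos] by (intro divide_right_mono mult_right_mono) auto
      have nn: "0 \<le> c_const ?d n * \<delta> powr a" using c0 by simp
      have "Theta T n \<delta> \<le> ereal ((\<delta> + R1 ^ (2 * n)) * S R1 / ?N)"
        unfolding S_def by (rule Theta_le[OF R1pos lattice_sum_first_power(1)[OF d R1pos]])
      also have "\<dots> \<le> ereal (c_const ?d n * \<delta> powr a + C1 + C2)"
        unfolding ereal_less_eq(3) using le nn C1 by linarith
      finally show ?thesis .
    qed
    then show "Theta T n \<delta> \<le> ereal (c_const ?d n * \<delta> powr (real ?d / (2 * real n)) + (C1 + C2))"
      by (simp add: a_def add.assoc)
  qed
qed

text \<open>
At the extremal series, \<open>\<delta> + R\<^sup>2\<^sup>n = F/G\<close>. Bounding \<open>c\<^sub>d(n) \<delta>\<^sup>a\<close> by the weighted mean inequality at this same scale, instead of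
expanding it, leaves \<open>F (s/R\<^sup>2\<^sup>n - F)/G = y (s - y)/g\<close>, whose limit needs only the leading behaviour of \<open>y/g\<close> and of \<open>s - y\<close>.
\<close>

lemma K_const_upper:
  fixes T :: "'d::finite itself"
  assumes d: "real CARD('d) < 2 * real n"
  shows "K_const T n \<le> ereal (2 * real n / ((2 * pi) ^ CARD('d) * (2 * real n - real CARD('d))))"
proof -
  let ?d = "CARD('d)" and ?N = "(2 * pi) ^ CARD('d)"
  define a where "a = real ?d / (2 * real n)"
  define I where "I = resolvent_mass ?d n"
  define F where "F R = (\<Sum>\<^sub>\<infinity>k :: int ^ 'd. resolvent n R (freq k)) - 1 / R ^ (2 * n)" for R
  define G where "G R = (\<Sum>\<^sub>\<infinity>k :: int ^ 'd. resolvent n R (freq k) ^ 2) - 1 / R ^ (4 * n)" for R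
  define s where "s R = I * R ^ ?d" for R :: real
  define y where "y R = R ^ (2 * n) * F R" for R
  define g where "g R = R ^ (4 * n) * G R" for R
  have d0: "0 < ?d" by simp
  have n: "n > 0" using d by (cases n) auto
  have a: "0 < a" "a < 1" using d n by (auto simp: a_def)
  have I: "I > 0" unfolding I_def by (rule resolvent_mass_eq(3)[OF d0 d])
  have s_top: "filterlim s at_top at_top"
    unfolding s_def using I
    by (intro filterlim_tendsto_pos_mult_at_top[OF tendsto_const] filterlim_pow_at_top filterlim_ident) auto
  have inv_s: "((\<lambda>R. 1 / s R) \<longlongrightarrow> 0) at_top"
    by (intro tendsto_divide_0[OF tendsto_const] filterlim_at_top_imp_at_infinity s_top)
  have ev_s: "\<forall>\<^sub>F R in at_top. s R > 0 \<and> R > 0"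
    using eventually_gt_at_top[of "0 :: real"] by (rule eventually_mono) (simp add: s_def I)
  have y_lim: "((\<lambda>R. y R - s R) \<longlongrightarrow> - 1) at_top"
  proof (rule Lim_transform_eventually)
    show "((\<lambda>R. R ^ (2 * n) * (\<Sum>\<^sub>\<infinity>k :: int ^ 'd. resolvent n R (freq k)) - s R - 1) \<longlongrightarrow> - 1) at_top"
      using tendsto_diff[OF lattice_sum_first_power(2)[OF d] tendsto_const[of 1]] by (simp add: s_def I_def)
    show "\<forall>\<^sub>F R in at_top. R ^ (2 * n) * (\<Sum>\<^sub>\<infinity>k :: int ^ 'd. resolvent n R (freq k)) - s R - 1 = y R - s R"
      using ev_s by (rule eventually_mono) (simp add: y_def F_def algebra_simps)
  qed
  have g_lim: "((\<lambda>R. g R - (1 - a) * s R) \<longlongrightarrow> - 1) at_top"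
  proof (rule Lim_transform_eventually)
    show "((\<lambda>R. R ^ (4 * n) * (\<Sum>\<^sub>\<infinity>k :: int ^ 'd. resolvent n R (freq k) ^ 2) - (1 - a) * s R - 1) \<longlongrightarrow> - 1) at_top"
      using tendsto_diff[OF lattice_sum_second_power(2)[OF d] tendsto_const[of 1]] by (simp add: s_def I_def a_def)
    show "\<forall>\<^sub>F R in at_top. R ^ (4 * n) * (\<Sum>\<^sub>\<infinity>k :: int ^ 'd. resolvent n R (freq k) ^ 2) - (1 - a) * s R - 1 = g R - (1 - a) * s R"
      using ev_s by (rule eventually_mono) (simp add: g_def G_def algebra_simps)
  qed
  have ys: "((\<lambda>R. y R / s R) \<longlongrightarrow> 1) at_top"
  proof (rule Lim_transform_eventually)
    show "((\<lambda>R. (y R - s R) * (1 / s R) + 1) \<longlongrightarrow> 1) at_top"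
      using tendsto_add[OF tendsto_mult[OF y_lim inv_s] tendsto_const[of 1]] by simp
    show "\<forall>\<^sub>F R in at_top. (y R - s R) * (1 / s R) + 1 = y R / s R"
      using ev_s by (rule eventually_mono) (simp add: field_simps)
  qed
  have gs: "((\<lambda>R. g R / s R) \<longlongrightarrow> 1 - a) at_top"
  proof (rule Lim_transform_eventually)
    show "((\<lambda>R. (g R - (1 - a) * s R) * (1 / s R) + (1 - a)) \<longlongrightarrow> 1 - a) at_top"
      using tendsto_add[OF tendsto_mult[OF g_lim inv_s] tendsto_const[of "1 - a"]] by simp
    show "\<forall>\<^sub>F R in at_top. (g R - (1 - a) * s R) * (1 / s R) + (1 - a) = g R / s R"
      using ev_s by (rule eventually_mono) (simp add: field_simps)
  qed
  have lim: "((\<lambda>R. (y R / s R) / (g R / s R) * - (y R - s R)) \<longlongrightarrow> 1 / (1 - a) * - (- 1)) at_top"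
    using a by (intro tendsto_mult tendsto_divide tendsto_minus ys gs y_lim) auto
  have gs_pos: "\<forall>\<^sub>F R in at_top. 0 < g R / s R"
    using a by (intro order_tendstoD(1)[OF gs]) simp
  have ev: "\<forall>\<^sub>F R in at_top. K_const T n \<le> ereal ((y R / s R) / (g R / s R) * - (y R - s R) / ?N)"
    using ev_s order_tendstoD(1)[OF ys zero_less_one] gs_pos
  proof eventually_elim
    case (elim R)
    then have R: "R > 0" "s R > 0" "y R > 0" "g R > 0"
      by (auto simp: zero_less_divide_iff)
    have FG: "F R > 0" "G R > 0" using R by (auto simp: y_def g_def zero_less_mult_iff)
    define \<delta> where "\<delta> = F R / G R - R ^ (2 * n)"
    note extremal = n R(1) lattice_sum_first_power(1)[OF d R(1)] lattice_sum_second_power(1)[OF d R(1)]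
      FG(2)[unfolded G_def] less_imp_le[OF FG(1)[unfolded F_def]]
    have ext: "1 \<le> \<delta>" "ereal ((F R)\<^sup>2 / (?N * G R)) \<le> Theta T n \<delta>"
      unfolding \<delta>_def F_def G_def by (rule Theta_extremal[OF extremal])+
    define X where "X = c_const ?d n * \<delta> powr (real ?d / (2 * real n)) - (F R)\<^sup>2 / (?N * G R)"
    have "K_const T n \<le> ereal (c_const ?d n * \<delta> powr (real ?d / (2 * real n))) - Theta T n \<delta>"
      unfolding K_const_def using ext(1) by (intro INF_lower) auto
    also have "\<dots> \<le> ereal (c_const ?d n * \<delta> powr (real ?d / (2 * real n))) - ereal ((F R)\<^sup>2 / (?N * G R))"
      using ext(2) by (rule ereal_minus_mono[OF order_refl])
    also have "\<dots> = ereal X" by (simp add: X_def)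
    finally have KX: "K_const T n \<le> ereal X" .
    have "?N * X = ?N * (c_const ?d n * \<delta> powr (real ?d / (2 * real n)) - (F R)\<^sup>2 / (?N * G R))"
      by (simp add: X_def)
    also have "\<dots> = ?N * c_const ?d n * \<delta> powr (real ?d / (2 * real n)) - (F R)\<^sup>2 / G R"
      using FG by (simp add: right_diff_distrib)
    also have "\<dots> \<le> (\<delta> + R ^ (2 * n)) * (s R / R ^ (2 * n)) - (F R)\<^sup>2 / G R"
      using c_const_weighted_mean(1)[OF d0 d _ R(1), of \<delta>] ext(1) by (simp add: s_def I_def)
    also have "\<dots> = F R * (s R / R ^ (2 * n) - F R) / G R"
      by (simp add: \<delta>_def power2_eq_square algebra_simps diff_divide_distrib)
    also have "\<dots> = (y R / s R) / (g R / s R) * - (y R - s R)"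
    proof -
      have "(y R / s R) / (g R / s R) * - (y R - s R) = y R * (s R - y R) / g R" using R by simp
      also have "\<dots> = R ^ (2 * n) * F R * (s R - R ^ (2 * n) * F R) / (R ^ (2 * n) * (R ^ (2 * n) * G R))"
        unfolding y_def g_def by (simp flip: power_add mult.assoc)
      also have "\<dots> = F R * (s R - R ^ (2 * n) * F R) / (R ^ (2 * n) * G R)" using R(1) by simp
      also have "\<dots> = F R * (s R / R ^ (2 * n) - F R) / G R"
      proof -
        have "s R - R ^ (2 * n) * F R = R ^ (2 * n) * (s R / R ^ (2 * n) - F R)"
          using R(1) by (simp add: right_diff_distrib)
        then show ?thesis using R(1) by simp
      qed
      finally show ?thesis by simp
    qed
    finally have "X \<le> (y R / s R) / (g R / s R) * - (y R - s R) / ?N"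
      by (subst pos_le_divide_eq) (simp_all only: mult.commute zero_less_power mult_pos_pos pi_gt_zero zero_less_numeral)
    then show ?case using KX by (intro order_trans[OF KX]) simp
  qed
  have "((\<lambda>R. ereal ((y R / s R) / (g R / s R) * - (y R - s R) / ?N)) \<longlongrightarrow> ereal (1 / (1 - a) * - (- 1) / ?N)) at_top"
    by (intro tendsto_intros lim) simp
  from tendsto_lowerbound[OF this ev] have "K_const T n \<le> ereal (1 / (1 - a) / ?N)" by simp
  also have "1 / (1 - a) = 2 * real n / (2 * real n - real ?d)"
    using n a by (simp add: a_def field_simps)
  finally show ?thesis by (simp add: mult.commute)
qed

theorem theorem5p5:
  fixes n :: nat
  assumes "0 < n" and "2 * real n - real CARD('d::finite) > 0"
  shows "(\<forall>u :: real ^ 'd \<Rightarrow> complex. u \<in> torus_H n \<longrightarrow> (LINT x|torus. u x) = 0 \<longrightarrow>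
           (C_norm u)\<^sup>2
             \<le> ereal (c_const CARD('d) n * L2_norm u powr (2 - real CARD('d) / real n)
                        * L2_norm (neg_laplacian_half_power n u) powr (real CARD('d) / real n)
                      - real_of_ereal (K_const TYPE('d) n) * (L2_norm u)\<^sup>2))
       \<and> \<bar>K_const TYPE('d) n\<bar> \<noteq> \<infinity>
       \<and> K_const TYPE('d) n
           \<le> ereal (2 * real n / ((2 * pi) ^ CARD('d) * (2 * real n - real CARD('d))))"
proof -
  let ?d = "CARD('d)" and ?N = "(2 * pi) ^ CARD('d)" and ?K = "K_const TYPE('d) n"
  have d: "real ?d < 2 * real n" using assms by simp
  define a where "a = real ?d / (2 * real n)"
  define c where "c = c_const ?d n"
  obtain C where C: "\<And>\<delta>. \<delta> \<ge> 1 \<Longrightarrow> Theta TYPE('d) n \<delta> \<le> ereal (c * \<delta> powr a + C)"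
    using Theta_le_c_const[OF d, of "TYPE('d)"] unfolding a_def c_def by blast
  have "ereal (- C) \<le> ?K"
    unfolding K_const_def
  proof (rule INF_greatest)
    fix \<delta> :: real assume "\<delta> \<in> {1..}"
    then have "ereal (c * \<delta> powr a) - ereal (c * \<delta> powr a + C) \<le> ereal (c * \<delta> powr a) - Theta TYPE('d) n \<delta>"
      using C[of \<delta>] by (intro ereal_minus_mono) auto
    then show "ereal (- C) \<le> ereal (c_const ?d n * \<delta> powr (real ?d / (2 * real n))) - Theta TYPE('d) n \<delta>"
      by (simp add: a_def c_def)
  qed
  then have K_low: "?K \<noteq> - \<infinity>" by auto
  have upper: "?K \<le> ereal (2 * real n / (?N * (2 * real n - real ?d)))"
    by (rule K_const_upper[OF d])
  then have K_high: "?K \<noteq> \<infinity>" by auto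
  obtain \<kappa> where \<kappa>: "?K = ereal \<kappa>" using K_low K_high by (cases ?K) auto
  have Theta: "Theta TYPE('d) n \<delta> \<le> ereal (c * \<delta> powr a - \<kappa>)" if \<delta>: "\<delta> \<ge> 1" for \<delta>
  proof -
    have "ereal \<kappa> \<le> ereal (c * \<delta> powr a) - Theta TYPE('d) n \<delta>"
      unfolding \<kappa>[symmetric] K_const_def c_def a_def using \<delta> by (intro INF_lower) auto
    then show ?thesis by (cases "Theta TYPE('d) n \<delta>") auto
  qed
  have main: "(C_norm u)\<^sup>2 \<le> ereal (c * L2_norm u powr (2 - real ?d / real n)
        * L2_norm (neg_laplacian_half_power n u) powr (real ?d / real n) - \<kappa> * (L2_norm u)\<^sup>2)"
    if u: "u \<in> torus_H n" and mean: "(LINT x|torus. u x) = 0" for u :: "real ^ 'd \<Rightarrow> complex"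
  proof (cases "L2_norm u = 0")
    case True
    have "AE x in torus. (cmod (u x))\<^sup>2 = 0"
      using True torus_L2_integrable(3)[OF torus_H_L2[OF u]]
      by (simp add: L2_norm_def integral_nonneg_eq_0_iff_AE)
    then have "AE x in torus. 0 = u x" by (rule eventually_mono) simp
    then have "C_norm u \<le> ereal 0"
      by (intro C_norm_le[of "\<lambda>x. 0"]) (auto simp: torus_periodic_def)
    then have "C_norm u = 0" using C_norm_nonneg[of u] by (intro antisym) (simp_all add: zero_ereal_def)
    then show ?thesis using True by (simp add: power2_eq_square flip: zero_ereal_def)
  next
    case False
    define A where "A = L2_norm u"
    define B where "B = L2_norm (neg_laplacian_half_power n u)"
    have A: "A > 0" using False by (simp add: A_def L2_norm_def less_le)
    have B0: "B \<ge> 0" by (simp add: B_def L2_norm_def)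
    define w where "w x = u x / of_real A" for x
    have coeff: "fourier_coeff w k = fourier_coeff u k / of_real A" for k
      unfolding fourier_coeff_char w_def by (simp add: mult.commute)
    have L2: "w \<in> torus_L2"
    proof -
      note [measurable] = torus_L2_integrable(4)[OF torus_H_L2[OF u]]
      have "w \<in> borel_measurable torus" unfolding w_def by measurable
      moreover have "integrable torus (\<lambda>x. (cmod (w x))\<^sup>2)"
        using torus_L2_integrable(3)[OF torus_H_L2[OF u]] by (simp add: w_def norm_divide power_divide)
      moreover have "torus_periodic w"
        using torus_H_L2[OF u] by (simp add: torus_L2_def torus_periodic_def w_def)
      ultimately show ?thesis by (simp add: torus_L2_def)
    qed
    have H: "w \<in> torus_H n"
    proof -
      have "(\<lambda>k. (1 + (norm (freq k))\<^sup>2) ^ n * (cmod (fourier_coeff u k))\<^sup>2 * (1 / A\<^sup>2)) summable_on UNIV"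
        using u by (intro summable_on_cmult_left) (simp add: torus_H_def)
      then show ?thesis using L2 by (simp add: torus_H_def coeff norm_divide power_divide)
    qed
    have mean_w: "(LINT x|torus. w x) = 0" using mean by (simp add: w_def)
    have norm_w: "L2_norm w = 1"
    proof -
      have "(\<lambda>x. (cmod (w x))\<^sup>2) = (\<lambda>x. (cmod (u x))\<^sup>2 / A\<^sup>2)"
        using A by (simp add: w_def norm_divide power_divide)
      then have "L2_norm w = sqrt ((LINT x|torus. (cmod (u x))\<^sup>2) / A\<^sup>2)" by (simp add: L2_norm_def)
      also have "\<dots> = L2_norm u / A" using A by (simp add: real_sqrt_divide L2_norm_def)
      finally show ?thesis using A by (simp add: A_def)
    qed
    have lap_w: "(L2_norm (neg_laplacian_half_power n w))\<^sup>2 = (B / A)\<^sup>2"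
    proof (rule has_sum_unique[OF neg_laplacian_parseval[OF H]])
      have "((\<lambda>k. ?N * (norm (freq k) ^ (2 * n) * (cmod (fourier_coeff u k))\<^sup>2) * (1 / A\<^sup>2)) has_sum B\<^sup>2 * (1 / A\<^sup>2)) UNIV"
        unfolding B_def by (rule has_sum_cmult_left[OF neg_laplacian_parseval[OF u]])
      then show "((\<lambda>k. ?N * (norm (freq k) ^ (2 * n) * (cmod (fourier_coeff w k))\<^sup>2)) has_sum (B / A)\<^sup>2) UNIV"
        by (simp add: coeff norm_divide power_divide)
    qed
    have \<delta>1: "1 \<le> (B / A)\<^sup>2" using poincare[OF H mean_w] norm_w lap_w by simp
    then have B: "B > 0" using B0 by (cases "B = 0") auto
    have "(C_norm w)\<^sup>2 \<le> Theta TYPE('d) n ((B / A)\<^sup>2)"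
      unfolding Theta_def using H mean_w norm_w lap_w by (intro Sup_upper) auto
    also have "\<dots> \<le> ereal (c * ((B / A)\<^sup>2) powr a - \<kappa>)" by (rule Theta[OF \<delta>1])
    finally have Cw: "(C_norm w)\<^sup>2 \<le> ereal (c * ((B / A)\<^sup>2) powr a - \<kappa>)" .
    have "C_norm u \<le> ereal A * C_norm w" using C_norm_scale[OF A, of u] unfolding w_def .
    then have "(C_norm u)\<^sup>2 \<le> (ereal A * C_norm w) * (ereal A * C_norm w)"
      unfolding power2_eq_square using C_norm_nonneg[of u] C_norm_nonneg[of w] A by (intro ereal_mult_mono) auto
    also have "\<dots> = ereal (A\<^sup>2) * (C_norm w)\<^sup>2"
      by (simp add: power2_eq_square ac_simps flip: times_ereal.simps(1))
    also have "\<dots> \<le> ereal (A\<^sup>2) * ereal (c * ((B / A)\<^sup>2) powr a - \<kappa>)"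
      using Cw by (intro ereal_mult_left_mono) auto
    also have "\<dots> = ereal (c * (A\<^sup>2 * ((B / A)\<^sup>2) powr a) - \<kappa> * A\<^sup>2)"
      by (simp add: algebra_simps)
    also have "A\<^sup>2 * ((B / A)\<^sup>2) powr a = A powr (2 - real ?d / real n) * B powr (real ?d / real n)"
    proof -
      have "((B / A)\<^sup>2) powr a = ((B / A) powr 2) powr a" using A B by (simp add: powr_numeral)
      also have "\<dots> = (B / A) powr (real ?d / real n)" by (subst powr_powr) (simp add: a_def)
      also have "\<dots> = B powr (real ?d / real n) / A powr (real ?d / real n)" using A B by (simp add: powr_divide)
      finally show ?thesis using A by (simp add: powr_diff powr_numeral)
    qed
    finally show ?thesis by (simp add: A_def B_def mult.assoc)
  qed
  show ?thesis using main upper K_low K_high by (auto simp: \<kappa> c_def)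
qed

end
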